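(* Fix a prime power $q$ and $\varepsilon>0$. There are constants $C>c>0$ depending only on $q,\varepsilon$, and a function $\eta(n)\to0$ as $n\to\infty$, such that for all $n$ and all integers $m$ with $(2-\varepsilon)\log_q n\ge m\ge(1+\varepsilon)\log_q n$, \[ \frac{p_{n,m,q}}{p_{n,m}}=(1+\delta)\,G_q(x)\exp\left(-\theta\frac{n^3}{mq^{2m}}\right)\] for some $\delta,\theta$ with $|\delta|\le\eta(n)$ and $c\le\theta\le C$.
   Context: $p_{n,m}$ is the probability that a uniformly random permutation in $S_n$ has all cycles of length at most $m$. For a prime power $q$, $p_{n,m,q}$ is the probability that a uniformly random monic polynomial of degree $n$ over $\mathbb{F}_q$ has all irreducible factors of degree at most $m$. $x=x_{n,m}$ is the unique positive solution of $\sum_{i=1}^m x^i=n$. Let $\mathcal P$ be the set of monic irreducible polynomials over $\mathbb{F}_q$ and, for $|z|<q$, \[ G_q(z):=\prod_{P\in\mathcal P,\ \deg P\le m}\left(1-\left(\frac zq\right)^{\deg P}\right)^{-1}\exp\left(-\sum_{i=1}^m\frac{z^i}{i}\right).\] *)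

theory Defs
  imports
    "HOL-Probability.Probability"
    "HOL-Combinatorics.Combinatorics"
    "HOL-Computational_Algebra.Computational_Algebra"
begin

text \<open>
  The finite field with \<open>q\<close> elements is a type \<open>'a\<close> of sort \<open>{finite, field}\<close> with
  \<open>CARD('a) = q\<close> (\<open>q\<close> is then automatically a prime power). Objects depending on the field
  take an argument of type \<open>'a itself\<close>.
\<close>

text \<open>
  The cycle of \<open>\<pi>\<close> through \<open>i\<close> is \<open>orbit \<pi> i\<close>; a fixed point is a cycle of length 1.
\<close>
definition smooth_perm_prob :: "nat \<Rightarrow> nat \<Rightarrow> real" where
  "smooth_perm_prob n m =
     measure_pmf.prob (pmf_of_set {\<pi>. \<pi> permutes {1..n}})
       {\<pi>. \<forall>i\<in>{1..n}. card (orbit \<pi> i) \<le> m}"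

definition smooth_poly_prob :: "'a::{finite,field} itself \<Rightarrow> nat \<Rightarrow> nat \<Rightarrow> real" where
  "smooth_poly_prob _ n m =
     measure_pmf.prob (pmf_of_set {f :: 'a poly. degree f = n \<and> lead_coeff f = 1})
       {f. \<forall>P. irreducible P \<and> P dvd f \<longrightarrow> degree P \<le> m}"

definition saddle :: "nat \<Rightarrow> nat \<Rightarrow> real" where
  "saddle n m = (THE x. x > 0 \<and> (\<Sum>i=1..m. x ^ i) = real n)"

definition monic_irreducibles :: "'a::{finite,field} poly set" where
  "monic_irreducibles = {P. lead_coeff P = 1 \<and> irreducible P}"

text \<open>
  Meaningful for \<open>norm z < q\<close>; a factor can vanish (and its inverse is then 0 by convention)
  only outside this disc.
\<close>
definition Gq :: "'a::{finite,field} itself \<Rightarrow> nat \<Rightarrow> 'b::{real_normed_field,banach} \<Rightarrow> 'b" where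
  "Gq _ m z =
     (\<Prod>P \<in> {P \<in> monic_irreducibles :: 'a poly set. degree P \<le> m}.
        inverse (1 - (z / of_nat CARD('a)) ^ degree P)) *
     exp (- (\<Sum>i=1..m. z ^ i / of_nat i))"

lemma finite_degree_le: "finite {f :: 'a::{finite,field} poly. degree f \<le> n}"
proof (rule finite_surj)
  show "finite {xs :: 'a list. set xs \<subseteq> UNIV \<and> length xs \<le> Suc n}"
    by (rule finite_lists_length_le) simp
  show "{f :: 'a poly. degree f \<le> n} \<subseteq> Poly ` {xs. set xs \<subseteq> UNIV \<and> length xs \<le> Suc n}"
  proof
    fix f :: "'a poly" assume "f \<in> {f. degree f \<le> n}"
    then have "length (coeffs f) \<le> Suc n"
      by (cases "f = 0") (auto simp: length_coeffs_degree)
    then show "f \<in> Poly ` {xs. set xs \<subseteq> UNIV \<and> length xs \<le> Suc n}"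
      by (intro image_eqI[of _ _ "coeffs f"]) auto
  qed
qed

lemma finite_monic_degree_eq:
  "finite {f :: 'a::{finite,field} poly. degree f = n \<and> lead_coeff f = 1}"
  by (rule finite_subset[OF _ finite_degree_le[of n]]) auto

lemma monic_degree_eq_nonempty:
  "{f :: 'a::{finite,field} poly. degree f = n \<and> lead_coeff f = 1} \<noteq> {}"
proof -
  have "monom 1 n \<in> {f :: 'a poly. degree f = n \<and> lead_coeff f = 1}"
    by (simp add: degree_monom_eq)
  then show ?thesis by blast
qed

lemma finite_monic_irreducibles_le:
  "finite {P \<in> monic_irreducibles :: 'a::{finite,field} poly set. degree P \<le> m}"
  by (rule finite_subset[OF _ finite_degree_le[of m]]) auto

lemma saddle_ex1:
  assumes "0 < n" "0 < m"
  shows "\<exists>!x::real. x > 0 \<and> (\<Sum>i=1..m. x ^ i) = real n"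
proof -
  define f where "f x = (\<Sum>i=1..m. x ^ i)" for x :: real
  have mono: "f x < f y" if "0 \<le> x" "x < y" for x y
    unfolding f_def
  proof (rule sum_strict_mono)
    show "x ^ i < y ^ i" if "i \<in> {1..m}" for i
      using \<open>0 \<le> x\<close> \<open>x < y\<close> that by (intro power_strict_mono) auto
  qed (use assms in auto)
  have f0: "f 0 = 0"
    by (simp add: f_def power_0_left)
  have fn: "real n \<le> f (real n)"
  proof -
    have "(\<Sum>i\<in>{1}. real n ^ i) \<le> f (real n)"
      unfolding f_def using assms by (intro sum_mono2) auto
    then show ?thesis by simp
  qed
  have "\<exists>x\<ge>0. x \<le> real n \<and> f x = real n"
  proof (rule IVT')
    show "continuous_on {0..real n} f"
      unfolding f_def by (intro continuous_intros)
  qed (use f0 fn in auto)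
  then obtain x where x: "0 \<le> x" "f x = real n" by blast
  with f0 assms have "x > 0" by (cases "x = 0") auto
  moreover have "y = x" if "y > 0" "f y = real n" for y
    using mono[of x y] mono[of y x] x that by (cases x y rule: linorder_cases) auto
  ultimately show ?thesis
    using x unfolding f_def by blast
qed

end

theory Submission
  imports Defs "HOL-Complex_Analysis.Complex_Analysis" "HOL-Real_Asymp.Real_Asymp"
begin

text \<open>
  Both probabilities are coefficients \<open>h n\<close> of a power series \<open>exp (\<Sum>j. b j * z ^ j / j)\<close> with
  \<open>b j \<ge> 0\<close>: for permutations \<open>b j\<close> is \<open>1\<close> or \<open>0\<close> according to \<open>j \<le> m\<close>; for polynomials
  \<open>b j = q powr (- j) * (\<Sum>P. deg P)\<close>, the sum being over the monic irreducible \<open>P\<close> with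
  \<open>deg P \<le> m\<close> and \<open>deg P dvd j\<close>, so that \<open>b j = 1\<close> for \<open>j \<le> m\<close>. If \<open>\<Sum>j. b j * y ^ j = n\<close>, then
  \<open>h n * y ^ n\<close> divided by the value of the series at \<open>y\<close> is the probability that a sum of \<open>j\<close>
  times independent Poisson variables equals its mean \<open>n\<close>, and a local limit theorem gives its
  asymptotics \<open>1 / sqrt (2 * pi * V)\<close>. For permutations \<open>y\<close> is the saddle point \<open>x\<close>. For polynomials
  the terms with \<open>j > m\<close>, whose main contribution comes from \<open>j\<close> near \<open>2 * m\<close>, move it to
  \<open>x * exp (- s)\<close> with \<open>s\<close> of order \<open>n / (m * q ^ m)\<close>. The two variances agree asymptotically, and
  comparing the exponents at the two saddle points produces \<open>Gq m x\<close> and the loss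
  \<open>E = (\<Sum>j. b j * y ^ j / j * (exp (j * s) - 1 - j * s))\<close>, which has the order of magnitude
  \<open>s ^ 2 * n * m\<close>, that is \<open>n ^ 3 / (m * q ^ (2 * m))\<close>.
  Since the coefficient \<open>h n\<close> only depends on \<open>b j\<close> for \<open>j \<le> n\<close>, all sums can be truncated at \<open>n\<close>.
\<close>

section \<open>Permutations without long cycles\<close>

text \<open>The range of \<open>m\<close> enters through the size of \<open>x\<close>, which is
  \<open>n powr (1 / m)\<close> up to a factor that tends to 1. Once \<open>n\<close> is large, the
  upper bound on \<open>m\<close> keeps \<open>x\<close> above \<open>sqrt q\<close> by a fixed
  factor; the lower bound keeps it below \<open>q\<close> by a fixed factor and makes
  \<open>n / q ^ m\<close> at most \<open>n powr (- \<epsilon>)\<close>. This is what makes the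
  terms with \<open>j > m\<close> decay geometrically on both sides of \<open>2 * m\<close>, and
  their total is then of relative order \<open>n / q ^ m\<close>. The same ratio bounds the change
  of the variance and the part of \<open>ln (Gq m x)\<close> beyond index \<open>n\<close>. The
  local limit theorem loses \<open>sqrt (m / n)\<close> and a term exponentially small in
  \<open>n / m ^ 3\<close>, harmless because \<open>m\<close> is of order \<open>ln n\<close>. The
  loss \<open>E\<close> need not be small, so it is never expanded: it stays in the exponent,
  \<open>\<theta>\<close> is its quotient by the expected order of magnitude, and all that is needed
  are bounds on \<open>E\<close> from both sides. All estimates hold only for large
  \<open>n\<close>; for the other \<open>n\<close> any admissible \<open>\<theta>\<close> is taken
  and \<open>\<delta>\<close> is solved for.\<close>

text \<open>Defined over an arbitrary set and not only \<open>{1..n}\<close>, because removing the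
  cycle of a point leaves a permutation of the complement of that cycle.\<close>

definition smooth_perms :: "nat \<Rightarrow> 'a set \<Rightarrow> ('a \<Rightarrow> 'a) set" where
  "smooth_perms m A = {\<pi>. \<pi> permutes A \<and> (\<forall>i\<in>A. card (orbit \<pi> i) \<le> m)}"

definition cyclic_perms :: "'a set \<Rightarrow> ('a \<Rightarrow> 'a) set" where
  "cyclic_perms A = {\<pi>. \<pi> permutes A \<and> cyclic_on \<pi> A}"

lemma finite_smooth_perms: "finite A \<Longrightarrow> finite (smooth_perms m A)"
  by (rule finite_subset[OF _ finite_permutations[of A]]) (auto simp: smooth_perms_def)

lemma finite_cyclic_perms: "finite A \<Longrightarrow> finite (cyclic_perms A)"
  by (rule finite_subset[OF _ finite_permutations[of A]]) (auto simp: cyclic_perms_def)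

lemma perm_restrict_cyclic_permutes:
  assumes "finite A" "\<pi> permutes A" "cyclic_on \<pi> B"
  shows "perm_restrict \<pi> B permutes B"
proof -
  have "finite B" using assms(3) by (rule finite_cyclic_on)
  have "inj_on \<pi> B" using permutes_inj[OF assms(2)] by (rule inj_on_subset) simp
  moreover have "\<pi> ` B \<subseteq> B" using cyclic_on_inI[OF assms(3)] by blast
  ultimately have "bij_betw \<pi> B B"
    using \<open>finite B\<close> by (simp add: bij_betw_def endo_inj_surj)
  then have "bij_betw (perm_restrict \<pi> B) B B"
    by (rule bij_betw_cong[THEN iffD1, rotated]) (simp add: perm_restrict_simps)
  then show ?thesis
    by (rule bij_imp_permutes) (simp add: perm_restrict_simps)
qed

text \<open>The inverse map is composition: \<open>\<tau> \<circ> \<sigma>\<close> acts as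
  \<open>\<sigma>\<close> on \<open>B\<close> and as \<open>\<tau>\<close> off \<open>B\<close>, so
  its cycles are \<open>B\<close> itself and the cycles of \<open>\<tau>\<close>, and the bound on
  the cycle lengths splits accordingly.\<close>

lemma bij_betw_smooth_perms:
  assumes fin: "finite A" and a: "a \<in> A"
  shows "bij_betw (\<lambda>\<pi>. (orbit \<pi> a, perm_restrict \<pi> (orbit \<pi> a), perm_restrict \<pi> (A - orbit \<pi> a)))
    (smooth_perms m A)
    (SIGMA B:{B. a \<in> B \<and> B \<subseteq> A \<and> card B \<le> m}. cyclic_perms B \<times> smooth_perms m (A - B))"
proof -
  define f where "f \<pi> = (orbit \<pi> a, perm_restrict \<pi> (orbit \<pi> a), perm_restrict \<pi> (A - orbit \<pi> a))" for \<pi>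
  define g where "g = (\<lambda>(B :: 'a set, \<sigma> :: 'a \<Rightarrow> 'a, \<tau> :: 'a \<Rightarrow> 'a). \<tau> \<circ> \<sigma>)"
  define T where "T = (SIGMA B:{B. a \<in> B \<and> B \<subseteq> A \<and> card B \<le> m}. cyclic_perms B \<times> smooth_perms m (A - B))"
  have orbit_facts: "cyclic_on \<pi> (orbit \<pi> a)" "orbit \<pi> a \<subseteq> A" "a \<in> orbit \<pi> a"
    if "\<pi> permutes A" for \<pi>
    using that fin a by (auto intro!: cyclic_on_orbit permutation_self_in_orbit
        dest: permutes_orbit_subset simp: permutation_permutes)
  have gf: "g (f \<pi>) = \<pi>" if "\<pi> \<in> smooth_perms m A" for \<pi>
  proof -
    have \<pi>: "\<pi> permutes A" using that by (simp add: smooth_perms_def)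
    have "(A - orbit \<pi> a) \<union> orbit \<pi> a = A" using orbit_facts(2)[OF \<pi>] by auto
    then show ?thesis
      using perm_restrict_comp[OF _ orbit_facts(1)[OF \<pi>], of "A - orbit \<pi> a"] \<pi> by (auto simp: f_def g_def)
  qed
  have fT: "f \<pi> \<in> T" if "\<pi> \<in> smooth_perms m A" for \<pi>
  proof -
    have \<pi>: "\<pi> permutes A" and sm: "\<And>i. i \<in> A \<Longrightarrow> card (orbit \<pi> i) \<le> m"
      using that by (auto simp: smooth_perms_def)
    let ?O = "orbit \<pi> a"
    note O = orbit_facts[OF \<pi>]
    have "perm_restrict \<pi> ?O \<in> cyclic_perms ?O"
      using perm_restrict_cyclic_permutes[OF fin \<pi> O(1)] O(1)
      by (simp add: cyclic_perms_def cyclic_on_perm_restrict)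
    moreover have "perm_restrict \<pi> (A - ?O) \<in> smooth_perms m (A - ?O)"
      unfolding smooth_perms_def
    proof (intro CollectI conjI ballI)
      show perm: "perm_restrict \<pi> (A - ?O) permutes (A - ?O)"
        using \<pi> O(1) by (rule perm_restrict_diff_cyclic)
      fix i assume i: "i \<in> A - ?O"
      have "orbit (perm_restrict \<pi> (A - ?O)) i = orbit \<pi> i"
        by (rule orbit_cong0[OF i])
          (use permutes_in_image[OF perm] in \<open>auto simp: perm_restrict_simps\<close>)
      then show "card (orbit (perm_restrict \<pi> (A - ?O)) i) \<le> m"
        using sm i by simp
    qed
    ultimately show ?thesis
      using O sm[OF a] by (simp add: f_def T_def)
  qed
  have comp: "\<tau> \<circ> \<sigma> \<in> smooth_perms m A \<and> orbit (\<tau> \<circ> \<sigma>) a = B \<and> f (\<tau> \<circ> \<sigma>) = (B, \<sigma>, \<tau>)"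
    if "a \<in> B" "B \<subseteq> A" "card B \<le> m" "\<sigma> \<in> cyclic_perms B" "\<tau> \<in> smooth_perms m (A - B)" for B \<sigma> \<tau>
  proof -
    have \<sigma>: "\<sigma> permutes B" "cyclic_on \<sigma> B" and \<tau>: "\<tau> permutes (A - B)"
      using that by (auto simp: cyclic_perms_def smooth_perms_def)
    have onB: "(\<tau> \<circ> \<sigma>) i = \<sigma> i" "\<sigma> i \<in> B" if "i \<in> B" for i
      using permutes_in_image[OF \<sigma>(1)] that permutes_not_in[OF \<tau>, of "\<sigma> i"] by auto
    have offB: "(\<tau> \<circ> \<sigma>) i = \<tau> i" if "i \<notin> B" for i
      using permutes_not_in[OF \<sigma>(1) that] by simp
    have cyc: "cyclic_on (\<tau> \<circ> \<sigma>) B"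
      using \<sigma>(2) cyclic_cong[of B "\<tau> \<circ> \<sigma>" \<sigma>] onB by blast
    have orbB: "orbit (\<tau> \<circ> \<sigma>) i = B" if "i \<in> B" for i
      using cyc that by (rule orbit_cyclic_eq3)
    have "\<tau> \<circ> \<sigma> permutes A"
      using \<sigma>(1) \<tau> that(2) by (meson Diff_subset permutes_compose permutes_subset)
    moreover have "card (orbit (\<tau> \<circ> \<sigma>) i) \<le> m" if "i \<in> A" for i
    proof (cases "i \<in> B")
      case False
      have "orbit \<tau> i = orbit (\<tau> \<circ> \<sigma>) i"
        by (rule orbit_cong0[of _ "A - B"])
          (use False that permutes_in_image[OF \<tau>] offB in auto)
      moreover have "card (orbit \<tau> i) \<le> m"
        using \<open>\<tau> \<in> smooth_perms m (A - B)\<close> False that by (simp add: smooth_perms_def)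
      ultimately show ?thesis by simp
    qed (use orbB \<open>card B \<le> m\<close> in simp)
    moreover have "perm_restrict (\<tau> \<circ> \<sigma>) B = \<sigma>"
      using onB permutes_not_in[OF \<sigma>(1)] by (auto simp: perm_restrict_def fun_eq_iff)
    moreover have "perm_restrict (\<tau> \<circ> \<sigma>) (A - B) = \<tau>"
      using offB permutes_not_in[OF \<tau>] by (auto simp: perm_restrict_def fun_eq_iff)
    ultimately show ?thesis
      using orbB that(1) by (simp add: smooth_perms_def f_def)
  qed
  have "f (g t) = t \<and> g t \<in> smooth_perms m A" if "t \<in> T" for t
  proof -
    obtain B \<sigma> \<tau> where t: "t = (B, \<sigma>, \<tau>)" by (cases t)
    with that have "a \<in> B" "B \<subseteq> A" "card B \<le> m" "\<sigma> \<in> cyclic_perms B" "\<tau> \<in> smooth_perms m (A - B)"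
      by (simp_all add: T_def)
    from comp[OF this] show ?thesis by (simp add: t g_def)
  qed
  with gf fT have "bij_betw f (smooth_perms m A) T"
    by (intro bij_betw_byWitness[where f' = g] ballI image_subsetI) simp_all
  then show ?thesis unfolding f_def T_def by (simp only:)
qed

lemma card_smooth_perms_rec:
  assumes fin: "finite A" and a: "a \<in> A"
  shows "card (smooth_perms m A) =
    (\<Sum>B | a \<in> B \<and> B \<subseteq> A \<and> card B \<le> m. card (cyclic_perms B) * card (smooth_perms m (A - B)))"
proof -
  have finB: "finite {B. a \<in> B \<and> B \<subseteq> A \<and> card B \<le> m}"
    by (rule finite_subset[of _ "Pow A"]) (use fin in auto)
  have "card (smooth_perms m A) = card (SIGMA B:{B. a \<in> B \<and> B \<subseteq> A \<and> card B \<le> m}. cyclic_perms B \<times> smooth_perms m (A - B))"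
    using bij_betw_smooth_perms[OF assms] by (rule bij_betw_same_card)
  also have "\<dots> = (\<Sum>B | a \<in> B \<and> B \<subseteq> A \<and> card B \<le> m. card (cyclic_perms B \<times> smooth_perms m (A - B)))"
    by (intro card_SigmaI finB ballI finite_cartesian_product finite_cyclic_perms finite_smooth_perms)
      (use fin in \<open>auto intro: finite_subset\<close>)
  finally show ?thesis by (simp add: card_cartesian_product)
qed

lemma card_subsets_through:
  assumes fin: "finite A" and a: "a \<in> A" and j: "0 < j"
  shows "card {B. a \<in> B \<and> B \<subseteq> A \<and> card B = j} = (card A - 1) choose (j - 1)"
proof -
  have "bij_betw (insert a) {B. B \<subseteq> A - {a} \<and> card B = j - 1} {B. a \<in> B \<and> B \<subseteq> A \<and> card B = j}"
  proof (rule bij_betw_byWitness[where f' = "\<lambda>B. B - {a}"])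
    show "insert a ` {B. B \<subseteq> A - {a} \<and> card B = j - 1} \<subseteq> {B. a \<in> B \<and> B \<subseteq> A \<and> card B = j}"
    proof clarify
      fix B assume B: "B \<subseteq> A - {a}" "card B = j - 1"
      then have "a \<notin> B" "finite B" using fin by (auto intro: finite_subset)
      then show "a \<in> insert a B \<and> insert a B \<subseteq> A \<and> card (insert a B) = j"
        using B a j by auto
    qed
  qed (use a in \<open>auto simp: card_Diff_singleton\<close>)
  then have "card {B. a \<in> B \<and> B \<subseteq> A \<and> card B = j} = card {B. B \<subseteq> A - {a} \<and> card B = j - 1}"
    by (rule bij_betw_same_card[symmetric])
  also have "\<dots> = card (A - {a}) choose (j - 1)"
    by (rule n_subsets) (use fin in simp)
  finally show ?thesis using a by simp
qed

lemma sum_subsets_through: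
  fixes f :: "nat \<Rightarrow> real"
  assumes fin: "finite A" and a: "a \<in> A"
  shows "(\<Sum>B | a \<in> B \<and> B \<subseteq> A \<and> card B \<le> m. f (card B)) =
    (\<Sum>j=1..min m (card A). ((card A - 1) choose (j - 1)) * f j)"
proof -
  let ?S = "{B. a \<in> B \<and> B \<subseteq> A \<and> card B \<le> m}"
  have finS: "finite ?S" by (rule finite_subset[of _ "Pow A"]) (use fin in auto)
  have "(\<Sum>B\<in>?S. f (card B)) = (\<Sum>j\<in>{1..min m (card A)}. \<Sum>B | B \<in> ?S \<and> card B = j. f (card B))"
  proof (rule sum.group[OF finS, symmetric])
    show "card ` ?S \<subseteq> {1..min m (card A)}"
      using fin by (auto simp: card_mono Suc_le_eq card_gt_0_iff dest: finite_subset)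
  qed auto
  also have "\<dots> = (\<Sum>j=1..min m (card A). ((card A - 1) choose (j - 1)) * f j)"
  proof (rule sum.cong[OF refl])
    fix j assume j: "j \<in> {1..min m (card A)}"
    have "{B. B \<in> ?S \<and> card B = j} = {B. a \<in> B \<and> B \<subseteq> A \<and> card B = j}" using j by auto
    then have "(\<Sum>B | B \<in> ?S \<and> card B = j. f (card B)) = (\<Sum>B | a \<in> B \<and> B \<subseteq> A \<and> card B = j. f j)"
      by (intro sum.cong) auto
    then show "(\<Sum>B | B \<in> ?S \<and> card B = j. f (card B)) = ((card A - 1) choose (j - 1)) * f j"
      using card_subsets_through[OF fin a, of j] j by simp
  qed
  finally show ?thesis .
qed

text \<open>The reason why the recurrences below have no binomial weights: in a uniformly random
  permutation the length \<open>j\<close> of the cycle of a given point is uniform on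
  \<open>{1..n}\<close>.\<close>

lemma binomial_fact_cancel:
  assumes "1 \<le> j" "j \<le> n"
  shows "real ((n - 1) choose (j - 1)) * fact (j - 1) * fact (n - j) = fact (n - 1)"
proof -
  have "fact (j - 1) * fact (n - 1 - (j - 1)) * ((n - 1) choose (j - 1)) = (fact (n - 1) :: nat)"
    by (rule binomial_fact_lemma) (use assms in simp)
  then have "real (fact (j - 1) * fact (n - j) * ((n - 1) choose (j - 1))) = real (fact (n - 1))"
    using assms by simp
  then show ?thesis by (simp add: mult_ac)
qed

lemma smooth_perms_all:
  assumes "finite A" "card A \<le> m" shows "smooth_perms m A = {\<pi>. \<pi> permutes A}"
proof -
  have "card (orbit \<pi> i) \<le> m" if "\<pi> permutes A" "i \<in> A" for \<pi> i
    using card_mono[OF assms(1) permutes_orbit_subset[OF that]] assms(2) by simp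
  then show ?thesis by (auto simp: smooth_perms_def)
qed

text \<open>
  The decomposition of an unrestricted permutation along the cycle of a point determines the
  number of cyclic permutations inductively.
\<close>
lemma card_cyclic_perms:
  assumes "finite A" "A \<noteq> {}"
  shows "real (card (cyclic_perms A)) = fact (card A - 1)"
  using assms
proof (induction A rule: finite_psubset_induct)
  case (psubset A)
  define n where "n = card A"
  have n: "n > 0" using psubset by (simp add: n_def card_gt_0_iff)
  obtain a where a: "a \<in> A" using psubset by auto
  let ?S = "{B. a \<in> B \<and> B \<subseteq> A \<and> card B \<le> n}"
  have finS: "finite ?S" by (rule finite_subset[of _ "Pow A"]) (use psubset in auto)
  have AS: "A \<in> ?S" using a by (simp add: n_def)
  have all: "real (card (smooth_perms n (A - B))) = fact (n - card B)" if "B \<in> ?S" for B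
  proof -
    have "card (A - B) = n - card B" using that psubset(1) unfolding n_def
      by (intro card_Diff_subset) (auto intro: finite_subset)
    then show ?thesis using psubset(1)
      by (subst smooth_perms_all) (auto simp: card_permutations)
  qed
  define g where "g B = real (card (cyclic_perms B)) * fact (n - card B)" for B :: "'a set"
  define g' where "g' B = (fact (card B - 1) * fact (n - card B) :: real)" for B :: "'a set"
  have "real (fact n) = real (card (smooth_perms n A))"
    using psubset(1) by (subst smooth_perms_all) (auto simp: n_def card_permutations)
  also have "\<dots> = (\<Sum>B\<in>?S. g B)"
    using psubset(1) by (subst card_smooth_perms_rec[OF _ a]) (auto intro!: sum.cong simp: g_def all)
  also have "\<dots> = g A + (\<Sum>B\<in>?S - {A}. g B)"
    by (rule sum.remove[OF finS AS])
  also have "(\<Sum>B\<in>?S - {A}. g B) = (\<Sum>B\<in>?S - {A}. g' B)"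
    unfolding g_def g'_def by (intro sum.cong refl) (use psubset in auto)
  \<comment> \<open>The full set is put back with the expected count, so that the sum over all
    \<open>B\<close> can be evaluated. It turns out to be \<open>fact n\<close>, the left-hand side,
    and \<open>g A = g' A\<close> remains.\<close>
  also have "g A + (\<Sum>B\<in>?S - {A}. g' B) = g A - g' A + (\<Sum>B\<in>?S. g' B)"
    by (subst sum.remove[OF finS AS]) simp
  also have "(\<Sum>B\<in>?S. g' B) = (\<Sum>j=1..min n n. real ((n - 1) choose (j - 1)) * (fact (j - 1) * fact (n - j)))"
    unfolding g'_def n_def by (rule sum_subsets_through) (use psubset a in auto)
  also have "\<dots> = (\<Sum>j=1..n. fact (n - 1))"
    by (intro sum.cong) (use binomial_fact_cancel[of _ n] in \<open>auto simp: mult.assoc\<close>)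
  also have "\<dots> = fact n" using n by (cases n) auto
  finally show ?case by (simp add: g_def g'_def n_def)
qed

text \<open>The recurrence is the coefficient form of \<open>z * H' = (z + ... + z ^ m) * H\<close>,
  the differential equation of \<open>H = exp (\<Sum>j=1..m. z ^ j / j)\<close>.\<close>

function smooth_perm_freq :: "nat \<Rightarrow> nat \<Rightarrow> real" where
  "smooth_perm_freq m n =
     (if n = 0 then 1 else (\<Sum>j=1..min m n. smooth_perm_freq m (n - j)) / real n)"
  by auto
termination by (relation "Wellfounded.measure snd") auto

declare smooth_perm_freq.simps [simp del]

lemma smooth_perm_freq_0 [simp]: "smooth_perm_freq m 0 = 1"
  by (subst smooth_perm_freq.simps) simp

lemma smooth_perm_freq_rec:
  assumes "n > 0"
  shows "real n * smooth_perm_freq m n = (\<Sum>j=1..min m n. smooth_perm_freq m (n - j))"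
  using assms by (subst smooth_perm_freq.simps) simp

text \<open>Splitting off the cycle of a point gives \<open>fact (n - 1)\<close> for every cycle
  length, and \<open>fact (n - 1) * n = fact n\<close> absorbs the factor \<open>n\<close> of the
  recurrence.\<close>

lemma card_smooth_perms_eq_fact_times:
  assumes "finite A"
  shows "real (card (smooth_perms m A)) = fact (card A) * smooth_perm_freq m (card A)"
  using \<open>finite A\<close>
proof (induction A rule: finite_psubset_induct)
  case (psubset A)
  show ?case
  proof (cases "A = {}")
    case True
    have "smooth_perms m A = {id}" by (auto simp: smooth_perms_def True)
    then show ?thesis using True by simp
  next
    case False
    define n where "n = card A"
    define h where "h = smooth_perm_freq m"
    have n: "n > 0" using False psubset(1) by (simp add: n_def card_gt_0_iff)
    obtain a where a: "a \<in> A" using False by auto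
    let ?S = "{B. a \<in> B \<and> B \<subseteq> A \<and> card B \<le> m}"
    have "real (card (smooth_perms m A)) = (\<Sum>B\<in>?S. fact (card B - 1) * (fact (n - card B) * h (n - card B)))"
      unfolding card_smooth_perms_rec[OF psubset(1) a] of_nat_sum of_nat_mult
    proof (intro sum.cong refl)
      fix B assume B: "B \<in> ?S"
      then have "finite B" "card (A - B) = n - card B" "A - B \<subset> A" "B \<noteq> {}" using psubset(1) unfolding n_def
        by (auto intro: finite_subset card_Diff_subset)
      then show "real (card (cyclic_perms B)) * real (card (smooth_perms m (A - B))) =
          fact (card B - 1) * (fact (n - card B) * h (n - card B))"
        using card_cyclic_perms[of B] psubset.IH[of "A - B"] by (simp add: h_def)
    qed
    also have "\<dots> = (\<Sum>j=1..min m n. real ((n - 1) choose (j - 1)) * (fact (j - 1) * (fact (n - j) * h (n - j))))"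
      unfolding n_def by (rule sum_subsets_through) (use psubset a in auto)
    also have "\<dots> = (\<Sum>j=1..min m n. fact (n - 1) * h (n - j))"
      by (intro sum.cong refl) (use binomial_fact_cancel[of _ n] in \<open>auto simp flip: mult.assoc\<close>)
    also have "\<dots> = fact (n - 1) * (real n * h n)"
      using n by (simp add: h_def smooth_perm_freq_rec sum_distrib_left)
    also have "\<dots> = fact n * h n" using n by (cases n) auto
    finally show ?thesis by (simp add: n_def h_def)
  qed
qed


lemma smooth_perm_prob_eq: "smooth_perm_prob n m = smooth_perm_freq m n"
proof -
  let ?S = "{\<pi>. \<pi> permutes {1..n}}"
  have "?S \<noteq> {}" using permutes_id by blast
  then have "smooth_perm_prob n m = card (?S \<inter> {\<pi>. \<forall>i\<in>{1..n}. card (orbit \<pi> i) \<le> m}) / card ?S"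
    unfolding smooth_perm_prob_def by (intro measure_pmf_of_set) (auto simp: finite_permutations)
  also have "?S \<inter> {\<pi>. \<forall>i\<in>{1..n}. card (orbit \<pi> i) \<le> m} = smooth_perms m {1..n}"
    by (auto simp: smooth_perms_def)
  also have "card ?S = fact n" by (simp add: card_permutations)
  finally show ?thesis by (simp add: card_smooth_perms_eq_fact_times)
qed

section \<open>Polynomials without large irreducible factors\<close>

definition smooth_polys :: "nat \<Rightarrow> nat \<Rightarrow> 'a::{finite,field} poly set" where
  "smooth_polys m n = {f. degree f = n \<and> lead_coeff f = 1 \<and> (\<forall>P. irreducible P \<and> P dvd f \<longrightarrow> degree P \<le> m)}"

definition irreds_le :: "nat \<Rightarrow> 'a::{finite,field} poly set" where
  "irreds_le m = {P \<in> monic_irreducibles. degree P \<le> m}"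

text \<open>For \<open>j > 0\<close> this is the sum of the von Mangoldt function of the polynomial
  ring over the monic polynomials of degree \<open>j\<close> that are powers of an irreducible of
  degree at most \<open>m\<close>: each such irreducible whose degree divides \<open>j\<close> has
  exactly one power of degree \<open>j\<close>.\<close>

definition irred_weight :: "'a::{finite,field} itself \<Rightarrow> nat \<Rightarrow> nat \<Rightarrow> nat" where
  "irred_weight _ m j = (\<Sum>P | P \<in> (irreds_le m :: 'a poly set) \<and> degree P dvd j. degree P)"

lemma finite_smooth_polys: "finite (smooth_polys m n)"
  by (rule finite_subset[OF _ finite_monic_degree_eq[of n]]) (auto simp: smooth_polys_def)

lemma finite_irreds_le: "finite (irreds_le m)"
  unfolding irreds_le_def by (rule finite_monic_irreducibles_le)

lemma monic_irreducibleD: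
  assumes "P \<in> monic_irreducibles"
  shows "irreducible P" "prime_elem P" "lead_coeff P = 1" "degree P > 0" "P \<noteq> 0" "\<not> is_unit P"
proof -
  show i: "irreducible P" and "lead_coeff P = 1" using assms by (auto simp: monic_irreducibles_def)
  show P: "prime_elem P" "P \<noteq> 0" "\<not> is_unit P"
    using i by (auto simp: field_poly_irreducible_imp_prime irreducible_def)
  show "degree P > 0" using P(2,3) by (simp add: is_unit_iff_degree)
qed

lemma monic_dvd_irreducible_imp_eq:
  assumes "P \<in> monic_irreducibles" "Q \<in> monic_irreducibles" "P dvd Q"
  shows "P = Q"
proof -
  from assms(3) obtain u where u: "Q = P * u" by blast
  then have "is_unit u"
    using irreducibleD[OF monic_irreducibleD(1)[OF assms(2)] u] monic_irreducibleD(6)[OF assms(1)] by blast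
  moreover have "lead_coeff u = 1"
    using u monic_irreducibleD(3)[OF assms(1)] monic_irreducibleD(3)[OF assms(2)] by (simp add: lead_coeff_mult)
  ultimately have "u = 1"
    by (elim is_unit_polyE) (simp add: one_pCons)
  then show ?thesis using u by simp
qed

lemma exists_irreducible_factor:
  fixes f :: "'a::field poly"
  assumes "degree f > 0"
  shows "\<exists>P. irreducible P \<and> P dvd f"
  using assms
proof (induction "degree f" arbitrary: f rule: less_induct)
  case less
  show ?case
  proof (cases "irreducible f")
    case False
    have "f \<noteq> 0" using less.prems by auto
    then have "\<not> is_unit f" using less.prems is_unit_iff_degree[of f] by simp
    then obtain g h where gh: "f = g * h" "\<not> is_unit g" "\<not> is_unit h"
      using False \<open>f \<noteq> 0\<close> \<open>\<not> is_unit f\<close> by (auto simp: irreducible_def)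
    then have "g \<noteq> 0" "h \<noteq> 0" using \<open>f \<noteq> 0\<close> by auto
    then have "degree g > 0" "degree h > 0" "degree f = degree g + degree h"
      using gh by (auto simp: is_unit_iff_degree degree_mult_eq)
    then obtain P where "irreducible P" "P dvd g" using less.hyps[of g] by auto
    then show ?thesis using gh by auto
  qed auto
qed

lemma exists_monic_irreducible_factor:
  fixes f :: "'a::{finite,field} poly"
  assumes "degree f > 0"
  shows "\<exists>P\<in>monic_irreducibles. P dvd f"
proof -
  obtain P where P: "irreducible P" "P dvd f" using exists_irreducible_factor[OF assms] by blast
  then have "P \<noteq> 0" by (auto simp: irreducible_def)
  then have l: "inverse (lead_coeff P) \<noteq> 0" by simp
  let ?Q = "smult (inverse (lead_coeff P)) P"
  have "is_unit [:inverse (lead_coeff P):]" using l by (simp add: is_unit_const_poly_iff dvd_field_iff)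
  then have "irreducible ([:inverse (lead_coeff P):] * P)"
    using P(1) by (subst irreducible_mult_unit_left) auto
  then have "irreducible ?Q" by simp
  then have "?Q \<in> monic_irreducibles" using \<open>P \<noteq> 0\<close> by (simp add: monic_irreducibles_def)
  moreover have "?Q dvd f" using P(2) l by (simp add: smult_dvd_iff)
  ultimately show ?thesis by blast
qed

text \<open>For a monic irreducible \<open>P\<close> and \<open>f \<noteq> 0\<close> the cardinality
  is the multiplicity of \<open>P\<close> in \<open>f\<close>. Writing it as a count of exponents
  \<open>k\<close> makes it possible to exchange the sums over \<open>f\<close> and
  \<open>k\<close>.\<close>

definition power_divisors :: "'a::field poly \<Rightarrow> 'a poly \<Rightarrow> nat set" where
  "power_divisors P f = {k. 0 < k \<and> P ^ k dvd f}"

lemma power_divisors_bounded: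
  assumes "P \<in> monic_irreducibles" "f \<noteq> 0"
  shows "power_divisors P f \<subseteq> {1..degree f}"
proof
  fix k assume k: "k \<in> power_divisors P f"
  note PD = monic_irreducibleD[OF assms(1)]
  have "degree (P ^ k) \<le> degree f"
    using k assms(2) by (intro dvd_imp_degree_le) (auto simp: power_divisors_def)
  then have "k * degree P \<le> degree f" using PD(5) by (simp add: degree_power_eq)
  moreover have "k * 1 \<le> k * degree P" using PD(4) by (intro mult_le_mono2) simp
  ultimately have "k \<le> degree f" by linarith
  then show "k \<in> {1..degree f}" using k by (auto simp: power_divisors_def)
qed

lemma prime_elem_power_dvd_mult_cancel:
  fixes P :: "'a::field poly"
  assumes P: "prime_elem P" and h: "\<not> P dvd h"
  shows "P ^ k dvd h * g \<longleftrightarrow> P ^ k dvd g"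
proof
  assume "P ^ k dvd h * g"
  then show "P ^ k dvd g"
  proof (induction k arbitrary: g)
    case (Suc k)
    have "P dvd h * g" using Suc.prems by (auto intro: dvd_trans[of P "P * P ^ k"])
    then have "P dvd g" using P h by (auto simp: prime_elem_dvd_mult_iff)
    then obtain g' where g': "g = P * g'" by blast
    have "P * P ^ k dvd P * (h * g')" using Suc.prems g' by (simp add: mult.left_commute)
    then have "P ^ k dvd h * g'" using P by (auto simp: prime_elem_def)
    then have "P ^ k dvd g'" by (rule Suc.IH)
    then show ?case unfolding g' power_Suc by (intro mult_dvd_mono dvd_refl)
  qed simp
qed simp

lemma card_power_divisors_mult_same:
  assumes "P \<in> monic_irreducibles" "g \<noteq> 0"
  shows "card (power_divisors P (P * g)) = Suc (card (power_divisors P g))"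
proof -
  have "P \<noteq> 0" using monic_irreducibleD[OF assms(1)] by simp
  have "power_divisors P (P * g) = insert 1 (Suc ` power_divisors P g)"
  proof (intro set_eqI)
    fix k
    show "k \<in> power_divisors P (P * g) \<longleftrightarrow> k \<in> insert 1 (Suc ` power_divisors P g)"
      using \<open>P \<noteq> 0\<close> by (cases k rule: nat.exhaust) (auto simp: power_divisors_def image_iff)
  qed
  moreover have "finite (power_divisors P g)"
    using power_divisors_bounded[OF assms] by (rule finite_subset) simp
  moreover have "1 \<notin> Suc ` power_divisors P g" by (auto simp: power_divisors_def)
  ultimately show ?thesis by (simp add: card_image)
qed

text \<open>Dividing out one monic irreducible \<open>P\<close> lowers the degree by
  \<open>degree P\<close> and the multiplicity of \<open>P\<close> by one. All other multiplicities
  are unchanged, since a different monic irreducible does not divide \<open>P\<close>.\<close>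

lemma degree_eq_sum_power_divisors:
  fixes f :: "'a::{finite,field} poly"
  assumes "f \<in> smooth_polys m n"
  shows "n = (\<Sum>P\<in>irreds_le m. degree P * card (power_divisors P f))"
  using assms
proof (induction n arbitrary: f rule: less_induct)
  case (less n)
  have f: "degree f = n" "lead_coeff f = 1" and sm: "\<And>P. irreducible P \<Longrightarrow> P dvd f \<Longrightarrow> degree P \<le> m"
    using less.prems by (auto simp: smooth_polys_def)
  show ?case
  proof (cases "n = 0")
    case True
    have "power_divisors P f = {}" if "P \<in> irreds_le m" for P
    proof -
      have "f \<noteq> 0" using f by auto
      then have "power_divisors P f \<subseteq> {1..degree f}"
        using that by (intro power_divisors_bounded) (auto simp: irreds_le_def)
      then show ?thesis using f True by simp
    qed
    then show ?thesis using True by simp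
  next
    case False
    then obtain P where P: "P \<in> monic_irreducibles" "P dvd f"
      using exists_monic_irreducible_factor[of f] f by auto
    then obtain g where g: "f = P * g" by blast
    note PD = monic_irreducibleD[OF P(1)]
    have Pm: "P \<in> irreds_le m" using P sm PD(1) by (auto simp: irreds_le_def)
    have "g \<noteq> 0" using g f by auto
    have deg: "n = degree P + degree g" using f g PD(5) \<open>g \<noteq> 0\<close> by (simp add: degree_mult_eq)
    have lg: "lead_coeff g = 1" using f(2) PD(3) unfolding g lead_coeff_mult by simp
    have "g \<in> smooth_polys m (degree g)" using lg sm g by (auto simp: smooth_polys_def)
    then have IH: "degree g = (\<Sum>Q\<in>irreds_le m. degree Q * card (power_divisors Q g))"
      using less.IH[of "degree g" g] deg PD(4) by simp
    have mult: "card (power_divisors Q f) = (if Q = P then 1 else 0) + card (power_divisors Q g)" if "Q \<in> irreds_le m" for Q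
    proof -
      have Q: "Q \<in> monic_irreducibles" using that by (simp add: irreds_le_def)
      note QD = monic_irreducibleD[OF Q]
      show ?thesis
      proof (cases "Q = P")
        case True
        then show ?thesis using card_power_divisors_mult_same[OF Q] \<open>g \<noteq> 0\<close> g by simp
      next
        case False
        then have "\<not> Q dvd P" using monic_dvd_irreducible_imp_eq[OF Q P(1)] by blast
        then show ?thesis
          using False g by (simp add: power_divisors_def prime_elem_power_dvd_mult_cancel[OF QD(2)])
      qed
    qed
    have "(\<Sum>Q\<in>irreds_le m. degree Q * card (power_divisors Q f)) =
        (\<Sum>Q\<in>irreds_le m. (if Q = P then degree P else 0) + degree Q * card (power_divisors Q g))"
      by (intro sum.cong refl) (simp add: mult algebra_simps)
    also have "\<dots> = degree P + degree g"
      using Pm by (simp add: sum.distrib IH[symmetric] finite_irreds_le)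
    finally show ?thesis using deg by simp
  qed
qed

text \<open>Multiplication by \<open>P ^ k\<close> is the bijection; it preserves smoothness because
  \<open>P\<close> itself has degree at most \<open>m\<close>.\<close>

lemma card_smooth_polys_power_dvd:
  fixes P :: "'a::{finite,field} poly"
  assumes P: "P \<in> irreds_le m"
  shows "card {f \<in> smooth_polys m n. P ^ k dvd f} =
    (if k * degree P \<le> n then card (smooth_polys m (n - k * degree P) :: 'a poly set) else 0)"
proof -
  have PM: "P \<in> monic_irreducibles" and "degree P \<le> m" using P by (auto simp: irreds_le_def)
  note PD = monic_irreducibleD[OF PM]
  have P0: "P ^ k \<noteq> 0" using PD(5) by simp
  have dk: "degree (P ^ k) = k * degree P" by (rule degree_power_eq[OF PD(5), THEN trans]) simp
  have lk: "lead_coeff (P ^ k) = 1" using PD(3) by (simp add: lead_coeff_power)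
  show ?thesis
  proof (cases "k * degree P \<le> n")
    case True
    have "bij_betw (\<lambda>g. P ^ k * g) (smooth_polys m (n - k * degree P)) {f \<in> smooth_polys m n. P ^ k dvd f}"
    proof (rule bij_betwI')
      fix g h :: "'a poly" show "(P ^ k * g = P ^ k * h) = (g = h)" using P0 by (metis mult_cancel_left)
    next
      fix g :: "'a poly" assume g: "g \<in> smooth_polys m (n - k * degree P)"
      then have "g \<noteq> 0" by (auto simp: smooth_polys_def)
      have "degree (P ^ k * g) = n"
        using g True P0 \<open>g \<noteq> 0\<close> dk by (simp add: degree_mult_eq smooth_polys_def)
      moreover have "lead_coeff (P ^ k * g) = 1"
        using g lk unfolding lead_coeff_mult smooth_polys_def by (metis (mono_tags, lifting) mem_Collect_eq mult_1)
      moreover have "degree Q \<le> m" if "irreducible Q" "Q dvd P ^ k * g" for Q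
      proof -
        have Q: "prime_elem Q" using that(1) by (rule field_poly_irreducible_imp_prime)
        then have "Q dvd P \<or> Q dvd g"
          using that(2) prime_elem_dvd_power[OF Q] by (auto simp: prime_elem_dvd_mult_iff)
        then show ?thesis
        proof
          assume "Q dvd P"
          then have "degree Q \<le> degree P" using PD(5) by (rule dvd_imp_degree_le)
          then show ?thesis using \<open>degree P \<le> m\<close> by simp
        qed (use g that(1) in \<open>auto simp: smooth_polys_def\<close>)
      qed
      ultimately show "P ^ k * g \<in> {f \<in> smooth_polys m n. P ^ k dvd f}"
        by (auto simp: smooth_polys_def)
    next
      fix f :: "'a poly" assume f: "f \<in> {f \<in> smooth_polys m n. P ^ k dvd f}"
      then obtain g where g: "f = P ^ k * g" by blast
      have f': "degree f = n" "lead_coeff f = 1" using f by (auto simp: smooth_polys_def)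
      have "g \<noteq> 0" using f' g by auto
      then have "degree g = n - k * degree P" using f' g P0 dk by (simp add: degree_mult_eq)
      moreover have "lead_coeff g = 1" using f'(2) lk unfolding g lead_coeff_mult by simp
      ultimately have "g \<in> smooth_polys m (n - k * degree P)" using f g by (auto simp: smooth_polys_def)
      then show "\<exists>g\<in>smooth_polys m (n - k * degree P). f = P ^ k * g" using g by blast
    qed
    then show ?thesis using True by (simp add: bij_betw_same_card)
  next
    case False
    have "\<not> P ^ k dvd f" if "f \<in> smooth_polys m n" for f :: "'a poly"
    proof
      assume d: "P ^ k dvd f"
      have "f \<noteq> 0" "degree f = n" using that by (auto simp: smooth_polys_def)
      then show False using dvd_imp_degree_le[OF d] dk False by simp
    qed
    then have "{f \<in> smooth_polys m n. P ^ k dvd f} = {}" by auto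
    then show ?thesis using False by (simp only: card.empty if_False)
  qed
qed

text \<open>Double counting: the degree \<open>n\<close> of each \<open>f\<close> is distributed
  over the pairs \<open>(P, k)\<close> with \<open>P ^ k dvd f\<close>, each weighted by
  \<open>degree P\<close>. Exchanging the sums and collecting the pairs with
  \<open>k * degree P = j\<close> gives the coefficient form of the logarithmic derivative of the
  Euler product.\<close>

lemma card_smooth_polys_rec:
  "n * card (smooth_polys m n :: 'a::{finite,field} poly set) =
    (\<Sum>j=1..n. irred_weight TYPE('a) m j * card (smooth_polys m (n - j) :: 'a poly set))"
proof -
  let ?S = "smooth_polys m n :: 'a poly set" and ?I = "irreds_le m :: 'a poly set"
  let ?s = "\<lambda>i. card (smooth_polys m i :: 'a poly set)"
  have "n * card ?S = (\<Sum>f\<in>?S. n)" by simp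
  also have "\<dots> = (\<Sum>f\<in>?S. \<Sum>P\<in>?I. degree P * card (power_divisors P f))"
    by (intro sum.cong refl degree_eq_sum_power_divisors)
  also have "\<dots> = (\<Sum>f\<in>?S. \<Sum>P\<in>?I. \<Sum>k=1..n. if P ^ k dvd f then degree P else 0)"
  proof (intro sum.cong refl)
    fix f P assume "f \<in> ?S" "P \<in> ?I"
    then have "P \<in> monic_irreducibles" "f \<noteq> 0" "degree f = n"
      by (auto simp: smooth_polys_def irreds_le_def)
    then have "power_divisors P f = {k \<in> {1..n}. P ^ k dvd f}"
      using power_divisors_bounded[of P f] by (auto simp: power_divisors_def)
    then show "degree P * card (power_divisors P f) = (\<Sum>k=1..n. if P ^ k dvd f then degree P else 0)"
      by (simp flip: sum.inter_filter)
  qed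
  also have "\<dots> = (\<Sum>P\<in>?I. \<Sum>f\<in>?S. \<Sum>k=1..n. if P ^ k dvd f then degree P else 0)"
    by (rule sum.swap)
  also have "\<dots> = (\<Sum>P\<in>?I. \<Sum>k=1..n. \<Sum>f\<in>?S. if P ^ k dvd f then degree P else 0)"
    by (intro sum.cong refl sum.swap)
  also have "\<dots> = (\<Sum>P\<in>?I. \<Sum>j=1..n. if degree P dvd j then degree P * ?s (n - j) else 0)"
  proof (rule sum.cong[OF refl])
    fix P assume P: "P \<in> ?I"
    then have d: "degree P > 0" by (simp add: irreds_le_def monic_irreducibleD)
    have "(\<Sum>k=1..n. \<Sum>f\<in>?S. if P ^ k dvd f then degree P else 0) =
        (\<Sum>k=1..n. degree P * card {f \<in> ?S. P ^ k dvd f})"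
      by (simp add: finite_smooth_polys mult.commute flip: sum.inter_filter)
    also have "\<dots> = (\<Sum>k=1..n. if k * degree P \<le> n then degree P * ?s (n - k * degree P) else 0)"
      by (intro sum.cong refl) (simp add: card_smooth_polys_power_dvd[OF P])
    also have "\<dots> = (\<Sum>k | k \<in> {1..n} \<and> k * degree P \<le> n. degree P * ?s (n - k * degree P))"
      by (rule sum.inter_filter[symmetric]) simp
    also have "\<dots> = (\<Sum>j | j \<in> {1..n} \<and> degree P dvd j. degree P * ?s (n - j))"
    proof (rule sum.reindex_bij_witness[of _ "\<lambda>j. j div degree P" "\<lambda>k. k * degree P"])
      fix j assume j: "j \<in> {j. j \<in> {1..n} \<and> degree P dvd j}"
      then obtain k where "j = degree P * k" by blast
      then show "j div degree P * degree P = j" "j div degree P \<in> {k. k \<in> {1..n} \<and> k * degree P \<le> n}"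
        using j d by (auto simp: Suc_le_eq mult.commute intro: le_trans[rotated])
    next
      fix k assume "k \<in> {k. k \<in> {1..n} \<and> k * degree P \<le> n}"
      then show "k * degree P div degree P = k" "k * degree P \<in> {j. j \<in> {1..n} \<and> degree P dvd j}"
        using d by (auto simp: Suc_le_eq)
    qed auto
    also have "\<dots> = (\<Sum>j=1..n. if degree P dvd j then degree P * ?s (n - j) else 0)"
      by (rule sum.inter_filter) simp
    finally show "(\<Sum>k=1..n. \<Sum>f\<in>?S. if P ^ k dvd f then degree P else 0) =
      (\<Sum>j=1..n. if degree P dvd j then degree P * ?s (n - j) else 0)" .
  qed
  also have "\<dots> = (\<Sum>j=1..n. \<Sum>P\<in>?I. if degree P dvd j then degree P * ?s (n - j) else 0)"
    by (rule sum.swap)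
  also have "\<dots> = (\<Sum>j=1..n. irred_weight TYPE('a) m j * ?s (n - j))"
    unfolding irred_weight_def sum_distrib_right
    by (rule sum.cong[OF refl], rule sum.inter_filter[symmetric]) (rule finite_irreds_le)
  finally show ?thesis .
qed

section \<open>The weights up to \<open>m\<close>: the prime polynomial theorem\<close>

lemma card_monic_degree_eq:
  "card {f :: 'a::{finite,field} poly. degree f = n \<and> lead_coeff f = 1} = CARD('a) ^ n"
proof (induction n)
  case 0
  have "{f :: 'a poly. degree f = 0 \<and> lead_coeff f = 1} = {1}"
    by (auto elim!: degree_eq_zeroE)
  then show ?case by simp
next
  case (Suc n)
  let ?M = "\<lambda>n. {f :: 'a poly. degree f = n \<and> lead_coeff f = 1}"
  have "bij_betw (\<lambda>(a, f). pCons a f) ((UNIV :: 'a set) \<times> ?M n) (?M (Suc n))"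
  proof (rule bij_betwI')
    fix x y :: "'a \<times> 'a poly"
    show "((case x of (a, f) \<Rightarrow> pCons a f) = (case y of (a, f) \<Rightarrow> pCons a f)) = (x = y)"
      by (cases x; cases y) simp
  next
    fix x assume "x \<in> (UNIV :: 'a set) \<times> ?M n"
    then show "(case x of (a, f) \<Rightarrow> pCons a f) \<in> ?M (Suc n)"
      by (cases "snd x = 0") (auto simp: degree_pCons_eq)
  next
    fix f assume f: "f \<in> ?M (Suc n)"
    obtain a g where g: "f = pCons a g" by (cases f)
    with f have "g \<noteq> 0" by auto
    with f g have "g \<in> ?M n" by (auto simp: degree_pCons_eq)
    then show "\<exists>x\<in>(UNIV :: 'a set) \<times> ?M n. f = (case x of (a, f) \<Rightarrow> pCons a f)" using g by force
  qed
  then have "card (?M (Suc n)) = card ((UNIV :: 'a set) \<times> ?M n)" by (rule bij_betw_same_card[symmetric])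
  then show ?case using Suc by (simp add: card_cartesian_product)
qed

lemma smooth_polys_all:
  assumes "n \<le> m"
  shows "smooth_polys m n = {f :: 'a::{finite,field} poly. degree f = n \<and> lead_coeff f = 1}"
proof -
  have "degree P \<le> m" if "degree f = n" "lead_coeff f = 1" "P dvd f" for f P :: "'a poly"
  proof -
    have "f \<noteq> 0" using that(2) by auto
    then show ?thesis using dvd_imp_degree_le[OF that(3)] that(1) assms by simp
  qed
  then show ?thesis by (auto simp: smooth_polys_def)
qed

text \<open>In degree \<open>j\<close> every monic polynomial is \<open>j\<close>-smooth, so the
  counts in the recurrence are known powers of \<open>q\<close>. By induction the first
  \<open>j - 1\<close> summands are \<open>q ^ j\<close> each, which leaves \<open>q ^ j\<close> for
  the last one. Raising the bound from \<open>j\<close> to \<open>m\<close> adds no irreducible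
  whose degree divides \<open>j\<close>.\<close>

lemma irred_weight_eq_power:
  assumes "0 < j" "j \<le> m"
  shows "irred_weight TYPE('a::{finite,field}) m j = CARD('a) ^ j"
  using assms
proof (induction j arbitrary: m rule: less_induct)
  case (less j)
  let ?q = "CARD('a)"
  have "j * ?q ^ j = (\<Sum>i=1..j. irred_weight TYPE('a) j i * ?q ^ (j - i))"
    using card_smooth_polys_rec[of j j, where 'a = 'a] by (simp add: smooth_polys_all card_monic_degree_eq)
  also have "\<dots> = (\<Sum>i=1..<j. irred_weight TYPE('a) j i * ?q ^ (j - i)) + irred_weight TYPE('a) j j"
    using less.prems by (subst sum.last_plus) auto
  also have "(\<Sum>i=1..<j. irred_weight TYPE('a) j i * ?q ^ (j - i)) = (\<Sum>i=1..<j. ?q ^ j)"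
    by (intro sum.cong refl) (use less.IH in \<open>auto simp flip: power_add\<close>)
  also have "\<dots> = (j - 1) * ?q ^ j" by simp
  finally have "irred_weight TYPE('a) j j = ?q ^ j"
    using less.prems by (cases j) auto
  moreover have "irred_weight TYPE('a) m j = irred_weight TYPE('a) j j"
    unfolding irred_weight_def using less.prems
    by (intro sum.cong) (auto simp: irreds_le_def dest: dvd_imp_le)
  ultimately show ?case by simp
qed

definition smooth_poly_freq :: "'a::{finite,field} itself \<Rightarrow> nat \<Rightarrow> nat \<Rightarrow> real" where
  "smooth_poly_freq _ m n = card (smooth_polys m n :: 'a poly set) / CARD('a) ^ n"

lemma smooth_poly_prob_eq: "smooth_poly_prob TYPE('a::{finite,field}) n m = smooth_poly_freq TYPE('a) m n"
proof -
  let ?S = "{f :: 'a poly. degree f = n \<and> lead_coeff f = 1}"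
  have "smooth_poly_prob TYPE('a) n m =
      card (?S \<inter> {f. \<forall>P. irreducible P \<and> P dvd f \<longrightarrow> degree P \<le> m}) / card ?S"
    unfolding smooth_poly_prob_def
    by (intro measure_pmf_of_set monic_degree_eq_nonempty finite_monic_degree_eq)
  also have "?S \<inter> {f. \<forall>P. irreducible P \<and> P dvd f \<longrightarrow> degree P \<le> m} = smooth_polys m n"
    by (auto simp: smooth_polys_def)
  finally show ?thesis by (simp add: card_monic_degree_eq smooth_poly_freq_def)
qed

lemma smooth_poly_freq_rec:
  "real n * smooth_poly_freq TYPE('a::{finite,field}) m n =
    (\<Sum>j=1..n. irred_weight TYPE('a) m j / CARD('a) ^ j * smooth_poly_freq TYPE('a) m (n - j))"
proof -
  let ?q = "real CARD('a)"
  have "real n * smooth_poly_freq TYPE('a) m n = real (n * card (smooth_polys m n :: 'a poly set)) / ?q ^ n"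
    by (simp add: smooth_poly_freq_def)
  also have "\<dots> = (\<Sum>j=1..n. irred_weight TYPE('a) m j * card (smooth_polys m (n - j) :: 'a poly set) / ?q ^ n)"
    unfolding card_smooth_polys_rec by (simp add: sum_divide_distrib)
  also have "\<dots> = (\<Sum>j=1..n. irred_weight TYPE('a) m j / ?q ^ j * smooth_poly_freq TYPE('a) m (n - j))"
  proof (intro sum.cong refl)
    fix j assume "j \<in> {1..n}"
    then have "?q ^ n = ?q ^ j * ?q ^ (n - j)" by (simp flip: power_add)
    then show "irred_weight TYPE('a) m j * card (smooth_polys m (n - j) :: 'a poly set) / ?q ^ n =
        irred_weight TYPE('a) m j / ?q ^ j * smooth_poly_freq TYPE('a) m (n - j)"
      by (simp add: smooth_poly_freq_def)
  qed
  finally show ?thesis by simp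
qed

lemma smooth_poly_freq_0: "smooth_poly_freq TYPE('a::{finite,field}) m 0 = 1"
proof -
  have "card (smooth_polys m 0 :: 'a poly set) = 1"
    unfolding smooth_polys_all[OF le0] card_monic_degree_eq by (rule power_0)
  then show ?thesis by (simp add: smooth_poly_freq_def)
qed

section \<open>A local limit theorem\<close>

lemma integral_periodic_shift:
  fixes f :: "real \<Rightarrow> 'b::banach"
  assumes cont: "continuous_on UNIV f" and per: "\<And>t. f (t + 2 * pi) = f t"
    and I: "(f has_integral I) {0..2 * pi}"
  shows "(f has_integral I) {-pi..pi}"
proof -
  have int: "f integrable_on {a..b}" for a b
    using cont by (meson continuous_on_subset integrable_continuous_interval subset_UNIV)
  have "((\<lambda>t::real. f (t + 2 * pi)) has_integral integral {pi..2*pi} f) ((\<lambda>x. x - 2*pi) ` {pi..2*pi})"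
    using has_integral_affinity[OF integrable_integral[OF int[of pi "2*pi"], unfolded box_real[symmetric]], of 1 "2*pi"]
    by (simp add: algebra_simps)
  moreover have "(\<lambda>x. x - 2*pi) ` {pi..2*pi} = {-pi..0}"
    by (simp only: diff_conv_add_uminus image_add_atLeastAtMost') simp
  ultimately have "(f has_integral integral {pi..2*pi} f) {-pi..0}"
    by (simp add: per)
  moreover have "(f has_integral integral {0..pi} f) {0..pi}"
    using int by blast
  ultimately have "(f has_integral (integral {pi..2*pi} f + integral {0..pi} f)) {-pi..pi}"
    by (intro has_integral_combine[of "-pi" 0 pi]) auto
  moreover have "integral {0..pi} f + integral {pi..2*pi} f = I"
    using I int[of 0 "2*pi"] by (metis Henstock_Kurzweil_Integration.integral_combine integral_unique mult_2 pi_ge_zero le_add_same_cancel1)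
  ultimately show ?thesis by (simp add: add.commute)
qed

text \<open>Comparing coefficients in \<open>K' = K * F'\<close> for \<open>K = exp F\<close> yields
  the recurrence that determines \<open>h\<close>. Hypotheses and conclusion stop at index
  \<open>n\<close>, so that \<open>F\<close> may be a truncated polynomial.\<close>

lemma fps_exp_compose_recurrence:
  fixes b :: "nat \<Rightarrow> real" and h :: "nat \<Rightarrow> real" and F :: "complex fps"
  assumes h0: "h 0 = 1" and rec: "\<And>i. 0 < i \<Longrightarrow> i \<le> n \<Longrightarrow> real i * h i = (\<Sum>j=1..i. b j * h (i - j))"
    and F0: "fps_nth F 0 = 0" and F: "\<And>j. 0 < j \<Longrightarrow> j \<le> n \<Longrightarrow> of_nat j * fps_nth F j = of_real (b j)"
    and "i \<le> n"
  shows "fps_nth (fps_exp 1 oo F) i = of_real (h i)"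
  using \<open>i \<le> n\<close>
proof (induction i rule: less_induct)
  case (less i)
  show ?case
  proof (cases i)
    case 0
    then show ?thesis by (simp add: h0)
  next
    case (Suc k)
    let ?K = "fps_exp 1 oo F"
    have "fps_deriv ?K = ?K * fps_deriv F"
      using F0 by (simp add: fps_compose_deriv)
    then have "fps_nth (fps_deriv ?K) k = fps_nth (?K * fps_deriv F) k" by simp
    then have "of_nat i * fps_nth ?K i = (\<Sum>l=0..k. fps_nth ?K l * (of_nat (Suc k - l) * fps_nth F (Suc k - l)))"
      using Suc by (simp add: fps_mult_nth Suc_diff_le)
    also have "\<dots> = (\<Sum>l=0..k. of_real (h l) * of_real (b (Suc k - l)))"
    proof (intro sum.cong refl arg_cong2[of _ _ _ _ "(*)"])
      fix l assume "l \<in> {0..k}"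
      then show "fps_nth ?K l = of_real (h l)"
        using less Suc by auto
      show "of_nat (Suc k - l) * fps_nth F (Suc k - l) = of_real (b (Suc k - l))"
        using less.prems Suc \<open>l \<in> {0..k}\<close> by (intro F) auto
    qed
    also have "\<dots> = of_real (\<Sum>j=1..i. b j * h (i - j))"
      unfolding of_real_sum
      by (rule sum.reindex_bij_witness[of _ "\<lambda>j. i - j" "\<lambda>j. i - j"]) (use Suc in auto)
    also have "\<dots> = of_nat i * of_real (h i)"
      using less.prems Suc by (subst rec[symmetric]) auto
    finally show ?thesis using Suc by (simp del: of_nat_Suc)
  qed
qed

text \<open>Cauchy's formula for the \<open>n\<close>-th derivative at 0, on the circle of radius
  \<open>y\<close>. With the exponent truncated at \<open>n\<close> the function is entire, and no
  radius of convergence restricts \<open>y\<close>.\<close>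

lemma coefficient_integral:
  fixes b h :: "nat \<Rightarrow> real"
  assumes h0: "h 0 = 1" and rec: "\<And>i. 0 < i \<Longrightarrow> i \<le> n \<Longrightarrow> real i * h i = (\<Sum>j=1..i. b j * h (i - j))"
    and y: "y > 0"
  shows "((\<lambda>t::real. exp (\<Sum>j=1..n. of_real (b j * y ^ j / j) * cis (j * t)) * cis (- (n * t)))
            has_integral of_real (2 * pi * h n * y ^ n)) {-pi..pi}"
proof -
  define p where "p = (\<Sum>j=1..n. monom (of_real (b j) / of_nat j) j :: complex poly)"
  define K where "K z = exp (poly p z)" for z
  have pp: "poly p z = (\<Sum>j=1..n. of_real (b j) / of_nat j * z ^ j)" for z
    by (simp add: p_def poly_sum poly_monom)
  have cp: "coeff p j = (if j \<in> {1..n} then of_real (b j) / of_nat j else 0)" for j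
    by (simp add: p_def coeff_sum)
  have exp: "K has_fps_expansion (fps_exp 1 oo fps_of_poly p)"
  proof -
    have "poly p has_fps_expansion fps_of_poly p"
      by (auto simp: has_fps_expansion_def)
    then have "(exp \<circ> poly p) has_fps_expansion (fps_exp 1 oo fps_of_poly p)"
      by (intro has_fps_expansion_compose has_fps_expansion_exp1) (auto simp: cp)
    then show ?thesis by (simp add: K_def[abs_def] o_def)
  qed
  have nth: "(deriv ^^ n) K 0 / fact n = of_real (h n)"
    using fps_nth_fps_expansion[OF exp, of n] h0 rec cp
    by (subst (asm) fps_exp_compose_recurrence[where h = h and b = b and n = n]) auto
  have holo: "K holomorphic_on S" for S
    unfolding K_def by (intro holomorphic_intros)
  have "((\<lambda>u. K u / (u - 0) ^ Suc n) has_contour_integral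
      (2 * pi * \<i> / fact n * (deriv ^^ n) K 0)) (circlepath 0 y)"
    by (rule Cauchy_has_contour_integral_higher_derivative_circlepath)
       (use y in \<open>auto intro!: holo holomorphic_on_imp_continuous_on\<close>)
  then have "((\<lambda>u. K u / u ^ Suc n) has_contour_integral (2 * pi * \<i> * of_real (h n)))
      (part_circlepath 0 y 0 (2 * pi))"
    by (simp add: circlepath_def nth[symmetric] field_simps)
  then have "((\<lambda>t::real. K (y * cis t) / (y * cis t) ^ Suc n * y * \<i> * cis t)
      has_integral (2 * pi * \<i> * of_real (h n))) {0..2 * pi}"
    by (subst (asm) has_contour_integral_part_circlepath_iff) auto
  \<comment> \<open>The factor removes the radius and the imaginary unit brought in by parametrizing
    the circle.\<close>
  then have "((\<lambda>t::real. (y ^ n / \<i>) * (K (y * cis t) / (y * cis t) ^ Suc n * y * \<i> * cis t))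
      has_integral ((y ^ n / \<i>) * (2 * pi * \<i> * of_real (h n)))) {0..2 * pi}"
    by (rule has_integral_mult_right)
  moreover have "(\<lambda>t::real. (y ^ n / \<i>) * (K (y * cis t) / (y * cis t) ^ Suc n * y * \<i> * cis t)) =
     (\<lambda>t::real. exp (\<Sum>j=1..n. of_real (b j * y ^ j / j) * cis (j * t)) * cis (- (n * t)))"
  proof
    fix t :: real
    have "K (y * cis t) = exp (\<Sum>j=1..n. of_real (b j * y ^ j / j) * cis (j * t))"
      unfolding K_def pp
      by (intro arg_cong[of _ _ exp] sum.cong refl) (simp add: power_mult_distrib Complex.DeMoivre)
    moreover have "(y ^ n / \<i>) * (K (y * cis t) / (y * cis t) ^ Suc n * y * \<i> * cis t) = K (y * cis t) * cis (- (n * t))"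
    proof -
      have gen: "(Y ^ n / w) * (k / (Y * c) ^ Suc n * Y * w * c) = k * (1 / c ^ n)"
        if "w \<noteq> 0" "c \<noteq> 0" "Y \<noteq> 0" for w c Y k :: complex
        using that by (simp add: field_simps)
      have eq: "cis (- (n * t)) = 1 / cis t ^ n"
        by (simp add: Complex.DeMoivre divide_inverse)
      show ?thesis
        unfolding eq of_real_power by (rule gen) (use y in auto)
    qed
    ultimately show "(y ^ n / \<i>) * (K (y * cis t) / (y * cis t) ^ Suc n * y * \<i> * cis t) =
      exp (\<Sum>j=1..n. of_real (b j * y ^ j / j) * cis (j * t)) * cis (- (n * t))"
      by (simp only:)
  qed
  moreover have "(y ^ n / \<i>) * (2 * pi * \<i> * of_real (h n)) = of_real (2 * pi * h n * y ^ n)"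
    by (simp add: field_simps)
  ultimately have "((\<lambda>t::real. exp (\<Sum>j=1..n. of_real (b j * y ^ j / j) * cis (j * t)) * cis (- (n * t)))
      has_integral of_real (2 * pi * h n * y ^ n)) {0..2 * pi}"
    by (simp only:)
  then show ?thesis
  proof (rule integral_periodic_shift[rotated 2])
    show "continuous_on UNIV (\<lambda>t::real. exp (\<Sum>j=1..n. of_real (b j * y ^ j / j) * cis (j * t)) * cis (- (n * t)))"
      by (intro continuous_intros)
    have *: "cis (real j * (t + 2 * pi)) = cis (real j * t)" for j and t :: real
    proof -
      have "cis (real j * (t + 2 * pi)) = cis (real j * t) * cis (2 * pi * real j)"
        by (simp add: cis_mult algebra_simps)
      then show ?thesis by simp
    qed
    have "cis (- (n * (t + 2 * pi))) = cis (- (n * t))" for t :: real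
      using *[of n t] by (metis cis_inverse)
    then show "exp (\<Sum>j=1..n. of_real (b j * y ^ j / j) * cis (j * (t + 2*pi))) * cis (- (n * (t + 2*pi))) =
      exp (\<Sum>j=1..n. of_real (b j * y ^ j / j) * cis (j * t)) * cis (- (n * t))" for t :: real
      by (simp only: *)
  qed
qed

section \<open>Comparison of the characteristic function with a Gaussian\<close>

lemma has_bochner_integral_gaussian:
  fixes a :: real
  assumes "a > 0"
  shows "has_bochner_integral lborel (\<lambda>t. exp (- (a * t\<^sup>2))) (sqrt (pi / a))"
proof -
  let ?s = "sqrt (1 / (2 * a))"
  have s: "?s > 0" using assms by simp
  have "has_bochner_integral lborel (\<lambda>t. sqrt (pi / a) * normal_density 0 ?s t) (sqrt (pi / a) * 1)"
    using s by (intro has_bochner_integral_mult_right) (simp add: has_bochner_integral_iff)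
  also have "(\<lambda>t. sqrt (pi / a) * normal_density 0 ?s t) = (\<lambda>t. exp (- (a * t\<^sup>2)))"
    using assms by (auto simp: normal_density_def fun_eq_iff field_simps real_sqrt_divide)
  finally show ?thesis by simp
qed

lemma norm_exp_diff_of_real_le:
  fixes w :: complex and v :: real
  shows "norm (exp w - of_real (exp v)) \<le> norm (w - of_real v) * exp (v + norm (w - of_real v))"
proof -
  have "exp w - of_real (exp v) = of_real (exp v) * (exp (w - of_real v) - 1)"
    by (simp add: exp_diff exp_of_real field_simps)
  moreover have "norm (exp (w - of_real v) - 1) \<le> exp (norm (w - of_real v)) * norm (w - of_real v)"
    using Taylor_exp_field[of "w - of_real v" 0] by simp
  ultimately show ?thesis
    by (simp add: norm_mult exp_add mult_ac)
qed

lemma cis_taylor2: "norm (cis u - 1 - \<i> * u + u\<^sup>2 / 2) \<le> \<bar>u\<bar> ^ 3 / 6"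
proof -
  have "(\<Sum>k\<le>2. (\<i> * u) ^ k / fact k) = 1 + \<i> * u - u\<^sup>2 / 2"
    by (simp add: numeral_2_eq_2 power_mult_distrib)
  moreover have "cis u = iexp u" by (simp add: cis_conv_exp)
  ultimately have "cis u - 1 - \<i> * u + u\<^sup>2 / 2 = iexp u - (\<Sum>k\<le>2. (\<i> * u) ^ k / fact k)"
    by simp
  then show ?thesis
    using iexp_approx1[of u 2] by (simp add: fact_numeral)
qed

text \<open>The quadratic Taylor term of \<open>exp (u\<^sup>2 / 8)\<close> is
  \<open>u ^ 4 / 128\<close>, whence \<open>1 + u ^ 4 \<le> 129 * exp (u\<^sup>2 / 8)\<close>. This
  trades polynomial factors for a slightly wider Gaussian.\<close>

lemma poly_le_exp_square:
  fixes u :: real assumes "u \<ge> 0"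
  shows "u ^ 3 \<le> 129 * exp (u\<^sup>2 / 8)" "u \<le> 129 * exp (u\<^sup>2 / 8)"
proof -
  have e: "1 + u\<^sup>2 / 8 + (u\<^sup>2 / 8)\<^sup>2 / 2 \<le> exp (u\<^sup>2 / 8)"
    by (rule exp_lower_Taylor_quadratic) simp
  have "(u\<^sup>2 / 8)\<^sup>2 / 2 = u ^ 4 / 128" by (simp add: power_divide flip: power_mult)
  moreover have "u ^ 3 \<le> 1 + u ^ 4" "u \<le> 1 + u ^ 4"
  proof -
    have "u ^ i \<le> 1 + u ^ 4" if "i \<le> 4" for i
    proof (cases "u \<le> 1")
      case True then have "u ^ i \<le> 1" using assms by (simp add: power_le_one)
      then show ?thesis using assms by (smt (verit) zero_le_power)
    next
      case False then have "u ^ i \<le> u ^ 4" using that by (intro power_increasing) auto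
      then show ?thesis by simp
    qed
    from this[of 3] this[of 1] show "u ^ 3 \<le> 1 + u ^ 4" "u \<le> 1 + u ^ 4" by auto
  qed
  moreover have "u\<^sup>2 / 8 \<ge> 0" "u ^ 4 \<ge> 0" by simp_all
  ultimately have "1 + u ^ 4 \<le> 129 * exp (u\<^sup>2 / 8)"
    using e by linarith
  then show "u ^ 3 \<le> 129 * exp (u\<^sup>2 / 8)" "u \<le> 129 * exp (u\<^sup>2 / 8)"
    using \<open>u ^ 3 \<le> 1 + u ^ 4\<close> \<open>u \<le> 1 + u ^ 4\<close> by linarith+
qed

text \<open>
  The characteristic function of a sum of \<open>j\<close> times independent Poisson variables with means
  \<open>l j\<close>, recentred at \<open>n\<close>.
\<close>
definition poisson_char :: "(nat \<Rightarrow> real) \<Rightarrow> nat \<Rightarrow> real \<Rightarrow> complex" where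
  "poisson_char l n t = exp (\<Sum>j=1..n. of_real (l j) * (cis (j * t) - 1)) * cis (- (n * t))"

lemma norm_poisson_char: "norm (poisson_char l n t) = exp (- (\<Sum>j=1..n. l j * (1 - cos (j * t))))"
  by (simp add: poisson_char_def norm_mult sum_negf[symmetric] algebra_simps)

lemma continuous_poisson_char: "continuous_on A (poisson_char l n)"
  unfolding poisson_char_def by (intro continuous_intros)

text \<open>The mean condition cancels the linear terms of the exponent. The quadratic ones sum to
  \<open>- V * t\<^sup>2 / 2\<close>, where \<open>V\<close> is the variance, and the Taylor
  remainders of \<open>cis\<close> are bounded by means of the third cumulant
  \<open>T\<close>.\<close>

lemma poisson_char_near_zero:
  assumes l: "\<And>j. j \<in> {1..n} \<Longrightarrow> l j \<ge> 0" and mean: "(\<Sum>j=1..n. j * l j) = real n"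
  defines "V \<equiv> \<Sum>j=1..n. real j ^ 2 * l j" and "T \<equiv> \<Sum>j=1..n. real j ^ 3 * l j"
  shows "norm (poisson_char l n t - of_real (exp (- (V * t\<^sup>2 / 2)))) \<le>
           (T * \<bar>t\<bar> ^ 3 / 6) * exp (- (V * t\<^sup>2 / 2) + T * \<bar>t\<bar> ^ 3 / 6)"
proof -
  define w where "w = (\<Sum>j=1..n. of_real (l j) * (cis (j * t) - 1)) - \<i> * of_real (n * t)"
  define v where "v = - (V * t\<^sup>2 / 2)"
  have T0: "T \<ge> 0" unfolding T_def using l by (intro sum_nonneg mult_nonneg_nonneg) auto
  have ch: "poisson_char l n t = exp w"
    by (simp add: poisson_char_def w_def exp_diff cis_conv_exp exp_minus divide_inverse)
  have "w - of_real v = (\<Sum>j=1..n. of_real (l j) * (cis (j * t) - 1 - \<i> * of_real (j * t) + of_real ((j * t)\<^sup>2) / 2))"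
  proof -
    have "\<i> * of_real (n * t) = (\<Sum>j=1..n. of_real (l j) * (\<i> * of_real (j * t)))"
      unfolding mean[symmetric] by (simp add: sum_distrib_left sum_distrib_right mult_ac)
    moreover have "of_real v = - (\<Sum>j=1..n. of_real (l j) * (of_real ((j * t)\<^sup>2) / 2) :: complex)"
      by (simp add: v_def V_def sum_distrib_left sum_distrib_right mult_ac power_mult_distrib sum_divide_distrib)
    ultimately show ?thesis
      unfolding w_def by (simp add: sum_subtractf sum.distrib ring_distribs)
  qed
  also have "norm \<dots> \<le> (\<Sum>j=1..n. l j * (\<bar>j * t\<bar> ^ 3 / 6))"
  proof (rule sum_norm_le)
    fix j assume "j \<in> {1..n}"
    then show "norm (of_real (l j) * (cis (j * t) - 1 - \<i> * of_real (j * t) + of_real ((j * t)\<^sup>2) / 2))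
        \<le> l j * (\<bar>j * t\<bar> ^ 3 / 6)"
      using l cis_taylor2[of "j * t"] unfolding norm_mult
      by (intro mult_mono) auto
  qed
  also have "\<dots> = T * \<bar>t\<bar> ^ 3 / 6"
  proof -
    have "(\<Sum>j=1..n. l j * (\<bar>j * t\<bar> ^ 3 / 6)) = (\<Sum>j=1..n. (real j ^ 3 * l j) * (\<bar>t\<bar> ^ 3 / 6))"
      by (intro sum.cong) (auto simp: abs_mult power_mult_distrib)
    also have "\<dots> = T * (\<bar>t\<bar> ^ 3 / 6)" unfolding T_def by (rule sum_distrib_right[symmetric])
    finally show ?thesis by simp
  qed
  finally have d: "norm (w - of_real v) \<le> T * \<bar>t\<bar> ^ 3 / 6" .
  have "norm (exp w - of_real (exp v)) \<le> norm (w - of_real v) * exp (v + norm (w - of_real v))"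
    by (rule norm_exp_diff_of_real_le)
  also have "\<dots> \<le> (T * \<bar>t\<bar> ^ 3 / 6) * exp (v + T * \<bar>t\<bar> ^ 3 / 6)"
    using d T0 by (intro mult_mono) auto
  finally show ?thesis by (simp add: ch v_def)
qed

text \<open>The line is cut at \<open>\<bar>t\<bar> = V / T\<close>. Inside,
  \<open>T * \<bar>t\<bar> ^ 3 \<le> V * t\<^sup>2\<close>, so the cubic error uses up only part of
  the Gaussian decay. Outside, the two functions are bounded separately; there
  \<open>\<tau> * u \<ge> 1\<close>, so even the bare Gaussian is of the size of the error term.
  \<open>\<tau>\<close> is the Lyapunov ratio. The bound holds on the whole line so that it can be
  integrated without treating Gaussian tails.\<close>

lemma poisson_char_gaussian_bound:
  assumes l: "\<And>j. j \<in> {1..n} \<Longrightarrow> l j \<ge> 0" and mean: "(\<Sum>j=1..n. j * l j) = real n"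
  defines "V \<equiv> \<Sum>j=1..n. real j ^ 2 * l j" and "T \<equiv> \<Sum>j=1..n. real j ^ 3 * l j"
  assumes V: "V > 0" and VT: "V \<le> T"
    and \<kappa>: "\<kappa> \<ge> 0" "\<And>t. V / T \<le> \<bar>t\<bar> \<Longrightarrow> \<bar>t\<bar> \<le> pi \<Longrightarrow> norm (poisson_char l n t) \<le> \<kappa>"
  shows "norm (indicator {-pi..pi} t *\<^sub>R poisson_char l n t - of_real (exp (- (V * t\<^sup>2 / 2)))) \<le>
    129 * (T / (V * sqrt V)) * exp (- (V / 8 * t\<^sup>2)) + \<kappa> * indicator {-pi..pi} t"
proof -
  define \<tau> where "\<tau> = T / (V * sqrt V)"
  define u where "u = sqrt V * \<bar>t\<bar>"
  have T: "T > 0" using V VT by simp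
  have \<tau>: "\<tau> > 0" using T V by (simp add: \<tau>_def)
  have u: "u \<ge> 0" "u\<^sup>2 = V * t\<^sup>2" using V by (auto simp: u_def power_mult_distrib)
  have Tt: "T * \<bar>t\<bar> ^ 3 = \<tau> * u ^ 3"
  proof -
    have "sqrt V ^ 3 = V * sqrt V" using V by (simp add: power3_eq_cube)
    then show ?thesis using V by (simp add: \<tau>_def u_def power_mult_distrib)
  qed
  have pos: "0 \<le> 129 * \<tau> * exp (- (V / 8 * t\<^sup>2))" using \<tau> by simp
  have \<kappa>i: "0 \<le> \<kappa> * indicator {-pi..pi} t" using \<kappa>(1) by (simp split: split_indicator)
  have split: "exp (- (V * t\<^sup>2 / 4)) * exp (u\<^sup>2 / 8) = exp (- (V / 8 * t\<^sup>2))"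
    by (simp add: u flip: exp_add)
  have "norm (indicator {-pi..pi} t *\<^sub>R poisson_char l n t - of_real (exp (- (V * t\<^sup>2 / 2)))) \<le>
    129 * \<tau> * exp (- (V / 8 * t\<^sup>2)) + \<kappa> * indicator {-pi..pi} t"
  proof (cases "\<bar>t\<bar> \<le> V / T")
    case True
    have "V / T \<le> 1" using VT T by simp
    then have "\<bar>t\<bar> \<le> pi" using True pi_gt3 by linarith
    then have ind: "indicator {-pi..pi} t = (1 :: real)" by (auto simp: abs_le_iff)
    have small: "T * \<bar>t\<bar> ^ 3 \<le> V * t\<^sup>2"
    proof -
      have "T * \<bar>t\<bar> \<le> V" using True T by (simp add: field_simps)
      then have "(T * \<bar>t\<bar>) * t\<^sup>2 \<le> V * t\<^sup>2" by (rule mult_right_mono) simp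
      moreover have "\<bar>t\<bar> ^ 3 = \<bar>t\<bar> * t\<^sup>2" by (simp add: power3_eq_cube power2_eq_square abs_mult_self_eq mult.assoc)
      ultimately show ?thesis by (simp add: mult.assoc)
    qed
    have "norm (poisson_char l n t - of_real (exp (- (V * t\<^sup>2 / 2)))) \<le>
           (T * \<bar>t\<bar> ^ 3 / 6) * exp (- (V * t\<^sup>2 / 2) + T * \<bar>t\<bar> ^ 3 / 6)"
      unfolding V_def T_def by (rule poisson_char_near_zero) (use l mean in auto)
    also have "\<dots> \<le> (T * \<bar>t\<bar> ^ 3) * exp (- (V * t\<^sup>2 / 4))"
    proof (rule mult_mono)
      show "T * \<bar>t\<bar> ^ 3 / 6 \<le> T * \<bar>t\<bar> ^ 3" "0 \<le> T * \<bar>t\<bar> ^ 3"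
        using T by (simp_all)
      have "0 \<le> V * t\<^sup>2" using V by simp
      then show "exp (- (V * t\<^sup>2 / 2) + T * \<bar>t\<bar> ^ 3 / 6) \<le> exp (- (V * t\<^sup>2 / 4))"
        using small unfolding exp_le_cancel_iff by linarith
    qed simp
    also have "\<dots> = \<tau> * (u ^ 3 * exp (- (V * t\<^sup>2 / 4)))" by (simp add: Tt)
    also have "\<dots> \<le> \<tau> * (129 * exp (u\<^sup>2 / 8) * exp (- (V * t\<^sup>2 / 4)))"
      using \<tau> poly_le_exp_square(1)[OF u(1)] by (intro mult_left_mono mult_right_mono) auto
    also have "\<dots> = 129 * \<tau> * exp (- (V / 8 * t\<^sup>2))"
      unfolding split[symmetric] by (simp add: mult_ac)
    finally show ?thesis using ind \<kappa>i by simp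
  next
    case False
    have "1 \<le> \<tau> * u"
    proof -
      have "\<tau> * u = T * \<bar>t\<bar> / V" using V by (simp add: \<tau>_def u_def)
      moreover have "V \<le> T * \<bar>t\<bar>" using False T by (simp add: field_simps)
      ultimately show ?thesis using V by simp
    qed
    then have "1 * exp (- (V * t\<^sup>2 / 2)) \<le> (\<tau> * u) * exp (- (V * t\<^sup>2 / 4))"
      using V by (intro mult_mono) auto
    also have "\<dots> = \<tau> * (u * exp (- (V * t\<^sup>2 / 4)))" by simp
    also have "\<dots> \<le> \<tau> * (129 * exp (u\<^sup>2 / 8) * exp (- (V * t\<^sup>2 / 4)))"
      using \<tau> poly_le_exp_square(2)[OF u(1)] by (intro mult_left_mono mult_right_mono) auto
    also have "\<dots> = 129 * \<tau> * exp (- (V / 8 * t\<^sup>2))"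
      unfolding split[symmetric] by (simp add: mult_ac)
    finally have g: "exp (- (V * t\<^sup>2 / 2)) \<le> 129 * \<tau> * exp (- (V / 8 * t\<^sup>2))" by simp
    have "norm (indicator {-pi..pi} t *\<^sub>R poisson_char l n t) \<le> \<kappa> * indicator {-pi..pi} t"
      using False \<kappa>(2)[of t] by (auto split: split_indicator simp: abs_le_iff)
    then show ?thesis using g
      by (intro order_trans[OF norm_triangle_ineq4]) (simp add: norm_of_real add_mono)
  qed
  then show ?thesis by (simp add: \<tau>_def)
qed

text \<open>By Fourier inversion \<open>P\<close> is the probability that the Poisson sum equals its
  mean. The pointwise bound is integrated and rescaled by \<open>sqrt (V / (2 * pi))\<close>, the
  inverse of the Gaussian integral.\<close>

lemma poisson_char_integral_bound:
  assumes l: "\<And>j. j \<in> {1..n} \<Longrightarrow> l j \<ge> 0" and mean: "(\<Sum>j=1..n. j * l j) = real n"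
  defines "V \<equiv> \<Sum>j=1..n. real j ^ 2 * l j" and "T \<equiv> \<Sum>j=1..n. real j ^ 3 * l j"
  assumes V: "V > 0" and VT: "V \<le> T"
    and \<kappa>: "\<kappa> \<ge> 0" "\<And>t. V / T \<le> \<bar>t\<bar> \<Longrightarrow> \<bar>t\<bar> \<le> pi \<Longrightarrow> norm (poisson_char l n t) \<le> \<kappa>"
    and P: "(poisson_char l n has_integral of_real (2 * pi * P)) {-pi..pi}"
  shows "\<bar>sqrt (2 * pi * V) * P - 1\<bar> \<le> 258 * (T / (V * sqrt V)) + sqrt (2 * pi * V) * \<kappa>"
proof -
  define \<tau> where "\<tau> = T / (V * sqrt V)"
  let ?I = "\<lambda>t. indicator {-pi..pi} t *\<^sub>R poisson_char l n t"
  have int: "integrable lborel ?I"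
    using borel_integrable_atLeastAtMost'[OF continuous_poisson_char, of "-pi" pi l n]
    by (simp add: set_integrable_def)
  have "(LINT t : {-pi..pi} | lborel. poisson_char l n t) = integral {-pi..pi} (poisson_char l n)"
    by (rule set_borel_integral_eq_integral(2))
       (use int in \<open>simp add: set_integrable_def\<close>)
  also have "\<dots> = of_real (2 * pi * P)" using P by (rule integral_unique)
  finally have I: "integral\<^sup>L lborel ?I = of_real (2 * pi * P)"
    by (simp add: set_lebesgue_integral_def)
  have g: "has_bochner_integral lborel (\<lambda>t. exp (- (V * t\<^sup>2 / 2))) (sqrt (2 * pi / V))"
    using has_bochner_integral_gaussian[of "V / 2"] V by (simp add: mult_ac)
  have gc: "has_bochner_integral lborel (\<lambda>t. complex_of_real (exp (- (V * t\<^sup>2 / 2)))) (of_real (sqrt (2 * pi / V)))"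
    using g by (rule has_bochner_integral_of_real)
  have b1: "has_bochner_integral lborel (\<lambda>t. 129 * \<tau> * exp (- (V / 8 * t\<^sup>2))) (129 * \<tau> * sqrt (pi / (V / 8)))"
    using V by (intro has_bochner_integral_mult_right has_bochner_integral_gaussian) auto
  have b2: "has_bochner_integral lborel (\<lambda>t::real. \<kappa> * indicator {-pi..pi} t) (\<kappa> * (2 * pi))"
    using has_bochner_integral_real_indicator[of "{-pi..pi}" lborel]
    by (intro has_bochner_integral_mult_right) simp
  have b: "has_bochner_integral lborel (\<lambda>t. 129 * \<tau> * exp (- (V / 8 * t\<^sup>2)) + \<kappa> * indicator {-pi..pi} t)
     (129 * \<tau> * sqrt (pi / (V / 8)) + \<kappa> * (2 * pi))"
    using b1 b2 by (rule has_bochner_integral_add)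
  have d: "has_bochner_integral lborel (\<lambda>t. ?I t - of_real (exp (- (V * t\<^sup>2 / 2))))
      (of_real (2 * pi * P - sqrt (2 * pi / V)))"
    unfolding of_real_diff using int I gc
    by (intro has_bochner_integral_diff) (auto simp: has_bochner_integral_iff)
  have bound: "norm (?I t - of_real (exp (- (V * t\<^sup>2 / 2)))) \<le>
      129 * \<tau> * exp (- (V / 8 * t\<^sup>2)) + \<kappa> * indicator {-pi..pi} t" for t
    unfolding V_def T_def \<tau>_def
    by (rule poisson_char_gaussian_bound) (use l mean V VT \<kappa> in \<open>simp_all add: V_def T_def\<close>)
  have "norm (complex_of_real (2 * pi * P - sqrt (2 * pi / V))) \<le> 129 * \<tau> * sqrt (pi / (V / 8)) + \<kappa> * (2 * pi)"
  proof -
    have "norm (integral\<^sup>L lborel (\<lambda>t. ?I t - of_real (exp (- (V * t\<^sup>2 / 2))))) \<le>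
        integral\<^sup>L lborel (\<lambda>t. 129 * \<tau> * exp (- (V / 8 * t\<^sup>2)) + \<kappa> * indicator {-pi..pi} t)"
      using d b bound
      by (intro order_trans[OF integral_norm_bound] integral_mono) (auto simp: has_bochner_integral_iff)
    then show ?thesis using d b by (simp add: has_bochner_integral_iff)
  qed
  then have le: "\<bar>2 * pi * P - sqrt (2 * pi / V)\<bar> \<le> 129 * \<tau> * sqrt (pi / (V / 8)) + \<kappa> * (2 * pi)"
    by (simp only: norm_of_real)
  define s where "s = sqrt (V / (2 * pi))"
  have s: "s > 0" using V by (simp add: s_def)
  have e1: "s * sqrt (2 * pi / V) = 1" using V by (simp add: s_def flip: real_sqrt_mult)
  have e2: "s * (2 * pi) = sqrt (2 * pi * V)"
    using V by (simp add: s_def real_sqrt_divide real_sqrt_mult field_simps)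
  \<comment> \<open>The error Gaussian has a quarter of the coefficient \<open>V / 2\<close> in its
    exponent, hence twice the integral: this turns 129 into 258.\<close>
  have e3: "s * sqrt (pi / (V / 8)) = 2"
  proof -
    have "s * sqrt (pi / (V / 8)) = sqrt (2 ^ 2)"
      using V by (simp add: s_def flip: real_sqrt_mult)
    then show ?thesis by simp
  qed
  have "\<bar>sqrt (2 * pi * V) * P - 1\<bar> = s * \<bar>2 * pi * P - sqrt (2 * pi / V)\<bar>"
  proof -
    have "sqrt (2 * pi * V) * P - 1 = s * (2 * pi * P - sqrt (2 * pi / V))"
      unfolding right_diff_distrib e1 e2[symmetric] by simp
    then show ?thesis using s by (simp add: abs_mult)
  qed
  also have "\<dots> \<le> s * (129 * \<tau> * sqrt (pi / (V / 8)) + \<kappa> * (2 * pi))"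
    using le s by (intro mult_left_mono) auto
  also have "\<dots> = 129 * \<tau> * (s * sqrt (pi / (V / 8))) + s * (2 * pi) * \<kappa>"
    by (simp add: algebra_simps)
  also have "\<dots> = 258 * \<tau> + sqrt (2 * pi * V) * \<kappa>"
    unfolding e2 e3 by simp
  finally show ?thesis by (simp add: \<tau>_def)
qed

section \<open>The characteristic function away from zero\<close>

lemma one_minus_cos_ge:
  fixes u :: real assumes "\<bar>u\<bar> \<le> 1"
  shows "u\<^sup>2 / 3 \<le> 1 - cos u"
proof -
  have "Re (cis u - 1 - \<i> * u + u\<^sup>2 / 2) \<le> \<bar>u\<bar> ^ 3 / 6"
    using complex_Re_le_cmod cis_taylor2 by (rule order_trans)
  moreover have "Re (cis u - 1 - \<i> * u + u\<^sup>2 / 2) = cos u - 1 + u\<^sup>2 / 2"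
    by simp
  moreover have "\<bar>u\<bar> ^ 3 \<le> u\<^sup>2"
  proof -
    have "\<bar>u\<bar> * u\<^sup>2 \<le> 1 * u\<^sup>2" using assms by (intro mult_right_mono) auto
    then show ?thesis by (simp add: power3_eq_cube power2_eq_square abs_mult_self_eq mult.assoc)
  qed
  ultimately show ?thesis by linarith
qed

text \<open>A triangle inequality in disguise: \<open>1 - cos u\<close> is twice the square of
  \<open>sin (u / 2)\<close>, and \<open>\<bar>sin\<bar>\<close> is subadditive.\<close>

lemma one_minus_cos_diff_le:
  fixes a b :: real
  shows "1 - cos (a - b) \<le> 2 * ((1 - cos a) + (1 - cos b))"
proof -
  have half: "1 - cos u = 2 * (sin (u / 2))\<^sup>2" for u :: real
    using cos_double_sin[of "u / 2"] by simp
  define p q where "p = sin (a / 2) * cos (b / 2)" and "q = cos (a / 2) * sin (b / 2)"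
  have "(sin ((a - b) / 2))\<^sup>2 = (p - q)\<^sup>2"
    by (simp add: p_def q_def sin_diff diff_divide_distrib)
  also have "\<dots> \<le> 2 * (p\<^sup>2 + q\<^sup>2)"
    using zero_le_power2[of "p + q"] by (simp add: power2_eq_square algebra_simps)
  also have "p\<^sup>2 \<le> (sin (a / 2))\<^sup>2" "q\<^sup>2 \<le> (sin (b / 2))\<^sup>2"
    using mult_left_mono[OF abs_square_le_1[THEN iffD2, OF abs_cos_le_one[of "b / 2"]], of "(sin (a / 2))\<^sup>2"]
      mult_right_mono[OF abs_square_le_1[THEN iffD2, OF abs_cos_le_one[of "a / 2"]], of "(sin (b / 2))\<^sup>2"]
    by (simp_all add: p_def q_def power_mult_distrib)
  then have "2 * (p\<^sup>2 + q\<^sup>2) \<le> 2 * ((sin (a / 2))\<^sup>2 + (sin (b / 2))\<^sup>2)" by simp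
  finally show ?thesis unfolding half by simp
qed

text \<open>
  Two consecutive frequencies \<open>m\<close> and \<open>m - 1\<close> cannot both be in resonance with \<open>t\<close>, which is all
  that is needed to control the characteristic function away from zero.
\<close>
lemma norm_poisson_char_away:
  assumes l: "\<And>j. j \<in> {1..n} \<Longrightarrow> l j \<ge> 0" and m: "2 \<le> m" "m \<le> n"
    and \<mu>: "0 \<le> \<mu>" "\<mu> \<le> l m" "\<mu> \<le> l (m - 1)"
    and \<rho>: "0 \<le> \<rho>" "\<rho> \<le> 1" "\<rho> \<le> \<bar>t\<bar>" "\<bar>t\<bar> \<le> pi"
  shows "norm (poisson_char l n t) \<le> exp (- (\<mu> * \<rho>\<^sup>2 / 6))"
proof -
  have "cos \<bar>t\<bar> \<le> cos \<rho>" using \<rho> by (intro cos_monotone_0_pi_le) auto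
  then have "\<rho>\<^sup>2 / 3 \<le> 1 - cos t"
    using one_minus_cos_ge[of \<rho>] \<rho> by simp
  also have "\<dots> = 1 - cos (m * t - (m - 1 :: nat) * t)"
    using m by (simp add: of_nat_diff algebra_simps)
  also have "\<dots> \<le> 2 * ((1 - cos (m * t)) + (1 - cos ((m - 1 :: nat) * t)))"
    by (rule one_minus_cos_diff_le)
  finally have "\<mu> * (\<rho>\<^sup>2 / 3) \<le> \<mu> * (2 * ((1 - cos (m * t)) + (1 - cos ((m - 1 :: nat) * t))))"
    using \<mu>(1) by (rule mult_left_mono)
  then have "\<mu> * \<rho>\<^sup>2 / 6 \<le> \<mu> * (1 - cos (m * t)) + \<mu> * (1 - cos ((m - 1 :: nat) * t))"
    by (simp add: algebra_simps)
  also have "\<dots> \<le> l m * (1 - cos (m * t)) + l (m - 1) * (1 - cos ((m - 1 :: nat) * t))"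
    using \<mu> by (intro add_mono mult_right_mono) auto
  also have "\<dots> = (\<Sum>j\<in>{m, m - 1}. l j * (1 - cos (j * t)))"
    using m by (subst sum.insert) auto
  also have "\<dots> \<le> (\<Sum>j=1..n. l j * (1 - cos (j * t)))"
    using m l by (intro sum_mono2) auto
  finally show ?thesis by (simp add: norm_poisson_char)
qed

text \<open>The single index \<open>j = m\<close> already gives \<open>V \<ge> c * n * m\<close>.
  Against the third cumulant, at most \<open>K * n * m\<^sup>2\<close>, this makes the Lyapunov
  ratio of order \<open>sqrt (m / n)\<close>. Away from zero only the indices \<open>m\<close> and
  \<open>m - 1\<close> are used, which is why \<open>b\<close> has to be known exactly only
  there.\<close>

lemma local_limit_bound:
  fixes b h :: "nat \<Rightarrow> real"
  assumes h0: "h 0 = 1" and rec: "\<And>i. 0 < i \<Longrightarrow> i \<le> n \<Longrightarrow> real i * h i = (\<Sum>j=1..i. b j * h (i - j))"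
    and b: "\<And>j. b j \<ge> 0" and m: "2 \<le> m" "m \<le> n" and bm: "b m = 1" "b (m - 1) = 1"
    and y: "0 < y" "y \<le> y1" "1 \<le> y1" and c: "c > 0" "c * n \<le> y ^ m"
    and mean: "(\<Sum>j=1..n. b j * y ^ j) = real n"
  defines "V \<equiv> \<Sum>j=1..n. real j * (b j * y ^ j)"
  assumes T: "(\<Sum>j=1..n. real j ^ 2 * (b j * y ^ j)) \<le> K * n * (real m)\<^sup>2"
  shows "V > 0" "\<bar>sqrt (2 * pi * V) * (h n * y ^ n * exp (- (\<Sum>j=1..n. b j * y ^ j / j))) - 1\<bar>
    \<le> 258 * K / (c * sqrt c) * sqrt (m / n)
      + sqrt (2 * pi * K) * (sqrt n * m * exp (- (c ^ 3 / (6 * y1 * K\<^sup>2) * (n / real m ^ 3))))"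
proof -
  define l where "l j = b j * y ^ j / j" for j :: nat
  define T where "T = (\<Sum>j=1..n. real j ^ 2 * (b j * y ^ j))"
  have TK: "T \<le> K * n * (real m)\<^sup>2" using T by (simp add: T_def)
  have n: "n > 0" "m > 0" "real n > 0" "real m > 0" using m by auto
  have l0: "l j \<ge> 0" for j using b y by (simp add: l_def)
  have lmean: "(\<Sum>j=1..n. j * l j) = real n"
    unfolding mean[symmetric] by (intro sum.cong) (auto simp: l_def)
  have lV: "V = (\<Sum>j=1..n. real j ^ 2 * l j)"
    unfolding V_def by (intro sum.cong) (auto simp: l_def power2_eq_square)
  have lT: "T = (\<Sum>j=1..n. real j ^ 3 * l j)"
    unfolding T_def by (intro sum.cong) (auto simp: l_def power2_eq_square power3_eq_cube)
  have Vlow: "c * n * m \<le> V"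
  proof -
    have "c * n * m \<le> y ^ m * m" using c n by (intro mult_right_mono) auto
    also have "\<dots> = (\<Sum>j\<in>{m}. real j * (b j * y ^ j))" using bm by simp
    also have "\<dots> \<le> V" unfolding V_def using m b y by (intro sum_mono2) auto
    finally show ?thesis .
  qed
  moreover have cnm: "c * n * m > 0" using c n by simp
  ultimately show V: "V > 0" by linarith
  have VT: "V \<le> T"
    unfolding V_def T_def using b y
    by (intro sum_mono mult_right_mono) (auto simp: power2_eq_square)
  have K: "K > 0"
  proof -
    have "0 < K * (real n * (real m)\<^sup>2)" using V VT TK by (simp add: mult.assoc)
    then show ?thesis by (rule zero_less_mult_pos2) (use n in simp)
  qed
  \<comment> \<open>\<open>\<rho>\<close> is a lower bound for the cut \<open>V / T\<close>, and
    \<open>\<mu>\<close> one for both \<open>l m\<close> and \<open>l (m - 1)\<close>; the bound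
    \<open>y1\<close> enters because \<open>y ^ (m - 1)\<close> is \<open>y ^ m / y\<close>. The
    exponent \<open>\<mu> * \<rho>\<^sup>2 / 6\<close> is then of order
    \<open>n / m ^ 3\<close>.\<close>
  define \<rho> where "\<rho> = c / (K * m)"
  define \<mu> where "\<mu> = c * n / (m * y1)"
  define \<kappa> where "\<kappa> = exp (- (\<mu> * \<rho>\<^sup>2 / 6))"
  have \<rho>V: "\<rho> \<le> V / T"
  proof -
    have "c * n * m / (K * n * (real m)\<^sup>2) \<le> V / T"
      using Vlow TK V VT cnm by (intro frac_le) auto
    moreover have "c * n * m / (K * n * (real m)\<^sup>2) = \<rho>"
      using n by (simp add: \<rho>_def power2_eq_square)
    ultimately show ?thesis by simp
  qed
  have \<mu>: "0 \<le> \<mu>" "\<mu> \<le> l m" "\<mu> \<le> l (m - 1)"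
  proof -
    show "0 \<le> \<mu>" using c y by (simp add: \<mu>_def)
    have "\<mu> \<le> y ^ m / (m * y1)"
      unfolding \<mu>_def using c y by (intro divide_right_mono) auto
    also have "\<dots> \<le> y ^ m / (m * 1)"
      using y n by (intro divide_left_mono mult_left_mono) auto
    finally show "\<mu> \<le> l m" by (simp add: l_def bm)
    have "\<mu> \<le> y ^ m / (m * y1)"
      unfolding \<mu>_def using c y by (intro divide_right_mono) auto
    also have "\<dots> \<le> y ^ m / (real (m - 1) * y)"
      using y m by (intro divide_left_mono mult_mono) (auto simp: of_nat_diff)
    also have "\<dots> = l (m - 1)"
      using m y bm by (cases m) (auto simp: l_def)
    finally show "\<mu> \<le> l (m - 1)" .
  qed
  have away: "norm (poisson_char l n t) \<le> \<kappa>" if "V / T \<le> \<bar>t\<bar>" "\<bar>t\<bar> \<le> pi" for t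
    unfolding \<kappa>_def
  proof (rule norm_poisson_char_away[OF l0 m \<mu>])
    show "0 \<le> \<rho>" using c K by (simp add: \<rho>_def)
    have "V / T \<le> 1" using V VT by simp
    then show "\<rho> \<le> 1" using \<rho>V by simp
    show "\<rho> \<le> \<bar>t\<bar>" "\<bar>t\<bar> \<le> pi" using \<rho>V that by auto
  qed
  define P where "P = h n * y ^ n * exp (- (\<Sum>j=1..n. l j))"
  have int: "(poisson_char l n has_integral of_real (2 * pi * P)) {-pi..pi}"
  proof -
    have "((\<lambda>t::real. of_real (exp (- (\<Sum>j=1..n. l j))) * (exp (\<Sum>j=1..n. of_real (b j * y ^ j / j) * cis (j * t)) * cis (- (n * t))))
       has_integral (of_real (exp (- (\<Sum>j=1..n. l j))) * of_real (2 * pi * h n * y ^ n))) {-pi..pi}"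
      by (intro has_integral_mult_right coefficient_integral[OF h0 rec y(1)])
    moreover have "(\<lambda>t::real. of_real (exp (- (\<Sum>j=1..n. l j))) * (exp (\<Sum>j=1..n. of_real (b j * y ^ j / j) * cis (j * t)) * cis (- (n * t))))
        = poisson_char l n"
    proof
      fix t :: real
      have "(\<Sum>j=1..n. of_real (l j) * (cis (j * t) - 1)) =
          (\<Sum>j=1..n. of_real (l j) * cis (j * t)) - of_real (\<Sum>j=1..n. l j)"
        by (simp add: right_diff_distrib sum_subtractf)
      then have "exp (\<Sum>j=1..n. of_real (l j) * (cis (j * t) - 1)) =
          exp (\<Sum>j=1..n. of_real (l j) * cis (j * t)) * of_real (exp (- (\<Sum>j=1..n. l j)))"
        by (simp only: exp_diff exp_of_real exp_minus divide_inverse of_real_inverse)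
      then show "of_real (exp (- (\<Sum>j=1..n. l j))) * (exp (\<Sum>j=1..n. of_real (b j * y ^ j / j) * cis (j * t)) * cis (- (n * t)))
        = poisson_char l n t"
        by (simp add: poisson_char_def l_def)
    qed
    moreover have "of_real (exp (- (\<Sum>j=1..n. l j))) * of_real (2 * pi * h n * y ^ n) = (of_real (2 * pi * P) :: complex)"
      by (simp add: P_def)
    ultimately show ?thesis by (simp only:)
  qed
  have "\<bar>sqrt (2 * pi * V) * P - 1\<bar> \<le> 258 * (T / (V * sqrt V)) + sqrt (2 * pi * V) * \<kappa>"
    by (rule poisson_char_integral_bound[where l = l and n = n, OF l0 lmean, folded lV lT])
       (use V VT away int in \<open>simp_all add: \<kappa>_def\<close>)
  also have "\<dots> \<le> 258 * (K * n * (real m)\<^sup>2 / (c * n * m * sqrt (c * n * m))) + sqrt (2 * pi * (K * n * (real m)\<^sup>2)) * \<kappa>"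
  proof (intro add_mono mult_left_mono mult_right_mono)
    show "T / (V * sqrt V) \<le> K * n * (real m)\<^sup>2 / (c * n * m * sqrt (c * n * m))"
      using TK Vlow cnm V VT by (intro frac_le mult_mono) auto
    show "sqrt (2 * pi * V) \<le> sqrt (2 * pi * (K * n * (real m)\<^sup>2))"
      using VT TK by simp
  qed (auto simp: \<kappa>_def)
  also have "K * n * (real m)\<^sup>2 / (c * n * m * sqrt (c * n * m)) = K / (c * sqrt c) * sqrt (m / n)"
  proof -
    have "sqrt m * sqrt m = m" "sqrt n * sqrt n = n" "sqrt n > 0" "sqrt m > 0" "sqrt c > 0" using n c by auto
    then show ?thesis
      using n c by (simp add: real_sqrt_mult real_sqrt_divide power2_eq_square field_simps)
  qed
  also have "sqrt (2 * pi * (K * n * (real m)\<^sup>2)) = sqrt (2 * pi * K) * (sqrt n * m)"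
    by (simp add: real_sqrt_mult)
  also have "\<kappa> = exp (- (c ^ 3 / (6 * y1 * K\<^sup>2) * (n / real m ^ 3)))"
    by (simp add: \<kappa>_def \<mu>_def \<rho>_def power2_eq_square power3_eq_cube mult_ac)
  finally show "\<bar>sqrt (2 * pi * V) * (h n * y ^ n * exp (- (\<Sum>j=1..n. b j * y ^ j / j))) - 1\<bar>
    \<le> 258 * K / (c * sqrt c) * sqrt (m / n)
      + sqrt (2 * pi * K) * (sqrt n * m * exp (- (c ^ 3 / (6 * y1 * K\<^sup>2) * (n / real m ^ 3))))"
    by (simp add: P_def l_def mult.assoc)
qed

section \<open>The weights beyond the smoothness bound\<close>

lemma card_field_ge_2: "CARD('a::{finite,field}) \<ge> 2"
proof -
  have "card {0, 1 :: 'a} \<le> CARD('a)" by (intro card_mono) auto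
  then show ?thesis by simp
qed

lemma sum_powers_le:
  fixes q :: nat assumes "q \<ge> 2"
  shows "(\<Sum>d=1..D. q ^ d) \<le> 2 * q ^ D"
proof (induction D)
  case (Suc D)
  have "(\<Sum>d=1..Suc D. q ^ d) \<le> 2 * q ^ D + q * q ^ D" using Suc by simp
  also have "\<dots> \<le> q * q ^ D + q * q ^ D" using assms by (intro add_mono mult_right_mono) auto
  finally show ?case by simp
qed simp

text \<open>The irreducibles of degree exactly \<open>d\<close> form part of the sum
  \<open>irred_weight d d = q ^ d\<close>.\<close>

lemma sum_irreds_degree_le:
  assumes "d > 0"
  shows "(\<Sum>P | P \<in> (irreds_le m :: 'a::{finite,field} poly set) \<and> degree P = d. degree P) \<le> CARD('a) ^ d"
proof -
  have "(\<Sum>P | P \<in> (irreds_le m :: 'a poly set) \<and> degree P = d. degree P) \<le> irred_weight TYPE('a) d d"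
    unfolding irred_weight_def
    by (intro sum_mono2) (use finite_irreds_le[of d] in \<open>auto simp: irreds_le_def intro: finite_subset[rotated]\<close>)
  then show ?thesis using irred_weight_eq_power[of d d, where 'a = 'a] assms by simp
qed

lemma irred_weight_le:
  assumes "\<And>P. P \<in> (irreds_le m :: 'a::{finite,field} poly set) \<Longrightarrow> degree P dvd j \<Longrightarrow> degree P \<le> D"
  shows "irred_weight TYPE('a) m j \<le> 2 * CARD('a) ^ D"
proof -
  let ?I = "{P. P \<in> (irreds_le m :: 'a poly set) \<and> degree P dvd j}"
  have fin: "finite ?I" using finite_irreds_le[of m] by (auto intro: finite_subset[rotated])
  have "irred_weight TYPE('a) m j = (\<Sum>d=1..D. \<Sum>P | P \<in> ?I \<and> degree P = d. degree P)"
    unfolding irred_weight_def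
    by (rule sum.group[OF fin, symmetric])
       (use assms in \<open>auto simp: irreds_le_def Suc_le_eq dest: monic_irreducibleD(4)\<close>)
  also have "\<dots> \<le> (\<Sum>d=1..D. CARD('a) ^ d)"
  proof (rule sum_mono)
    fix d assume "d \<in> {1..D}"
    then have "(\<Sum>P | P \<in> (irreds_le m :: 'a poly set) \<and> degree P = d. degree P) \<le> CARD('a) ^ d"
      by (intro sum_irreds_degree_le) simp
    moreover have "(\<Sum>P | P \<in> ?I \<and> degree P = d. degree P) \<le> (\<Sum>P | P \<in> (irreds_le m :: 'a poly set) \<and> degree P = d. degree P)"
      using finite_irreds_le[of m] by (intro sum_mono2) (auto intro: finite_subset[rotated])
    ultimately show "(\<Sum>P | P \<in> ?I \<and> degree P = d. degree P) \<le> CARD('a) ^ d" by (rule le_trans[rotated])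
  qed
  also have "\<dots> \<le> 2 * CARD('a) ^ D" using card_field_ge_2 by (rule sum_powers_le)
  finally show ?thesis .
qed

lemma irred_weight_le_power: "irred_weight TYPE('a::{finite,field}) m j \<le> 2 * CARD('a) ^ m"
  by (rule irred_weight_le) (simp add: irreds_le_def)

text \<open>Beyond \<open>m\<close> only proper powers of irreducibles contribute, so the degree of
  the base is at most \<open>j div 2\<close>.\<close>

lemma irred_weight_le_half_power:
  assumes "m < j"
  shows "irred_weight TYPE('a::{finite,field}) m j \<le> 2 * CARD('a) ^ (j div 2)"
proof (rule irred_weight_le)
  fix P :: "'a poly" assume P: "P \<in> irreds_le m" "degree P dvd j"
  then obtain k where k: "j = degree P * k" by blast
  have "degree P < j" using P assms by (simp add: irreds_le_def)
  then have "k \<ge> 2" using k by (cases k; cases "k - 1") auto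
  then have "degree P * 2 \<le> j" unfolding k by (intro mult_le_mono2)
  then show "degree P \<le> j div 2" by linarith
qed

text \<open>Every divisor of \<open>m\<close> divides \<open>2 * m\<close>. The main contribution is
  that of the squares of irreducibles of degree \<open>m\<close>, and it is what eventually bounds
  \<open>\<theta>\<close> from below.\<close>

lemma irred_weight_double_ge:
  assumes "m > 0"
  shows "CARD('a::{finite,field}) ^ m \<le> irred_weight TYPE('a) m (2 * m)"
proof -
  have "CARD('a) ^ m = irred_weight TYPE('a) m m" using assms by (simp add: irred_weight_eq_power)
  also have "\<dots> \<le> irred_weight TYPE('a) m (2 * m)"
    unfolding irred_weight_def
    by (intro sum_mono2) (use finite_irreds_le[of m] in \<open>auto intro: finite_subset[rotated]\<close>)
  finally show ?thesis .
qed

lemma summable_square_times_power: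
  fixes s :: real assumes "0 \<le> s" "s < 1"
  shows "summable (\<lambda>i. (1 + real i)\<^sup>2 * s ^ i)"
proof (cases "s = 0")
  case True
  then show ?thesis by (intro summable_finite[of "{0}"]) (auto simp: power_0_left)
next
  case False
  define t where "t = (1 + s) / 2"
  have t: "s < t" "0 < t" "t < 1" and s: "0 < s" using assms False by (auto simp: t_def)
  show ?thesis
  proof (rule summable_comparison_test_bigo)
    show "summable (\<lambda>i. norm (t ^ i))" using t by (simp add: summable_geometric)
    show "(\<lambda>i. (1 + real i)\<^sup>2 * s ^ i) \<in> O(\<lambda>i. t ^ i)" using s t by real_asymp
  qed
qed

text \<open>
  The coefficients \<open>a j = irred_weight m j / q ^ j\<close> are of size \<open>q powr (- j / 2)\<close> up to \<open>j = 2 * m\<close>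
  and \<open>q powr (m - j)\<close> afterwards, so for \<open>sqrt q < x < q\<close> the terms \<open>a j * x ^ j\<close>
  decay geometrically on both sides of \<open>j = 2 * m\<close>.
\<close>
lemma irred_weight_term_le:
  fixes m j :: nat and x s :: real
  defines "q \<equiv> real CARD('a::{finite,field})"
  assumes j: "m < j" and x: "0 < x" and s: "sqrt q \<le> s * x" "x \<le> s * q"
  shows "irred_weight TYPE('a) m j / q ^ j * x ^ j \<le> 2 * (x ^ (2 * m) / q ^ m) * s ^ nat \<bar>int j - 2 * int m\<bar>"
proof -
  have q: "q \<ge> 2" "q > 0" using card_field_ge_2[where 'a = 'a] by (simp_all add: q_def)
  have qq: "q = sqrt q * sqrt q" using q by simp
  show ?thesis
  proof (cases "j \<le> 2 * m")
    case True
    then obtain i where i: "2 * m = j + i" using le_Suc_ex by blast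
    have "real (irred_weight TYPE('a) m j) \<le> 2 * q ^ (j div 2)"
      using irred_weight_le_half_power[OF j, where 'a = 'a] unfolding q_def
      by (metis of_nat_mono of_nat_mult of_nat_numeral of_nat_power)
    also have "q ^ (j div 2) = sqrt q ^ (2 * (j div 2))"
      using q by (simp add: power_mult)
    also have "\<dots> \<le> sqrt q ^ j" using q by (intro power_increasing) auto
    finally have "irred_weight TYPE('a) m j / q ^ j * x ^ j \<le> (2 * sqrt q ^ j) / q ^ j * x ^ j"
      using q x by (intro mult_right_mono divide_right_mono) auto
    also have "\<dots> = 2 * (x / sqrt q) ^ j"
    proof -
      have "q ^ j = sqrt q ^ j * sqrt q ^ j" by (subst qq) (rule power_mult_distrib)
      then show ?thesis using q by (simp add: power_divide)
    qed
    also have "\<dots> \<le> 2 * ((x / sqrt q) ^ j * ((x * s) / sqrt q) ^ i)"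
    proof -
      \<comment> \<open>Here \<open>sqrt q \<le> s * x\<close> is used: the \<open>i\<close> factors
        \<open>x / sqrt q\<close> missing up to the exponent \<open>2 * m\<close> are supplied at
        the price of \<open>s ^ i\<close> in the bound.\<close>
      have "1 \<le> ((x * s) / sqrt q) ^ i" using s q by (intro one_le_power) (simp add: mult.commute)
      then show ?thesis using x q by simp
    qed
    also have "\<dots> = 2 * ((x / sqrt q) ^ (2 * m)) * s ^ i"
      by (simp add: i power_add power_mult_distrib power_divide)
    also have "(x / sqrt q) ^ (2 * m) = x ^ (2 * m) / q ^ m"
      using q by (simp add: power_divide power_mult)
    also have "i = nat \<bar>int j - 2 * int m\<bar>" using i by linarith
    finally show ?thesis by simp
  next
    case False
    then obtain i where i: "j = 2 * m + i" by (metis le_Suc_ex nat_le_linear)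
    have "real (irred_weight TYPE('a) m j) \<le> 2 * q ^ m"
      using irred_weight_le_power[of m j, where 'a = 'a] unfolding q_def
      by (metis of_nat_mono of_nat_mult of_nat_numeral of_nat_power)
    then have "irred_weight TYPE('a) m j / q ^ j * x ^ j \<le> (2 * q ^ m) / q ^ j * x ^ j"
      using q x by (intro mult_right_mono divide_right_mono) auto
    also have "\<dots> = 2 * (x ^ (2 * m) / q ^ m) * (x / q) ^ i"
    proof -
      have "q ^ j = q ^ m * q ^ m * q ^ i" by (simp add: i power_add mult_2)
      moreover have "x ^ j = x ^ (2 * m) * x ^ i" unfolding i by (rule power_add)
      ultimately show ?thesis using q by (simp add: power_divide)
    qed
    also have "\<dots> \<le> 2 * (x ^ (2 * m) / q ^ m) * s ^ i"
      using s x q by (intro mult_left_mono power_mono) (auto simp: field_simps)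
    also have "i = nat \<bar>int j - 2 * int m\<bar>" using i by linarith
    finally show ?thesis by simp
  qed
qed

text \<open>Each distance to \<open>k\<close> occurs at most once on either side.\<close>

lemma sum_reflected_le:
  fixes g :: "nat \<Rightarrow> real"
  assumes g: "summable g" "\<And>i. g i \<ge> 0"
  shows "(\<Sum>j=a..N. g (nat \<bar>int j - int k\<bar>)) \<le> 2 * suminf g"
proof -
  have "(\<Sum>j=a..N. g (nat \<bar>int j - int k\<bar>)) \<le> (\<Sum>j\<in>{..k} \<union> {k..N}. g (nat \<bar>int j - int k\<bar>))"
    using g by (intro sum_mono2) auto
  also have "\<dots> \<le> (\<Sum>j\<in>{..k}. g (nat \<bar>int j - int k\<bar>)) + (\<Sum>j\<in>{k..N}. g (nat \<bar>int j - int k\<bar>))"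
    using g by (subst sum.union_inter[symmetric]) (auto intro!: sum_nonneg)
  also have "(\<Sum>j\<in>{..k}. g (nat \<bar>int j - int k\<bar>)) = (\<Sum>i\<in>{..k}. g i)"
    by (rule sum.reindex_bij_witness[of _ "\<lambda>i. k - i" "\<lambda>i. k - i"]) (auto simp: nat_diff_distrib)
  also have "(\<Sum>j\<in>{k..N}. g (nat \<bar>int j - int k\<bar>)) = (\<Sum>i\<in>(\<lambda>j. j - k) ` {k..N}. g i)"
    by (subst sum.reindex) (auto simp: inj_on_def nat_diff_distrib intro!: sum.cong)
  also have "(\<Sum>i\<in>{..k}. g i) \<le> suminf g" using g by (intro sum_le_suminf) auto
  also have "(\<Sum>i\<in>(\<lambda>j. j - k) ` {k..N}. g i) \<le> suminf g" using g by (intro sum_le_suminf) auto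
  finally show ?thesis by simp
qed

text \<open>With \<open>i\<close> the distance of \<open>j\<close> from \<open>2 * m\<close>,
  \<open>j \<le> 2 * m * (1 + i)\<close>, so the weight \<open>j\<^sup>2\<close> costs only
  \<open>m\<^sup>2\<close> and a convergent series in \<open>i\<close>. The constant is 4 from
  squaring, 2 from the bound on a single term and 2 from the two sides of
  \<open>2 * m\<close>.\<close>

lemma irred_weight_sum_le:
  fixes m N :: nat and x s :: real
  defines "q \<equiv> real CARD('a::{finite,field})"
  assumes m: "m > 0" and x: "0 < x" and s: "sqrt q \<le> s * x" "x \<le> s * q" "0 \<le> s" "s < 1"
  shows "(\<Sum>j=m+1..N. real j ^ 2 * (irred_weight TYPE('a) m j / q ^ j * x ^ j)) \<le>
     16 * (\<Sum>i. (1 + real i)\<^sup>2 * s ^ i) * (real m ^ 2 * (x ^ (2 * m) / q ^ m))"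
proof -
  define g where "g i = (1 + real i)\<^sup>2 * s ^ i" for i
  define B where "B = x ^ (2 * m) / q ^ m"
  have q: "q > 0" using card_field_ge_2[where 'a = 'a] by (simp add: q_def)
  have B: "B \<ge> 0" using x q by (simp add: B_def)
  have g: "summable g" "g i \<ge> 0" for i
    using summable_square_times_power[OF s(3,4)] s by (auto simp: g_def[abs_def])
  have "(\<Sum>j=m+1..N. real j ^ 2 * (irred_weight TYPE('a) m j / q ^ j * x ^ j)) \<le>
     (\<Sum>j=m+1..N. 8 * real m ^ 2 * B * g (nat \<bar>int j - int (2 * m)\<bar>))"
  proof (rule sum_mono)
    fix j assume j: "j \<in> {m+1..N}"
    let ?i = "nat \<bar>int j - int (2 * m)\<bar>"
    have t: "irred_weight TYPE('a) m j / q ^ j * x ^ j \<le> 2 * B * s ^ ?i"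
      using irred_weight_term_le[of m j x s, where 'a = 'a] j x s by (simp add: q_def B_def)
    have j2: "real j ^ 2 \<le> (2 * real m * (1 + real ?i))\<^sup>2"
    proof (rule power_mono)
      have "j \<le> 2 * m + ?i" by linarith
      also have "\<dots> \<le> 2 * m * (1 + ?i)" using m by simp
      finally have "real j \<le> real (2 * m * (1 + ?i))" by (rule of_nat_mono)
      then show "real j \<le> 2 * real m * (1 + real ?i)"
        by (simp only: of_nat_mult of_nat_add of_nat_1 of_nat_numeral)
    qed simp
    have "real j ^ 2 * (irred_weight TYPE('a) m j / q ^ j * x ^ j) \<le>
        (2 * real m * (1 + real ?i))\<^sup>2 * (2 * B * s ^ ?i)"
      by (rule mult_mono[OF j2 t]) (use q x in auto)
    also have "\<dots> = 8 * real m ^ 2 * B * g ?i"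
      by (simp add: g_def power_mult_distrib)
    finally show "real j ^ 2 * (irred_weight TYPE('a) m j / q ^ j * x ^ j) \<le> 8 * real m ^ 2 * B * g ?i" .
  qed
  also have "\<dots> = 8 * real m ^ 2 * B * (\<Sum>j=m+1..N. g (nat \<bar>int j - int (2 * m)\<bar>))"
    by (simp only: sum_distrib_left)
  also have "\<dots> \<le> 8 * real m ^ 2 * B * (2 * suminf g)"
    using B g by (intro mult_left_mono sum_reflected_le) auto
  finally show ?thesis by (simp add: g_def[abs_def] B_def algebra_simps)
qed

section \<open>The logarithm of \<open>Gq\<close> as a series\<close>

lemma ln_one_minus_power_sums:
  fixes y :: real
  assumes y: "0 \<le> y" "y < 1" and d: "d > 0"
  shows "(\<lambda>j. if d dvd j then real d / real j * y ^ j else 0) sums - ln (1 - y ^ d)"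
proof -
  let ?f = "\<lambda>j. if d dvd j then real d / real j * y ^ j else 0"
  have "y ^ d < 1" using y d by (simp add: power_less_one_iff)
  then have "\<bar>- (y ^ d)\<bar> < 1" using y by simp
  then have "(\<lambda>k. - ((y ^ d) ^ k) / real k) sums ln (1 - y ^ d)"
    using ln_series'[of "- (y ^ d)"] by simp
  then have "(\<lambda>k. - (- ((y ^ d) ^ k) / real k)) sums - ln (1 - y ^ d)"
    by (rule sums_minus)
  \<comment> \<open>At \<open>k = 0\<close> both sides vanish, since division by 0 yields 0.\<close>
  moreover have "(\<lambda>k. - (- ((y ^ d) ^ k) / real k)) = (\<lambda>k. ?f (d * k))"
    using d by (auto simp: power_mult fun_eq_iff)
  ultimately have "(\<lambda>k. ?f (d * k)) sums - ln (1 - y ^ d)" by (simp only:)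
  then show ?thesis
    by (subst (asm) sums_mono_reindex) (use d in \<open>auto simp: strict_mono_def\<close>)
qed

text \<open>The logarithm of the Euler product, with the prime powers collected by degree. The
  exponential factor of \<open>Gq\<close> cancels exactly the indices up to \<open>m\<close>, where
  the weights are 1; the summand at \<open>j = 0\<close> is 0 because of the division by
  \<open>j\<close>.\<close>

lemma Gq_series:
  fixes x :: real and m :: nat
  defines "q \<equiv> real CARD('a::{finite,field})"
  assumes x: "0 \<le> x" "x < q"
  shows "(\<lambda>j. irred_weight TYPE('a) m j / q ^ j * x ^ j / j) sums
     (ln (Gq TYPE('a) m x) + (\<Sum>i=1..m. x ^ i / i))" and "Gq TYPE('a) m x > 0"
proof -
  let ?I = "irreds_le m :: 'a poly set"
  define y where "y = x / q"
  have y: "0 \<le> y" "y < 1" using x by (auto simp: y_def)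
  have d: "degree P > 0" if "P \<in> ?I" for P using that by (simp add: irreds_le_def monic_irreducibleD)
  have pos: "1 - y ^ degree P > 0" if "P \<in> ?I" for P
    using y d[OF that] by (simp add: power_less_one_iff)
  have G: "Gq TYPE('a) m x = (\<Prod>P\<in>?I. inverse (1 - y ^ degree P)) * exp (- (\<Sum>i=1..m. x ^ i / i))"
    by (simp add: Gq_def irreds_le_def y_def q_def)
  have prod: "(\<Prod>P\<in>?I. inverse (1 - y ^ degree P)) > 0"
    using pos by (intro prod_pos) auto
  then show "Gq TYPE('a) m x > 0" by (simp add: G)
  have "ln (Gq TYPE('a) m x) = ln (\<Prod>P\<in>?I. inverse (1 - y ^ degree P)) - (\<Sum>i=1..m. x ^ i / i)"
    unfolding G using prod by (subst ln_mult) auto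
  also have "ln (\<Prod>P\<in>?I. inverse (1 - y ^ degree P)) = (\<Sum>P\<in>?I. - ln (1 - y ^ degree P))"
    using pos less_imp_neq[OF pos] by (subst ln_prod) (auto simp: ln_inverse finite_irreds_le intro!: sum.cong)
  finally have eq: "ln (Gq TYPE('a) m x) + (\<Sum>i=1..m. x ^ i / i) = (\<Sum>P\<in>?I. - ln (1 - y ^ degree P))"
    by simp
  have "(\<lambda>j. \<Sum>P\<in>?I. if degree P dvd j then real (degree P) / real j * y ^ j else 0) sums
     (\<Sum>P\<in>?I. - ln (1 - y ^ degree P))"
    by (intro sums_sum ln_one_minus_power_sums y d)
  moreover have "(\<Sum>P\<in>?I. if degree P dvd j then real (degree P) / real j * y ^ j else 0) =
      irred_weight TYPE('a) m j / q ^ j * x ^ j / j" for j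
  proof -
    have "(\<Sum>P\<in>?I. if degree P dvd j then real (degree P) / real j * y ^ j else 0) =
        (\<Sum>P | P \<in> ?I \<and> degree P dvd j. real (degree P) / real j * y ^ j)"
      by (rule sum.inter_filter[symmetric]) (rule finite_irreds_le)
    also have "\<dots> = irred_weight TYPE('a) m j / real j * y ^ j"
      by (simp add: irred_weight_def sum_distrib_right sum_divide_distrib)
    finally show ?thesis by (simp add: y_def power_divide)
  qed
  ultimately show "(\<lambda>j. irred_weight TYPE('a) m j / q ^ j * x ^ j / j) sums
     (ln (Gq TYPE('a) m x) + (\<Sum>i=1..m. x ^ i / i))"
    unfolding eq by (simp only:)
qed

text \<open>The generating function is used only up to index \<open>n\<close>, whereas
  \<open>Gq\<close> involves all indices. As \<open>n \<ge> 2 * m\<close>, the indices beyond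
  \<open>n\<close> lie on the decaying side of \<open>2 * m\<close>, and the divisor
  \<open>j\<close> gains the factor \<open>1 / n\<close>. The remainder \<open>t\<close> will be
  absorbed in \<open>\<delta>\<close>.\<close>

lemma Gq_truncation:
  fixes x s :: real and m n :: nat
  defines "q \<equiv> real CARD('a::{finite,field})"
  assumes m: "m > 0" "2 * m \<le> n" and x: "0 < x" and s: "sqrt q \<le> s * x" "x \<le> s * q" "0 \<le> s" "s < 1"
  shows "\<exists>t\<ge>0. t \<le> 2 / (1 - s) * (x ^ (2 * m) / q ^ m) / n \<and>
    ln (Gq TYPE('a) m x) = (\<Sum>j=m+1..n. irred_weight TYPE('a) m j / q ^ j * x ^ j / j) + t"
proof -
  define f where "f j = irred_weight TYPE('a) m j / q ^ j * x ^ j / j" for j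
  define B where "B = x ^ (2 * m) / q ^ m"
  have q: "q > 0" using card_field_ge_2[where 'a = 'a] by (simp add: q_def)
  have xq: "x < q"
  proof -
    have "s * q < 1 * q" using s q by (intro mult_strict_right_mono) auto
    then show ?thesis using s by simp
  qed
  have B: "B \<ge> 0" using x q by (simp add: B_def)
  have f0: "f j \<ge> 0" for j using x q by (simp add: f_def)
  have sums: "f sums (ln (Gq TYPE('a) m x) + (\<Sum>i=1..m. x ^ i / i))"
    unfolding f_def q_def by (rule Gq_series(1)) (use x xq in \<open>auto simp: q_def\<close>)
  define t where "t = (\<Sum>j. f (j + Suc n))"
  have "summable f" using sums by (rule sums_summable)
  have "ln (Gq TYPE('a) m x) + (\<Sum>i=1..m. x ^ i / i) = t + (\<Sum>j<Suc n. f j)"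
    using suminf_split_initial_segment[OF \<open>summable f\<close>, of "Suc n"] sums by (simp add: t_def sums_iff)
  moreover have "(\<Sum>j<Suc n. f j) = (\<Sum>i=1..m. x ^ i / i) + (\<Sum>j=m+1..n. f j)"
  proof -
    have "(\<Sum>j<Suc n. f j) = f 0 + (\<Sum>j\<in>{1..m} \<union> {m+1..n}. f j)"
    proof -
      have "{..<Suc n} = insert 0 ({1..m} \<union> {m+1..n})" using m by auto
      then show ?thesis by simp
    qed
    also have "(\<Sum>j\<in>{1..m} \<union> {m+1..n}. f j) = (\<Sum>j=1..m. f j) + (\<Sum>j=m+1..n. f j)"
      by (rule sum.union_disjoint) auto
    also have "(\<Sum>j=1..m. f j) = (\<Sum>i=1..m. x ^ i / i)"
      using q by (intro sum.cong) (auto simp: f_def irred_weight_eq_power q_def)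
    finally show ?thesis by (simp add: f_def)
  qed
  ultimately have "ln (Gq TYPE('a) m x) = (\<Sum>j=m+1..n. f j) + t" by simp
  moreover have "t \<ge> 0" unfolding t_def
    by (rule suminf_nonneg[OF summable_ignore_initial_segment[OF \<open>summable f\<close>] f0])
  moreover have "t \<le> 2 / (1 - s) * B / n"
  proof -
    have n: "real n > 0" using m by simp
    have "f (j + Suc n) \<le> 2 * B / n * s ^ j" for j
    proof -
      define k where "k = j + Suc n"
      have "irred_weight TYPE('a) m k / q ^ k * x ^ k \<le> 2 * B * s ^ nat \<bar>int k - 2 * int m\<bar>"
        using irred_weight_term_le[of m k x s, where 'a = 'a] m x s by (simp add: q_def B_def k_def)
      also have "\<dots> \<le> 2 * B * s ^ j"
        using s m B by (intro mult_left_mono power_decreasing) (auto simp: k_def)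
      finally have "f k \<le> 2 * B * s ^ j / k"
        unfolding f_def by (rule divide_right_mono) simp
      also have "\<dots> \<le> 2 * B * s ^ j / n"
        using n B s by (intro divide_left_mono) (auto simp: k_def)
      finally show ?thesis by (simp add: k_def)
    qed
    then have "t \<le> (\<Sum>j. 2 * B / n * s ^ j)"
      unfolding t_def using s
      by (intro suminf_le[OF _ summable_ignore_initial_segment[OF \<open>summable f\<close>]] summable_mult summable_geometric) auto
    also have "\<dots> = 2 / (1 - s) * B / n"
      using s by (subst suminf_mult) (auto simp: summable_geometric suminf_geometric)
    finally show ?thesis .
  qed
  ultimately show ?thesis unfolding f_def B_def by blast
qed

section \<open>Moving the saddle point\<close>

lemma exp_minus_one_le: "exp u - 1 \<le> u * exp (u :: real)"
proof -
  have "exp u * (1 - u) \<le> exp u * exp (- u)"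
    using exp_ge_add_one_self[of "- u"] by (intro mult_left_mono) auto
  then show ?thesis by (simp add: exp_minus_inverse algebra_simps)
qed

lemma exp_remainder_le:
  fixes u :: real assumes "u \<ge> 0"
  shows "exp u - 1 - u \<le> u\<^sup>2 * exp u"
proof -
  have "exp u - 1 - u \<le> u * (exp u - 1)"
    using exp_minus_one_le[of u] by (simp add: algebra_simps)
  also have "\<dots> \<le> u * (u * exp u)"
    using exp_minus_one_le assms by (rule mult_left_mono)
  finally show ?thesis by (simp add: power2_eq_square)
qed

lemma exp_remainder_ge:
  fixes u :: real assumes "u \<ge> 0"
  shows "u\<^sup>2 / 2 \<le> exp u - 1 - u"
  using exp_lower_Taylor_quadratic[OF assms] by simp

text \<open>
  \<open>x\<close> is the saddle point for the weights truncated at \<open>m\<close>; the full weights \<open>b\<close> move it to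
  \<open>x * exp (- s)\<close>, where \<open>s\<close> is of order \<open>n / (m * q ^ m)\<close>.
\<close>
locale shifted_saddle =
  fixes n m :: nat and b :: "nat \<Rightarrow> real" and x y0 q C :: real
  assumes m: "2 \<le> m" "2 * m \<le> n"
    and b_nonneg: "\<And>j. b j \<ge> 0" and b_1: "\<And>j. 1 \<le> j \<Longrightarrow> j \<le> m \<Longrightarrow> b j = 1"
    and b_double: "1 / q ^ m \<le> b (2 * m)"
    and y0: "1 < y0" "y0 \<le> x" and q: "q > 0"
    and saddle: "(\<Sum>i=1..m. x ^ i) = real n"
    and tail: "(\<Sum>j=m+1..n. real j ^ 2 * (b j * x ^ j)) \<le> C * (real m ^ 2 * (n * (n / q ^ m)))"
    and C: "C \<ge> 0" and small: "C * (n / q ^ m) \<le> (1 - 1 / y0) / 2"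
begin

text \<open>The relative size of the tail \<open>j > m\<close>, up to constants.\<close>

definition "r = real n / q ^ m"
text \<open>The last term \<open>x ^ m\<close> makes up at least the share \<open>1 - 1 / y0\<close>
  of the saddle sum. The divisor 3 pays for \<open>exp (s * m) \<le> 3\<close>, so that
  \<open>z ^ m\<close> at the shifted point still has the share \<open>c\<close>.\<close>

definition "c = (1 - 1 / y0) / 3"

lemma basic: "real n > 0" "real m > 0" "n > 0" "m > 0" "x > 0" "x > 1" "r > 0" "c > 0" "3 * c < 1"
  "C * r \<le> 3 * c / 2"
  using m y0 q small by (auto simp: r_def c_def field_simps)

lemma Cr_le_1: "C * r \<le> 1"
  using basic by linarith

lemma sum_split: "(\<Sum>j=1..n. f j) = (\<Sum>j=1..m. f j) + (\<Sum>j=m+1..n. f j :: real)"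
proof -
  have "{1..n} = {1..m} \<union> {m+1..n}" using m by auto
  then show ?thesis by (simp add: sum.union_disjoint)
qed

text \<open>All indices of the tail exceed \<open>m\<close>, so each factor \<open>j\<close> dropped
  from the second moment gains a factor \<open>1 / m\<close>.\<close>

lemma tail_moments:
  "(\<Sum>j=m+1..n. real j ^ 2 * (b j * x ^ j)) \<le> C * r * n * real m ^ 2"
  "(\<Sum>j=m+1..n. real j * (b j * x ^ j)) \<le> C * r * n * m"
  "(\<Sum>j=m+1..n. b j * x ^ j) \<le> C * r * n"
proof -
  note bs = basic
  show 2: "(\<Sum>j=m+1..n. real j ^ 2 * (b j * x ^ j)) \<le> C * r * n * real m ^ 2"
    using tail by (simp add: r_def mult_ac)
  have "real m * (\<Sum>j=m+1..n. real j * (b j * x ^ j)) \<le> (\<Sum>j=m+1..n. real j ^ 2 * (b j * x ^ j))"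
    unfolding sum_distrib_left
  proof (rule sum_mono)
    fix j assume "j \<in> {m+1..n}"
    then have "real m * real j * (b j * x ^ j) \<le> real j * real j * (b j * x ^ j)"
      using b_nonneg[of j] bs by (intro mult_right_mono) auto
    then show "real m * (real j * (b j * x ^ j)) \<le> real j ^ 2 * (b j * x ^ j)"
      by (simp add: power2_eq_square mult.assoc)
  qed
  also note 2
  finally have "real m * (\<Sum>j=m+1..n. real j * (b j * x ^ j)) \<le> real m * (C * r * n * m)"
    by (simp add: power2_eq_square mult_ac)
  then show 1: "(\<Sum>j=m+1..n. real j * (b j * x ^ j)) \<le> C * r * n * m"
    using bs by simp
  have "real m * (\<Sum>j=m+1..n. b j * x ^ j) \<le> (\<Sum>j=m+1..n. real j * (b j * x ^ j))"
    unfolding sum_distrib_left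
    by (intro sum_mono mult_right_mono) (use b_nonneg bs in auto)
  also note 1
  finally have "real m * (\<Sum>j=m+1..n. b j * x ^ j) \<le> real m * (C * r * n)"
    by (simp add: mult_ac)
  then show "(\<Sum>j=m+1..n. b j * x ^ j) \<le> C * r * n"
    using bs by simp
qed

text \<open>Since \<open>x \<ge> y0\<close>, each \<open>x ^ i\<close> is at most a fixed multiple
  of \<open>x ^ i - x ^ (i - 1)\<close>, and these differences telescope to
  \<open>x ^ m - 1\<close>.\<close>

lemma x_power_bounds: "3 * c * n \<le> x ^ m" "x ^ m \<le> n"
proof -
  have "x ^ m = (\<Sum>i\<in>{m}. x ^ i)" by simp
  also have "\<dots> \<le> (\<Sum>i=1..m. x ^ i)" using basic by (intro sum_mono2) auto
  finally show "x ^ m \<le> n" using saddle by simp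
  have "3 * c * n = (1 - 1 / y0) * (\<Sum>i=1..m. x ^ i)"
    by (simp add: c_def saddle del: One_nat_def)
  also have "\<dots> = (\<Sum>i=1..m. (1 - 1 / y0) * x ^ i)" by (rule sum_distrib_left)
  also have "\<dots> \<le> (\<Sum>i=1..m. x ^ i - x ^ (i - 1))"
  proof (rule sum_mono)
    fix i assume "i \<in> {1..m}"
    then have "x ^ i = x * x ^ (i - 1)" by (cases i) auto
    then have "y0 * x ^ (i - 1) \<le> x ^ i" using y0 basic by (simp add: mult_right_mono)
    then have "x ^ (i - 1) \<le> 1 / y0 * x ^ i" using y0 by (simp add: field_simps)
    then show "(1 - 1 / y0) * x ^ i \<le> x ^ i - x ^ (i - 1)" by (simp add: left_diff_distrib)
  qed
  also have "\<dots> = x ^ m - x ^ 0"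
    using sum_telescope''[of 0 m "\<lambda>i. x ^ i"] by simp
  finally show "3 * c * n \<le> x ^ m" by simp
qed

text \<open>Intermediate value theorem on \<open>{0..1 / m}\<close>. At 0 the sum exceeds
  \<open>n\<close> by the tail. At \<open>1 / m\<close> the term \<open>j = m\<close> has lost at
  least half of \<open>x ^ m\<close>, which outweighs the tail by the smallness assumption.\<close>

lemma exists_shift:
  obtains s :: real where "0 \<le> s" "s * m \<le> 1" "(\<Sum>j=1..n. b j * (x * exp (- s)) ^ j) = real n"
proof -
  note bs = basic
  define f where "f s = (\<Sum>j=1..n. b j * (x * exp (- s)) ^ j)" for s
  have f0: "real n \<le> f 0"
  proof -
    have "real n = (\<Sum>j=1..m. b j * x ^ j)" by (simp add: saddle[symmetric] b_1)
    also have "\<dots> \<le> f 0" unfolding f_def sum_split[of "\<lambda>j. b j * (x * exp (- 0)) ^ j"]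
      using b_nonneg bs by (simp add: sum_nonneg)
    finally show ?thesis .
  qed
  have f1: "f (1 / m) \<le> real n"
  proof -
    have le: "(x * exp (- (1 / m))) ^ j \<le> x ^ j" for j
      using bs by (intro power_mono) (auto simp: mult_le_cancel_left1)
    have em: "exp (- (1 / real m)) ^ m \<le> 1 / 2"
    proof -
      have "exp (- (1 / real m)) ^ m = exp (- 1)" using bs by (simp flip: exp_of_nat_mult)
      moreover have "exp (1::real) \<ge> 2" using exp_ge_add_one_self[of 1] by simp
      ultimately show ?thesis by (simp add: exp_minus field_simps)
    qed
    have "f (1 / m) = (\<Sum>j=1..m. b j * (x * exp (- (1 / m))) ^ j) + (\<Sum>j=m+1..n. b j * (x * exp (- (1 / m))) ^ j)"
      unfolding f_def by (rule sum_split)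
    also have "(\<Sum>j=1..m. b j * (x * exp (- (1 / m))) ^ j) = (\<Sum>j=1..m. (x * exp (- (1 / m))) ^ j)"
      by (simp add: b_1)
    also have "\<dots> = (\<Sum>j\<in>{1..m} - {m}. (x * exp (- (1 / m))) ^ j) + (x * exp (- (1 / m))) ^ m"
      using m by (subst sum.remove[of _ m]) auto
    also have "\<dots> \<le> (\<Sum>j\<in>{1..m} - {m}. x ^ j) + x ^ m / 2"
    proof (intro add_mono sum_mono le)
      have "x ^ m * exp (- (1 / real m)) ^ m \<le> x ^ m * (1 / 2)"
        using em bs by (intro mult_left_mono) auto
      then show "(x * exp (- (1 / m))) ^ m \<le> x ^ m / 2" by (simp add: power_mult_distrib)
    qed
    also have "(\<Sum>j\<in>{1..m} - {m}. x ^ j) = real n - x ^ m"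
      using m unfolding saddle[symmetric] by (subst sum.remove[of _ m]) auto
    also have "(\<Sum>j=m+1..n. b j * (x * exp (- (1 / m))) ^ j) \<le> (\<Sum>j=m+1..n. b j * x ^ j)"
      by (intro sum_mono mult_left_mono le b_nonneg)
    also have "\<dots> \<le> C * r * n" by (rule tail_moments)
    also have "\<dots> \<le> 3 * c / 2 * n" using bs by (intro mult_right_mono) auto
    also have "\<dots> \<le> x ^ m / 2" using x_power_bounds by (simp add: mult_ac)
    finally show ?thesis by simp
  qed
  have "\<exists>s\<ge>0. s \<le> 1 / m \<and> f s = real n"
  proof (rule IVT2')
    show "continuous_on {0..1 / real m} f" unfolding f_def by (intro continuous_intros)
  qed (use f0 f1 bs in auto)
  then obtain s where "0 \<le> s" "s \<le> 1 / m" "f s = real n" by blast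
  then show ?thesis using bs by (intro that[of s]) (auto simp: f_def field_simps)
qed

context
  fixes s z :: real
  assumes s: "0 \<le> s" "s * m \<le> 1" and z_def: "z = x * exp (- s)"
    and z_saddle: "(\<Sum>j=1..n. b j * z ^ j) = real n"
begin

lemma z_basic: "z > 0" "z \<le> x" "x = z * exp s" "x ^ j = z ^ j * exp (j * s)"
  using basic s by (auto simp: z_def mult_le_cancel_left1 power_mult_distrib exp_of_nat_mult mult.assoc
      simp flip: exp_add power_mult_distrib)

lemma z_power_le: "z ^ j \<le> x ^ j"
  using z_basic by (intro power_mono) auto

lemma z_power_lower: "c * n \<le> z ^ m"
proof -
  have "exp (m * s) \<le> 3" using s exp_le by (simp add: mult.commute) (meson exp_le_cancel_iff order_trans)
  then have "x ^ m \<le> z ^ m * 3" unfolding z_basic(4)[of m] using z_basic by (intro mult_left_mono) auto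
  then show ?thesis using x_power_bounds by simp
qed

text \<open>What the head loses by the shift is the mass of the tail at the new point; both bounds
  on \<open>s\<close> compare these two quantities.\<close>

lemma balance: "(\<Sum>j=1..m. x ^ j - z ^ j) = (\<Sum>j=m+1..n. b j * z ^ j)"
proof -
  have "(\<Sum>j=1..m. z ^ j) + (\<Sum>j=m+1..n. b j * z ^ j) = real n"
    using z_saddle unfolding sum_split[of "\<lambda>j. b j * z ^ j"] by (simp add: b_1)
  then show ?thesis using saddle by (simp add: sum_subtractf)
qed

text \<open>The loss at \<open>j = m\<close> alone is at least \<open>s * m * z ^ m\<close>, while
  the tail is at most \<open>C * r * n\<close>.\<close>

lemma shift_upper: "s * m \<le> C / c * r"
proof -
  note bs = basic
  have "s * m * (c * n) \<le> s * m * z ^ m" using s z_power_lower by (intro mult_left_mono) auto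
  also have "\<dots> \<le> x ^ m - z ^ m"
  proof -
    have "z ^ m * (1 + m * s) \<le> x ^ m"
      unfolding z_basic(4)[of m] using z_basic exp_ge_add_one_self by (intro mult_left_mono) auto
    then show ?thesis by (simp add: algebra_simps)
  qed
  also have "\<dots> = (\<Sum>j\<in>{m}. x ^ j - z ^ j)" by simp
  also have "\<dots> \<le> (\<Sum>j=1..m. x ^ j - z ^ j)"
    using m z_power_le by (intro sum_mono2) auto
  also have "\<dots> \<le> (\<Sum>j=m+1..n. b j * x ^ j)"
    unfolding balance using z_power_le b_nonneg by (intro sum_mono mult_left_mono)
  also have "\<dots> \<le> C * r * n" by (rule tail_moments)
  finally have "(s * m * c) * n \<le> (C * r) * n" by (simp add: mult_ac)
  then have "s * m * c \<le> C * r" using bs by simp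
  then show ?thesis using bs by (simp add: field_simps)
qed

text \<open>The tail contains \<open>j = 2 * m\<close>, whose term is at least
  \<open>(z ^ m)\<^sup>2 / q ^ m\<close>, while the head loses at most the fraction
  \<open>s * m\<close> of its total \<open>n\<close>.\<close>

lemma shift_lower: "c\<^sup>2 * r \<le> s * m"
proof -
  note bs = basic
  have "c\<^sup>2 * r * n = (c * n)\<^sup>2 * (1 / q ^ m)" by (simp add: r_def power2_eq_square)
  also have "\<dots> \<le> (z ^ m)\<^sup>2 * b (2 * m)"
    using z_power_lower b_double bs q by (intro mult_mono power_mono) auto
  also have "\<dots> = (\<Sum>j\<in>{2 * m}. b j * z ^ j)" by (simp add: power_mult[symmetric] mult.commute)
  also have "\<dots> \<le> (\<Sum>j=m+1..n. b j * z ^ j)"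
    using m b_nonneg z_basic by (intro sum_mono2) auto
  also have "\<dots> = (\<Sum>j=1..m. x ^ j - z ^ j)" by (rule balance[symmetric])
  also have "\<dots> \<le> (\<Sum>j=1..m. s * m * x ^ j)"
  proof (rule sum_mono)
    fix j assume j: "j \<in> {1..m}"
    have "x ^ j - z ^ j = z ^ j * (exp (j * s) - 1)" by (simp add: z_basic(4)[of j] right_diff_distrib)
    also have "\<dots> \<le> z ^ j * (j * s * exp (j * s))"
      using exp_minus_one_le z_basic by (intro mult_left_mono) auto
    also have "\<dots> = j * s * x ^ j" by (simp add: z_basic(4)[of j])
    also have "\<dots> \<le> s * m * x ^ j" using j s bs by (simp add: mult.commute mult_left_mono)
    finally show "x ^ j - z ^ j \<le> s * m * x ^ j" .
  qed
  also have "\<dots> = s * m * n" by (simp add: saddle del: One_nat_def flip: sum_distrib_left)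
  finally show ?thesis using bs by simp
qed

definition "E = (\<Sum>j=1..n. b j * z ^ j / j * (exp (j * s) - 1 - j * s))"

text \<open>\<open>E\<close> is the Taylor remainder of second order in \<open>s\<close>. The saddle
  equation at \<open>z\<close> makes the linear term \<open>n * s\<close>, which will cancel against
  the quotient of \<open>x ^ n\<close> and \<open>z ^ n\<close>.\<close>

lemma E_eq: "(\<Sum>j=1..n. b j * z ^ j / j) = (\<Sum>j=1..n. b j * x ^ j / j) - n * s - E"
proof -
  have "E = (\<Sum>j=1..n. b j * x ^ j / j - b j * z ^ j / j - b j * z ^ j * s)"
    unfolding E_def by (intro sum.cong refl) (auto simp: z_basic(4) field_simps)
  also have "\<dots> = (\<Sum>j=1..n. b j * x ^ j / j) - (\<Sum>j=1..n. b j * z ^ j / j) - n * s"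
    by (simp add: sum_subtractf z_saddle del: One_nat_def flip: sum_distrib_right)
  finally show ?thesis by simp
qed

text \<open>All terms are nonnegative and \<open>j = m\<close> suffices: four factors
  \<open>c\<close> come from squaring the lower bound on \<open>s * m\<close>, the fifth from that
  on \<open>z ^ m\<close>.\<close>

lemma E_lower: "c ^ 5 / 2 * (n / m * r\<^sup>2) \<le> E"
proof -
  note bs = basic
  have "c ^ 5 / 2 * (n / m * r\<^sup>2) = (c\<^sup>2 * r)\<^sup>2 * (c * n) / (2 * m)"
    by (simp add: power2_eq_square power_numeral_reduce)
  also have "\<dots> \<le> (s * m)\<^sup>2 * z ^ m / (2 * m)"
    by (intro divide_right_mono mult_mono[OF power_mono[OF shift_lower] z_power_lower])
      (use bs in auto)
  also have "\<dots> = b m * z ^ m / m * ((m * s)\<^sup>2 / 2)"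
    using bs m by (simp add: b_1 power2_eq_square)
  also have "\<dots> \<le> b m * z ^ m / m * (exp (m * s) - 1 - m * s)"
    using bs s z_basic b_nonneg by (intro mult_left_mono exp_remainder_ge) auto
  also have "\<dots> = (\<Sum>j\<in>{m}. b j * z ^ j / j * (exp (j * s) - 1 - j * s))" by simp
  also have "\<dots> \<le> E" unfolding E_def
  proof (intro sum_mono2)
    fix j :: nat
    have "exp (j * s) - 1 - j * s \<ge> (j * s)\<^sup>2 / 2" using s by (intro exp_remainder_ge) simp
    then have "exp (j * s) - 1 - j * s \<ge> 0" by (rule order_trans[rotated]) simp
    then show "0 \<le> b j * z ^ j / j * (exp (j * s) - 1 - j * s)"
      using b_nonneg z_basic by simp
  qed (use m in auto)
  finally show ?thesis .
qed

lemma second_moment_x: "(\<Sum>j=1..n. real j * (b j * x ^ j)) \<le> 2 * n * m"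
proof -
  note bs = basic
  have "(\<Sum>j=1..m. real j * (b j * x ^ j)) \<le> (\<Sum>j=1..m. real m * x ^ j)"
    using bs by (intro sum_mono) (auto simp: b_1)
  also have "\<dots> = m * n" by (simp add: saddle del: One_nat_def flip: sum_distrib_left)
  finally have "(\<Sum>j=1..m. real j * (b j * x ^ j)) \<le> m * n" .
  moreover have "(\<Sum>j=m+1..n. real j * (b j * x ^ j)) \<le> 1 * real n * real m"
    by (rule order_trans[OF tail_moments(2)]) (intro mult_right_mono Cr_le_1; simp)
  ultimately show ?thesis unfolding sum_split[of "\<lambda>j. real j * (b j * x ^ j)"] by (simp add: mult.commute)
qed

text \<open>The factor \<open>exp (j * s)\<close> in the remainder bound turns \<open>z ^ j\<close>
  back into \<open>x ^ j\<close>, and the square of \<open>j * s\<close> against the divisor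
  \<open>j\<close> leaves \<open>s\<^sup>2\<close> times the variance at \<open>x\<close>.\<close>

lemma E_upper: "E \<le> 2 * (C / c)\<^sup>2 * (n / m * r\<^sup>2)"
proof -
  note bs = basic
  have "E \<le> (\<Sum>j=1..n. s\<^sup>2 * (real j * (b j * x ^ j)))"
    unfolding E_def
  proof (rule sum_mono)
    fix j assume "j \<in> {1..n}"
    have "b j * z ^ j / j * (exp (j * s) - 1 - j * s) \<le> b j * z ^ j / j * ((j * s)\<^sup>2 * exp (j * s))"
      using s b_nonneg z_basic by (intro mult_left_mono exp_remainder_le) auto
    also have "\<dots> = s\<^sup>2 * (real j * (b j * x ^ j))"
      using \<open>j \<in> {1..n}\<close> by (simp add: z_basic(4)[of j] power2_eq_square)
    finally show "b j * z ^ j / j * (exp (j * s) - 1 - j * s) \<le> s\<^sup>2 * (real j * (b j * x ^ j))" .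
  qed
  also have "\<dots> = s\<^sup>2 * (\<Sum>j=1..n. real j * (b j * x ^ j))" by (rule sum_distrib_left[symmetric])
  also have "\<dots> \<le> s\<^sup>2 * (2 * n * m)" using second_moment_x by (intro mult_left_mono) auto
  also have "\<dots> = 2 * (n / m) * (s * m)\<^sup>2" using bs by (simp add: power2_eq_square)
  also have "\<dots> \<le> 2 * (n / m) * (C / c * r)\<^sup>2"
    using shift_upper s bs by (intro mult_left_mono power_mono) auto
  finally show ?thesis unfolding power_mult_distrib by (simp only: mult_ac)
qed

lemma third_moment_z: "(\<Sum>j=1..n. real j ^ 2 * (b j * z ^ j)) \<le> 2 * n * (real m)\<^sup>2"
proof -
  note bs = basic
  have "(\<Sum>j=1..m. real j ^ 2 * (b j * x ^ j)) \<le> (\<Sum>j=1..m. real m ^ 2 * x ^ j)"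
    using bs by (intro sum_mono) (auto simp: b_1)
  also have "\<dots> = (real m)\<^sup>2 * n" by (simp add: saddle del: One_nat_def flip: sum_distrib_left)
  finally have "(\<Sum>j=1..m. real j ^ 2 * (b j * x ^ j)) \<le> (real m)\<^sup>2 * n" .
  moreover have "(\<Sum>j=m+1..n. real j ^ 2 * (b j * x ^ j)) \<le> 1 * real n * (real m)\<^sup>2"
    by (rule order_trans[OF tail_moments(1)]) (intro mult_right_mono Cr_le_1; simp)
  ultimately have "(\<Sum>j=1..n. real j ^ 2 * (b j * x ^ j)) \<le> 2 * n * (real m)\<^sup>2"
    unfolding sum_split[of "\<lambda>j. real j ^ 2 * (b j * x ^ j)"] by (simp add: mult.commute)
  moreover have "(\<Sum>j=1..n. real j ^ 2 * (b j * z ^ j)) \<le> (\<Sum>j=1..n. real j ^ 2 * (b j * x ^ j))"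
    by (intro sum_mono mult_left_mono z_power_le b_nonneg) auto
  ultimately show ?thesis by linarith
qed

text \<open>From above the tail is added to the head at \<open>x\<close>; from below the head at
  \<open>z\<close> retains the fraction \<open>1 - s * m\<close>. Both deviations are at most a
  multiple of \<open>r\<close>.\<close>

lemma variance_ratio:
  defines "V \<equiv> \<Sum>j=1..m. real j * x ^ j"
  shows "V > 0" "\<bar>(\<Sum>j=1..n. real j * (b j * z ^ j)) / V - 1\<bar> \<le> C / c * r"
proof -
  note bs = basic
  define Vz where "Vz = (\<Sum>j=1..n. real j * (b j * z ^ j))"
  have Vlow: "c * n * m \<le> V"
  proof -
    have "c * n * m \<le> x ^ m * m" using z_power_lower z_power_le[of m] bs by (intro mult_right_mono) auto
    also have "\<dots> = (\<Sum>j\<in>{m}. real j * x ^ j)" by simp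
    also have "\<dots> \<le> V" unfolding V_def using bs m by (intro sum_mono2) auto
    finally show ?thesis .
  qed
  moreover have "c * n * m > 0" using bs by simp
  ultimately show V: "V > 0" by linarith
  have "Vz \<le> (\<Sum>j=1..n. real j * (b j * x ^ j))"
    unfolding Vz_def by (intro sum_mono mult_left_mono z_power_le b_nonneg) auto
  also have "\<dots> \<le> V + C * r * n * m"
    unfolding sum_split[of "\<lambda>j. real j * (b j * x ^ j)"] V_def using tail_moments(2) by (simp add: b_1)
  also have "C * r * n * m = C / c * r * (c * n * m)" using bs by simp
  also have "\<dots> \<le> C / c * r * V" using Vlow C bs by (intro mult_left_mono) auto
  finally have up: "Vz \<le> V + C / c * r * V" by simp
  have "(1 - s * m) * V \<le> (\<Sum>j=1..m. real j * (b j * z ^ j))"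
    unfolding V_def sum_distrib_left
  proof (rule sum_mono)
    fix j assume j: "j \<in> {1..m}"
    have "x ^ j * (1 - s * m) \<le> x ^ j * exp (- (j * s))"
    proof (rule mult_left_mono)
      have "1 - s * m \<le> 1 + - (j * s)" using j s by (simp add: mult.commute mult_left_mono)
      also have "\<dots> \<le> exp (- (j * s))" by (rule exp_ge_add_one_self)
      finally show "1 - s * m \<le> exp (- (j * s))" .
    qed (use bs in simp)
    also have "\<dots> = z ^ j" unfolding z_basic(4)[of j] by (simp add: exp_minus_inverse mult.assoc)
    finally show "(1 - s * m) * (real j * x ^ j) \<le> real j * (b j * z ^ j)"
      using j by (simp add: b_1 mult_left_mono mult_ac)
  qed
  also have "\<dots> \<le> Vz"
    unfolding Vz_def sum_split[of "\<lambda>j. real j * (b j * z ^ j)"]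
    using b_nonneg z_basic by (simp add: sum_nonneg)
  finally have "(1 - C / c * r) * V \<le> Vz"
    using mult_right_mono[OF shift_upper, of V] V by (simp add: algebra_simps)
  then have lo: "V - C / c * r * V \<le> Vz" by (simp add: left_diff_distrib)
  have "Vz / V - 1 = (Vz - V) / V" using V by (simp add: field_simps)
  moreover have "\<bar>Vz - V\<bar> \<le> C / c * r * V" using lo up by linarith
  ultimately show "\<bar>(\<Sum>j=1..n. real j * (b j * z ^ j)) / V - 1\<bar> \<le> C / c * r"
    using V unfolding Vz_def[symmetric] by (simp add: abs_divide pos_divide_le_eq)
qed

end

end

section \<open>The quotient of the probabilities\<close>

lemma saddle_props:
  assumes "0 < n" "0 < m"
  shows "saddle n m > 0" "(\<Sum>i=1..m. saddle n m ^ i) = real n" "saddle n m ^ m \<le> n"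
proof -
  show 1: "saddle n m > 0" "(\<Sum>i=1..m. saddle n m ^ i) = real n"
    using theI'[OF saddle_ex1[OF assms]] by (simp_all add: saddle_def)
  have "saddle n m ^ m = (\<Sum>i\<in>{m}. saddle n m ^ i)" by simp
  also have "\<dots> \<le> (\<Sum>i=1..m. saddle n m ^ i)" using assms 1 by (intro sum_mono2) auto
  finally show "saddle n m ^ m \<le> n" using 1 by simp
qed

text \<open>\<open>A\<close> and \<open>A0\<close> are the two local probabilities divided by their
  Gaussian predictions, \<open>W\<close> is the quotient of the variances and \<open>t\<close> the
  part of \<open>ln Gq\<close> beyond \<open>n\<close>. Nothing is claimed to be small here:
  \<open>n\<close> and \<open>m\<close> are fixed and all bounds are explicit. The condition
  \<open>A0 \<noteq> 0\<close> will hold as soon as \<open>err < 1\<close>.\<close>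

lemma smooth_ratio_expansion:
  fixes n m :: nat and y0 y1 s0 :: real
  defines "q \<equiv> real CARD('a::{finite,field})"
  defines "C \<equiv> 16 * (\<Sum>i. (1 + real i)\<^sup>2 * s0 ^ i)" and "c \<equiv> (1 - 1 / y0) / 3"
  defines "x \<equiv> saddle n m"
  assumes m: "2 \<le> m" "2 * m \<le> n" and y0: "1 < y0" "y0 \<le> x" "x \<le> y1"
    and s0: "sqrt q \<le> s0 * x" "x \<le> s0 * q" "0 \<le> s0" "s0 < 1"
    and small: "C * (n / q ^ m) \<le> (1 - 1 / y0) / 2"
  defines "err \<equiv> 258 * 2 / (c * sqrt c) * sqrt (m / n)
      + sqrt (2 * pi * 2) * (sqrt n * m * exp (- (c ^ 3 / (6 * y1 * 2\<^sup>2) * (n / real m ^ 3))))"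
    and "B \<equiv> real n ^ 3 / (real m * q ^ (2 * m))"
  shows "\<exists>A A0 W t E. \<bar>A - 1\<bar> \<le> err \<and> \<bar>A0 - 1\<bar> \<le> err \<and> \<bar>W - 1\<bar> \<le> C / c * (n / q ^ m) \<and>
    0 \<le> t \<and> t \<le> 2 / (1 - s0) * (n / q ^ m) \<and> c ^ 5 / 2 * B \<le> E \<and> E \<le> 2 * (C / c)\<^sup>2 * B \<and>
    (A0 \<noteq> 0 \<longrightarrow> smooth_poly_prob TYPE('a) n m / smooth_perm_prob n m =
      A / A0 * sqrt (1 / W) * exp (- t) * Gq TYPE('a) m x * exp (- E))"
proof -
  define b where "b j = irred_weight TYPE('a) m j / q ^ j" for j
  define b0 where "b0 j = (if j \<le> m then 1 else 0 :: real)" for j :: nat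
  define h where "h = smooth_poly_freq TYPE('a) m"
  define h0 where "h0 = smooth_perm_freq m"
  have q: "q > 0" using card_field_ge_2[where 'a = 'a] by (simp add: q_def)
  have nm: "n > 0" "m > 0" "real n > 0" "real m > 0" using m by auto
  note x = saddle_props[OF nm(1,2), folded x_def]
  have xq: "x < q"
  proof -
    have "s0 * q < 1 * q" using s0 q by (intro mult_strict_right_mono) auto
    then show ?thesis using s0 by simp
  qed
  have x2m: "x ^ (2 * m) \<le> n * n"
    using mult_mono[OF x(3) x(3)] x(1) by (simp add: mult_2 power_add)
  have C0: "C \<ge> 0"
    unfolding C_def using summable_square_times_power[OF s0(3,4)] s0
    by (intro mult_nonneg_nonneg suminf_nonneg) auto
  interpret sh: shifted_saddle n m b x y0 q C
  proof
    show "1 / q ^ m \<le> b (2 * m)"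
    proof -
      have "q ^ m \<le> real (irred_weight TYPE('a) m (2 * m))"
        using irred_weight_double_ge[OF nm(2), where 'a = 'a] unfolding q_def
        by (metis of_nat_mono of_nat_power)
      then have "q ^ m / q ^ (2 * m) \<le> b (2 * m)"
        unfolding b_def using q by (intro divide_right_mono) auto
      moreover have "q ^ m / q ^ (2 * m) = 1 / q ^ m" using q by (simp add: mult_2 power_add)
      ultimately show ?thesis by simp
    qed
    have "(\<Sum>j=m+1..n. real j ^ 2 * (b j * x ^ j)) \<le> C * (real m ^ 2 * (x ^ (2 * m) / q ^ m))"
      unfolding C_def b_def q_def
      by (rule irred_weight_sum_le) (use nm x s0 in \<open>auto simp: q_def\<close>)
    also have "\<dots> \<le> C * (real m ^ 2 * (n * n / q ^ m))"
      using C0 x2m q by (intro mult_left_mono divide_right_mono) auto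
    finally show "(\<Sum>j=m+1..n. real j ^ 2 * (b j * x ^ j)) \<le> C * (real m ^ 2 * (n * (n / q ^ m)))"
      by simp
    show "b j = 1" if "1 \<le> j" "j \<le> m" for j
      using that q irred_weight_eq_power[of j m, where 'a = 'a] by (simp add: b_def q_def)
    show "0 \<le> b j" for j by (simp add: b_def q_def)
    show "2 \<le> m" "2 * m \<le> n" by (rule m)+
    show "1 < y0" "y0 \<le> x" by (rule y0)+
    show "q > 0" by (rule q)
    show "(\<Sum>i=1..m. x ^ i) = real n" by (rule x(2))
    show "C \<ge> 0" by (rule C0)
    show "C * (n / q ^ m) \<le> (1 - 1 / y0) / 2" by (rule small)
  qed
  have c: "sh.c = c" "sh.r = n / q ^ m"
    by (simp_all add: sh.c_def sh.r_def c_def)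
  have c0: "c > 0" using sh.basic(8) c by simp
  obtain s :: real where s: "0 \<le> s" "s * m \<le> 1" and zs: "(\<Sum>j=1..n. b j * (x * exp (- s)) ^ j) = real n"
    by (rule sh.exists_shift)
  define z where "z = x * exp (- s)"
  note Z = s z_def zs[folded z_def]
  note zb = sh.z_basic[OF Z]
  define E where "E = sh.E s z"
  define V where "V = (\<Sum>j=1..n. real j * (b0 j * x ^ j))"
  define Vz where "Vz = (\<Sum>j=1..n. real j * (b j * z ^ j))"
  have Vm: "V = (\<Sum>j=1..m. real j * x ^ j)"
    unfolding V_def sh.sum_split[of "\<lambda>j. real j * (b0 j * x ^ j)"] by (simp add: b0_def)
  define \<Lambda>0 where "\<Lambda>0 = (\<Sum>j=1..n. b0 j * x ^ j / j)"
  define \<Lambda>z where "\<Lambda>z = (\<Sum>j=1..n. b j * z ^ j / j)"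
  define A0 where "A0 = sqrt (2 * pi * V) * (h0 n * x ^ n * exp (- \<Lambda>0))"
  define A where "A = sqrt (2 * pi * Vz) * (h n * z ^ n * exp (- \<Lambda>z))"
  have y1: "1 \<le> y1" using y0 by simp
  have hrec: "real i * h i = (\<Sum>j=1..i. b j * h (i - j))" for i
    using smooth_poly_freq_rec[of i m, where 'a = 'a] by (simp add: h_def b_def q_def)
  have h0rec: "real i * h0 i = (\<Sum>j=1..i. b0 j * h0 (i - j))" for i
  proof (cases "i = 0")
    case False
    have "(\<Sum>j=1..i. b0 j * h0 (i - j)) = (\<Sum>j=1..min m i. b0 j * h0 (i - j))"
      by (rule sum.mono_neutral_right) (auto simp: b0_def)
    also have "\<dots> = (\<Sum>j=1..min m i. h0 (i - j))" by (intro sum.cong) (auto simp: b0_def)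
    finally show ?thesis using False smooth_perm_freq_rec[of i m] by (simp add: h0_def)
  qed simp
  have mn: "m \<le> n" using m by simp
  have A: "Vz > 0" "\<bar>A - 1\<bar> \<le> err"
  proof -
    have h0: "h 0 = 1" by (simp add: h_def smooth_poly_freq_0)
    have bm: "b m = 1" "b (m - 1) = 1" using m by (auto intro: sh.b_1)
    have zy: "z \<le> y1" using zb(2) y0(3) by simp
    have cz: "c * n \<le> z ^ m" using sh.z_power_lower[OF Z] c by simp
    have Tz: "(\<Sum>j=1..n. real j ^ 2 * (b j * z ^ j)) \<le> 2 * real n * (real m)\<^sup>2"
      using sh.third_moment_z[OF Z] by simp
    show "Vz > 0" unfolding Vz_def
      by (rule local_limit_bound(1)[where h = h and b = b and K = 2,
            OF h0 hrec sh.b_nonneg m(1) mn bm zb(1) zy y1 c0 cz Z(4) Tz])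
    show "\<bar>A - 1\<bar> \<le> err" unfolding A_def Vz_def \<Lambda>z_def err_def
      by (rule local_limit_bound(2)[where h = h and b = b and K = 2,
            OF h0 hrec sh.b_nonneg m(1) mn bm zb(1) zy y1 c0 cz Z(4) Tz])
  qed
  have A0: "V > 0" "\<bar>A0 - 1\<bar> \<le> err"
  proof -
    have h00: "h0 0 = 1" by (simp add: h0_def)
    have b0: "b0 j \<ge> 0" for j by (simp add: b0_def)
    have b0m: "b0 m = 1" "b0 (m - 1) = 1" by (auto simp: b0_def)
    have mean0: "(\<Sum>j=1..n. b0 j * x ^ j) = real n"
      unfolding sh.sum_split[of "\<lambda>j. b0 j * x ^ j"] by (simp add: b0_def x(2) del: One_nat_def)
    have cx: "c * n \<le> x ^ m" using sh.z_power_lower[OF Z] sh.z_power_le[OF Z, of m] c by simp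
    have T0: "(\<Sum>j=1..n. real j ^ 2 * (b0 j * x ^ j)) \<le> 2 * real n * (real m)\<^sup>2"
    proof -
      have "(\<Sum>j=1..n. real j ^ 2 * (b0 j * x ^ j)) \<le> (\<Sum>j=1..n. real m ^ 2 * (b0 j * x ^ j))"
        using x by (intro sum_mono) (auto simp: b0_def)
      also have "\<dots> = real m ^ 2 * n" unfolding mean0[symmetric] by (rule sum_distrib_left[symmetric])
      \<comment> \<open>The factor 2 is given away so that both local limit bounds share the same
        \<open>err\<close>.\<close>
      also have "\<dots> \<le> 2 * real n * (real m)\<^sup>2" using nm by simp
      finally show ?thesis .
    qed
    show "V > 0" unfolding V_def
      by (rule local_limit_bound(1)[where h = h0 and b = b0 and K = 2,
            OF h00 h0rec b0 m(1) mn b0m x(1) y0(3) y1 c0 cx mean0 T0])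
    show "\<bar>A0 - 1\<bar> \<le> err" unfolding A0_def V_def \<Lambda>0_def err_def
      by (rule local_limit_bound(2)[where h = h0 and b = b0 and K = 2,
            OF h00 h0rec b0 m(1) mn b0m x(1) y0(3) y1 c0 cx mean0 T0])
  qed
  obtain t where t: "t \<ge> 0" "t \<le> 2 / (1 - s0) * (x ^ (2 * m) / q ^ m) / n"
      and lnG: "ln (Gq TYPE('a) m x) = (\<Sum>j=m+1..n. b j * x ^ j / j) + t"
    using Gq_truncation[of m n x s0, where 'a = 'a] nm m x s0 unfolding b_def q_def by blast
  have G: "Gq TYPE('a) m x > 0"
    by (rule Gq_series(2)) (use x xq in \<open>auto simp: q_def\<close>)
  have t': "t \<le> 2 / (1 - s0) * (n / q ^ m)"
  proof -
    have "2 / (1 - s0) * (x ^ (2 * m) / q ^ m) / n \<le> 2 / (1 - s0) * (n * n / q ^ m) / n"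
      using x2m s0 q by (intro divide_right_mono mult_left_mono) auto
    then show ?thesis using t nm by simp
  qed
  have \<Lambda>: "\<Lambda>z - \<Lambda>0 = ln (Gq TYPE('a) m x) - t - n * s - E"
  proof -
    have "\<Lambda>z = (\<Sum>j=1..n. b j * x ^ j / j) - n * s - E"
      unfolding \<Lambda>z_def E_def by (rule sh.E_eq[OF Z])
    also have "(\<Sum>j=1..n. b j * x ^ j / j) = \<Lambda>0 + (\<Sum>j=m+1..n. b j * x ^ j / j)"
      unfolding \<Lambda>0_def sh.sum_split[of "\<lambda>j. b j * x ^ j / j"] sh.sum_split[of "\<lambda>j. b0 j * x ^ j / j"]
      by (simp add: b0_def sh.b_1)
    finally show ?thesis using lnG by simp
  qed
  have ratio: "h n / h0 n = A / A0 * sqrt (1 / (Vz / V)) * exp (- t) * Gq TYPE('a) m x * exp (- E)"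
    if "A0 \<noteq> 0"
  proof -
    \<comment> \<open>This factor cancels the linear term \<open>n * s\<close> in the difference of
      the exponents.\<close>
    have "x ^ n = z ^ n * exp (n * s)" by (rule zb(4))
    then have "A / A0 = sqrt (2 * pi * Vz) / sqrt (2 * pi * V) * (h n / h0 n) * exp (- (n * s) - (\<Lambda>z - \<Lambda>0))"
      unfolding A_def A0_def using zb(1) by (simp add: exp_diff exp_minus divide_simps)
    also have "sqrt (2 * pi * Vz) / sqrt (2 * pi * V) = sqrt Vz / sqrt V"
      by (simp add: real_sqrt_mult)
    also have "exp (- (n * s) - (\<Lambda>z - \<Lambda>0)) = exp t * exp E / Gq TYPE('a) m x"
      unfolding \<Lambda> using G by (simp add: exp_diff exp_add)
    finally have AA: "A / A0 = sqrt Vz / sqrt V * (h n / h0 n) * (exp t * exp E / Gq TYPE('a) m x)" .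
    have "X = a * (v / u) * (1 / p) * g * (1 / e)"
      if "a = u / v * X * (p * e / g)" "u \<noteq> 0" "v \<noteq> 0" "p \<noteq> 0" "e \<noteq> 0" "g \<noteq> 0" for X a u v p g e :: real
      using that by simp
    from this[OF AA] show ?thesis
      using A(1) A0(1) G by (simp add: real_sqrt_divide exp_minus inverse_eq_divide)
  qed
  have B: "n / m * (n / q ^ m)\<^sup>2 = B"
    by (simp add: B_def power2_eq_square power3_eq_cube mult_2 power_add)
  show ?thesis
  proof (intro exI conjI impI)
    show "\<bar>A - 1\<bar> \<le> err" "\<bar>A0 - 1\<bar> \<le> err" using A A0 by auto
    show "\<bar>Vz / V - 1\<bar> \<le> C / c * (n / q ^ m)"
      using sh.variance_ratio(2)[OF Z] unfolding Vz_def Vm c by simp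
    show "0 \<le> t" "t \<le> 2 / (1 - s0) * (n / q ^ m)" using t t' by auto
    show "c ^ 5 / 2 * B \<le> E" "E \<le> 2 * (C / c)\<^sup>2 * B"
      using sh.E_lower[OF Z] sh.E_upper[OF Z] unfolding c B E_def by auto
    show "smooth_poly_prob TYPE('a) n m / smooth_perm_prob n m =
      A / A0 * sqrt (1 / (Vz / V)) * exp (- t) * Gq TYPE('a) m x * exp (- E)" if "A0 \<noteq> 0"
      using ratio[OF that] by (simp add: smooth_poly_prob_eq smooth_perm_prob_eq h_def h0_def)
  qed
qed



text \<open>Passes from a threshold in \<open>n\<close> for each \<open>e\<close> to a single null
  sequence. \<open>\<eta> n\<close> is the largest, over the finitely many admissible
  \<open>m\<close>, of the infima of the possible \<open>\<bar>d\<bar>\<close>; the summand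
  \<open>1 / (n + 1)\<close> is there because an infimum need not be attained. Mere existence of
  \<open>d\<close> takes care of the small \<open>n\<close>.\<close>

lemma uniform_error_function:
  fixes P :: "nat \<Rightarrow> nat \<Rightarrow> real \<Rightarrow> bool"
  assumes fin: "\<And>n. finite {m. R n m}" and ex: "\<And>n m. R n m \<Longrightarrow> \<exists>d. P n m d"
    and ev: "\<And>e. e > 0 \<Longrightarrow> \<forall>\<^sub>F n in sequentially. \<forall>m. R n m \<longrightarrow> (\<exists>d. \<bar>d\<bar> \<le> e \<and> P n m d)"
  shows "\<exists>\<eta>::nat \<Rightarrow> real. \<eta> \<longlonglongrightarrow> 0 \<and> (\<forall>n m. R n m \<longrightarrow> (\<exists>d. \<bar>d\<bar> \<le> \<eta> n \<and> P n m d))"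
proof -
  define D where "D n m = {\<bar>d\<bar> | d. P n m d}" for n m
  have bdd: "bdd_below (D n m)" for n m by (rule bdd_belowI[of _ 0]) (auto simp: D_def)
  define \<eta> where "\<eta> n = Max (insert 0 ((\<lambda>m. Inf (D n m)) ` {m. R n m})) + 1 / real (Suc n)" for n
  have "\<eta> \<longlonglongrightarrow> 0"
  proof (rule LIMSEQ_I)
    fix e :: real assume e: "e > 0"
    have "\<forall>\<^sub>F n in sequentially. 1 / real (Suc n) < e / 2"
      using order_tendstoD(2)[OF LIMSEQ_inverse_real_of_nat, of "e / 2"] e by (simp add: inverse_eq_divide)
    moreover have "\<forall>\<^sub>F n in sequentially. \<forall>m. R n m \<longrightarrow> (\<exists>d. \<bar>d\<bar> \<le> e / 2 \<and> P n m d)"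
      using e by (intro ev) simp
    ultimately have "\<forall>\<^sub>F n in sequentially. norm (\<eta> n - 0) < e"
    proof eventually_elim
      case (elim n)
      have "Inf (D n m) \<le> e / 2" if r: "R n m" for m
      proof -
        obtain d where "\<bar>d\<bar> \<le> e / 2" "P n m d" using elim r by blast
        moreover from this have "Inf (D n m) \<le> \<bar>d\<bar>" by (intro cInf_lower bdd) (auto simp: D_def)
        ultimately show ?thesis by linarith
      qed
      then have "Max (insert 0 ((\<lambda>m. Inf (D n m)) ` {m. R n m})) \<le> e / 2"
        using fin[of n] e by (subst Max_le_iff) auto
      moreover have "Max (insert 0 ((\<lambda>m. Inf (D n m)) ` {m. R n m})) \<ge> 0"
        using fin[of n] by (intro Max_ge) auto
      moreover have "1 / real (Suc n) > 0" by simp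
      ultimately show ?case using elim unfolding \<eta>_def real_norm_def by linarith
    qed
    then show "\<exists>no. \<forall>n\<ge>no. norm (\<eta> n - 0) < e" by (simp add: eventually_sequentially)
  qed
  moreover have "\<exists>d. \<bar>d\<bar> \<le> \<eta> n \<and> P n m d" if "R n m" for n m
  proof -
    have ne: "D n m \<noteq> {}" using ex[OF that] by (auto simp: D_def)
    have "Inf (D n m) < Inf (D n m) + 1 / real (Suc n)" by simp
    then obtain a where a: "a \<in> D n m" "a < Inf (D n m) + 1 / real (Suc n)"
      using cInf_lessD[OF ne] by blast
    moreover have "Inf (D n m) \<le> Max (insert 0 ((\<lambda>m. Inf (D n m)) ` {m. R n m}))"
      using fin[of n] that by (intro Max_ge) auto
    ultimately have "a \<le> \<eta> n" unfolding \<eta>_def by linarith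
    then show ?thesis using a by (auto simp: D_def)
  qed
  ultimately show ?thesis by blast
qed

text \<open>Continuity at the point where \<open>A\<close>, \<open>A0\<close> and \<open>W\<close>
  are 1 and \<open>t\<close> is 0; it merges all error factors into one
  \<open>\<delta>\<close>.\<close>

lemma perturbation_near_one:
  fixes e :: real assumes "e > 0"
  shows "\<exists>d>0. \<forall>A A0 W t :: real. \<bar>A - 1\<bar> \<le> d \<longrightarrow> \<bar>A0 - 1\<bar> \<le> d \<longrightarrow> \<bar>W - 1\<bar> \<le> d \<longrightarrow> \<bar>t\<bar> \<le> d \<longrightarrow>
    A0 \<noteq> 0 \<and> \<bar>A / A0 * sqrt (1 / W) * exp (- t) - 1\<bar> \<le> e"
proof -
  define f :: "(real \<times> real) \<times> (real \<times> real) \<Rightarrow> real"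
    where "f p = fst (fst p) / snd (fst p) * sqrt (1 / fst (snd p)) * exp (- snd (snd p))" for p
  have "isCont f ((1, 1), (1, 0))"
    unfolding f_def by (intro continuous_intros) auto
  then obtain d where d: "d > 0"
    "\<And>p. p \<noteq> ((1, 1), (1, 0)) \<Longrightarrow> dist p ((1, 1), (1, 0)) < d \<Longrightarrow> dist (f p) (f ((1, 1), (1, 0))) < e"
    using assms unfolding isCont_def LIM_def by blast
  have f1: "f ((1, 1), (1, 0)) = 1" by (simp add: f_def)
  have d2: "dist (f p) 1 < e" if "dist p ((1, 1), (1, 0)) < d" for p
    using d(2)[of p] that f1 assms by (cases "p = ((1, 1), (1, 0))") auto
  \<comment> \<open>Four deviations of at most \<open>d'\<close> add up to less than
    \<open>d\<close>, and \<open>1 / 2\<close> keeps \<open>A0\<close> away from 0.\<close>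
  define d' where "d' = min (1 / 2) (d / 8)"
  show ?thesis
  proof (intro exI[of _ d'] conjI allI impI)
    show "d' > 0" using d by (simp add: d'_def)
    fix A A0 W t :: real
    assume *: "\<bar>A - 1\<bar> \<le> d'" "\<bar>A0 - 1\<bar> \<le> d'" "\<bar>W - 1\<bar> \<le> d'" "\<bar>t\<bar> \<le> d'"
    show "A0 \<noteq> 0" using *(2) by (auto simp: d'_def)
    have "dist ((A, A0), (W, t)) ((1, 1), (1, 0)) \<le> dist (A, A0) (1, 1) + dist (W, t) (1, 0)"
      unfolding dist_Pair_Pair[of "(A, A0)"] by (rule sqrt_sum_squares_le_sum) auto
    also have "dist (A, A0) (1, 1) \<le> dist A 1 + dist A0 1"
      unfolding dist_Pair_Pair by (rule sqrt_sum_squares_le_sum) auto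
    also have "dist (W, t) (1, 0) \<le> dist W 1 + dist t 0"
      unfolding dist_Pair_Pair by (rule sqrt_sum_squares_le_sum) auto
    finally have "dist ((A, A0), (W, t)) ((1, 1), (1, 0)) \<le> 4 * d'"
      using * by (simp add: dist_real_def)
    also have "\<dots> < d" using d by (simp add: d'_def min_def)
    finally have "dist (f ((A, A0), (W, t))) 1 < e" by (rule d2)
    then show "\<bar>A / A0 * sqrt (1 / W) * exp (- t) - 1\<bar> \<le> e"
      by (simp add: f_def dist_real_def)
  qed
qed

text \<open>The last two bounds confine \<open>n powr (1 / m)\<close>, and with it the saddle point,
  strictly between \<open>sqrt q\<close> and \<open>q\<close>. The case \<open>n = 1\<close> is
  excluded because it would force \<open>m \<le> 0\<close>, and the two bounds on \<open>m\<close>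
  are compatible only for \<open>\<epsilon> \<le> 1 / 2\<close>.\<close>

lemma in_range_bounds:
  fixes q \<epsilon> :: real and n m :: nat
  assumes q: "q > 1" and \<epsilon>: "\<epsilon> > 0" and nm: "0 < n" "0 < m"
    and up: "real m \<le> (2 - \<epsilon>) * log q (real n)" and lo: "(1 + \<epsilon>) * log q (real n) \<le> real m"
  shows "n > 1" "\<epsilon> \<le> 1 / 2" "log q n \<le> m" "m \<le> 2 * log q n"
    "n / q ^ m \<le> n powr (- \<epsilon>)" "n \<le> (q powr (1 / (1 + \<epsilon>))) ^ m" "(q powr (1 / (2 - \<epsilon>))) ^ m \<le> n"
proof -
  have L0: "log q n \<ge> 0" using q nm by simp
  have L: "log q n > 0"
  proof (rule ccontr)
    assume "\<not> ?thesis"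
    then have "log q n = 0" using L0 by simp
    then show False using up nm by simp
  qed
  then show "n > 1" using nm q by (cases "n = 1") auto
  have "(1 + \<epsilon>) * log q n \<le> (2 - \<epsilon>) * log q n" using up lo by linarith
  then show e: "\<epsilon> \<le> 1 / 2" using L by simp
  have eL: "\<epsilon> * log q n > 0" using L \<epsilon> by simp
  then show "log q n \<le> m" using lo by (simp add: algebra_simps)
  show "m \<le> 2 * log q n" using eL up by (simp add: algebra_simps)
  have nq: "real n = q powr log q n" using q nm by simp
  have qm: "q powr (real m) = q ^ m" using q by (simp add: powr_realpow)
  have "n powr (1 + \<epsilon>) = q powr ((1 + \<epsilon>) * log q n)"
    by (subst nq) (simp add: powr_powr mult.commute)
  also have "\<dots> \<le> q powr m" using lo q by (intro powr_mono) auto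
  finally have "n powr (1 + \<epsilon>) \<le> q ^ m" by (simp add: qm)
  then have "n / q ^ m \<le> n / n powr (1 + \<epsilon>)"
    using nm q by (intro divide_left_mono) auto
  also have "\<dots> = n powr (- \<epsilon>)"
    using nm by (simp add: powr_add powr_minus field_simps)
  finally show "n / q ^ m \<le> n powr (- \<epsilon>)" .
  have pw: "(q powr a) ^ m = q powr (a * m)" for a
    using q by (simp add: powr_powr flip: powr_realpow)
  have "log q n \<le> 1 / (1 + \<epsilon>) * m" using lo \<epsilon> by (simp add: field_simps)
  then show "n \<le> (q powr (1 / (1 + \<epsilon>))) ^ m"
    unfolding pw using q by (subst nq) (intro powr_mono, auto)
  have "1 / (2 - \<epsilon>) * m \<le> log q n" using up e by (simp add: field_simps)
  then show "(q powr (1 / (2 - \<epsilon>))) ^ m \<le> n"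
    unfolding pw using q by (subst nq) (intro powr_mono, auto)
qed

text \<open>Otherwise each of the \<open>m\<close> terms would be at most
  \<open>y0 ^ m\<close>.\<close>

lemma power_sum_base_ge:
  fixes x y0 y2 :: real
  assumes y: "1 < y0" "0 < x" and big: "real m * y0 ^ m < y2 ^ m"
    and sum: "y2 ^ m \<le> (\<Sum>i=1..m. x ^ i)"
  shows "y0 \<le> x"
proof (rule ccontr)
  assume "\<not> ?thesis"
  then have "(\<Sum>i=1..m. x ^ i) \<le> (\<Sum>i=1..m. y0 ^ m)"
    using y by (intro sum_mono order_trans[OF power_mono power_increasing]) auto
  then show False using big sum by simp
qed

lemma eventually_mult_power_less:
  fixes y0 y2 :: real
  assumes "0 < y0" "y0 < y2"
  shows "\<forall>\<^sub>F m in sequentially. real m * y0 ^ m < y2 ^ m"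
proof -
  have "(\<lambda>m. real m * (y0 / y2) ^ m) \<longlonglongrightarrow> 0"
    using assms by (intro powser_times_n_limit_0) auto
  then have "\<forall>\<^sub>F m in sequentially. real m * (y0 / y2) ^ m < 1"
    by (rule order_tendstoD(2)) simp
  then show ?thesis
    by eventually_elim (use assms in \<open>simp add: power_divide field_simps\<close>)
qed


text \<open>The local limit error with \<open>m\<close> replaced by its upper bound
  \<open>2 * log q n\<close>, where \<open>k\<close> stands for \<open>ln q\<close>.\<close>

lemma error_bound_tendsto_0:
  fixes k K1 K2 K3 :: real
  assumes "k > 0" "K3 > 0"
  shows "(\<lambda>n. K1 * sqrt (2 * (ln (real n) / k) / n) +
    K2 * (sqrt n * (2 * (ln (real n) / k)) * exp (- (K3 * (n / (2 * (ln (real n) / k)) ^ 3))))) \<longlonglongrightarrow> 0"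
  using assms by real_asymp

theorem theorem1p9:
  fixes q :: nat and \<epsilon> :: real
  assumes "CARD('a::{finite,field}) = q" and "\<epsilon> > 0"
  shows "\<exists>c C :: real. 0 < c \<and> c < C \<and>
    (\<exists>\<eta> :: nat \<Rightarrow> real. \<eta> \<longlonglongrightarrow> 0 \<and>
      (\<forall>n m :: nat. 0 < n \<longrightarrow> 0 < m \<longrightarrow>
        real m \<le> (2 - \<epsilon>) * log (real q) (real n) \<longrightarrow>
        (1 + \<epsilon>) * log (real q) (real n) \<le> real m \<longrightarrow>
        (\<exists>\<delta> \<theta> :: real. \<bar>\<delta>\<bar> \<le> \<eta> n \<and> c \<le> \<theta> \<and> \<theta> \<le> C \<and>
          smooth_poly_prob TYPE('a) n m / smooth_perm_prob n m =
            (1 + \<delta>) * Gq TYPE('a) m (saddle n m) *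
              exp (- \<theta> * (real n ^ 3 / (real m * real q ^ (2 * m)))))))"
proof -
  define R where "R n m \<longleftrightarrow> 0 < n \<and> 0 < m \<and> real m \<le> (2 - \<epsilon>) * log (real q) (real n) \<and>
    (1 + \<epsilon>) * log (real q) (real n) \<le> real m" for n m :: nat
  have q2: "real q \<ge> 2" using card_field_ge_2[where 'a = 'a] assms(1) by simp
  then have q: "real q > 1" by simp
  note range = in_range_bounds[OF q assms(2)]
  show ?thesis
  proof (cases "\<epsilon> \<le> 1 / 2")
    case False
    then have "\<not> R n m" for n m using range(2) by (auto simp: R_def)
    then show ?thesis
      by (intro exI[of _ 1] exI[of _ 2] conjI exI[of _ "\<lambda>_. 0"]) (auto simp: R_def)
  next
    case True
    \<comment> \<open>\<open>y1\<close> bounds the saddle point from above because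
      \<open>x ^ m \<le> n\<close>. From below only \<open>y2 ^ m \<le> n \<le> m * x ^ m\<close> is
      available when \<open>x \<ge> 1\<close>; the exponent with \<open>\<epsilon> / 2\<close> puts
      \<open>y0\<close> strictly between \<open>sqrt q\<close> and \<open>y2\<close>, which leaves
      room for the factor \<open>m\<close>. \<open>s0\<close> is the resulting ratio of the
      geometric decay around \<open>2 * m\<close>.\<close>
    define y0 where "y0 = real q powr (1 / (2 - \<epsilon> / 2))"
    define y1 where "y1 = real q powr (1 / (1 + \<epsilon>))"
    define y2 where "y2 = real q powr (1 / (2 - \<epsilon>))"
    define s0 where "s0 = max (sqrt q / y0) (y1 / q)"
    have sq: "sqrt q < y0"
    proof -
      have "real q powr (1 / 2) < y0"
        unfolding y0_def using q assms(2) True by (intro powr_less_mono) (auto simp: field_simps)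
      then show ?thesis using q by (simp add: powr_half_sqrt)
    qed
    have y0: "1 < y0" using sq q real_sqrt_gt_1_iff[of q] by linarith
    have y02: "y0 < y2"
      unfolding y0_def y2_def using q assms(2) True by (intro powr_less_mono) (auto simp: field_simps)
    have "y1 < real q powr 1"
      unfolding y1_def using q assms(2) by (intro powr_less_mono) (auto simp: field_simps)
    then have y1: "y1 < q" "y1 > 0" using q by (auto simp: y1_def)
    have s0: "0 \<le> s0" "s0 < 1"
      using sq y0 y1 q by (auto simp: s0_def le_max_iff_disj)
    define C where "C = 16 * (\<Sum>i. (1 + real i)\<^sup>2 * s0 ^ i)"
    define c where "c = (1 - 1 / y0) / 3"
    define c1 where "c1 = c ^ 5 / 2"
    \<comment> \<open>The summand \<open>c1 + 1\<close> merely secures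
      \<open>c1 < C1\<close>.\<close>
    define C1 where "C1 = 2 * (C / c)\<^sup>2 + c1 + 1"
    have c: "c > 0" using y0 by (simp add: c_def)
    then have c1: "c1 > 0" by (simp add: c1_def)
    have cC: "c1 < C1" by (simp add: C1_def add_nonneg_pos)
    define B where "B n m = real n ^ 3 / (real m * real q ^ (2 * m))" for n m :: nat
    define P where "P n m \<delta> \<longleftrightarrow> (\<exists>\<theta>. c1 \<le> \<theta> \<and> \<theta> \<le> C1 \<and>
      smooth_poly_prob TYPE('a) n m / smooth_perm_prob n m =
        (1 + \<delta>) * Gq TYPE('a) m (saddle n m) * exp (- \<theta> * B n m))" for n m \<delta>
    have x_le: "saddle n m \<le> y1" if "R n m" for n m
    proof -
      have nm: "0 < n" "0 < m" using that by (auto simp: R_def)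
      have "saddle n m ^ m \<le> y1 ^ m"
        using saddle_props(3)[OF nm] range(6)[of n m] that by (simp add: R_def y1_def)
      then show ?thesis using y1 nm by (simp add: power_mono_iff saddle_props(1) less_imp_le)
    qed
    have "\<exists>\<eta>::nat \<Rightarrow> real. \<eta> \<longlonglongrightarrow> 0 \<and> (\<forall>n m. R n m \<longrightarrow> (\<exists>d. \<bar>d\<bar> \<le> \<eta> n \<and> P n m d))"
    proof (rule uniform_error_function)
      show "finite {m. R n m}" for n
      proof (rule finite_subset)
        show "{m. R n m} \<subseteq> {..nat \<lfloor>(2 - \<epsilon>) * log (real q) (real n)\<rfloor>}"
          by (auto simp: R_def le_nat_floor)
      qed simp
    next
      fix n m assume r: "R n m"
      have "Gq TYPE('a) m (saddle n m) > 0"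
        by (rule Gq_series(2)) (use x_le[OF r] y1 saddle_props(1)[of n m] r assms(1) in \<open>auto simp: R_def\<close>)
      \<comment> \<open>With \<open>\<theta> = c1\<close> the equation can be solved for
        \<open>\<delta>\<close>, as \<open>Gq\<close> is positive; no bound on
        \<open>\<delta>\<close> is required at this point.\<close>
      then have "P n m (smooth_poly_prob TYPE('a) n m / smooth_perm_prob n m /
          (Gq TYPE('a) m (saddle n m) * exp (- c1 * B n m)) - 1)"
        unfolding P_def using cC by (intro exI[of _ c1]) (auto simp: mult.assoc)
      then show "\<exists>\<delta>. P n m \<delta>" by blast
    next
      fix e :: real assume "e > 0"
      then obtain d where d: "d > 0" "\<And>A A0 W t :: real. \<bar>A - 1\<bar> \<le> d \<Longrightarrow> \<bar>A0 - 1\<bar> \<le> d \<Longrightarrow> \<bar>W - 1\<bar> \<le> d \<Longrightarrow>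
          \<bar>t\<bar> \<le> d \<Longrightarrow> A0 \<noteq> 0 \<and> \<bar>A / A0 * sqrt (1 / W) * exp (- t) - 1\<bar> \<le> e"
        using perturbation_near_one[of e] by blast
      define L where "L n = 2 * (ln (real n) / ln (real q))" for n :: nat
      define K1 where "K1 = 258 * 2 / (c * sqrt c)"
      define K2 where "K2 = sqrt (2 * pi * 2)"
      define K3 where "K3 = c ^ 3 / (6 * y1 * 2\<^sup>2)"
      have K: "K1 \<ge> 0" "K2 \<ge> 0" "K3 > 0" using c y1 by (auto simp: K1_def K2_def K3_def)
      have lq: "ln (real q) > 0" using q by simp
      have r0: "(\<lambda>n. K * real n powr (- \<epsilon>)) \<longlonglongrightarrow> 0" for K
        using assms(2) by real_asymp
      obtain M where M: "\<And>m. m \<ge> M \<Longrightarrow> real m * y0 ^ m < y2 ^ m"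
        using eventually_mult_power_less[of y0 y2] y0 y02 by (auto simp: eventually_sequentially)
      have Linf: "filterlim L at_top sequentially" unfolding L_def using lq by real_asymp
      \<comment> \<open>Since \<open>m\<close> is at least \<open>log q n = L n / 2\<close>, this
        yields both \<open>m \<ge> 2\<close> and \<open>m \<ge> M\<close>.\<close>
      have "\<forall>\<^sub>F n in sequentially. L n \<ge> 4 + 2 * real M"
        using Linf by (simp add: filterlim_at_top)
      moreover have "\<forall>\<^sub>F n in sequentially. 2 * L n \<le> real n"
        unfolding L_def using lq by real_asymp
      moreover have "\<forall>\<^sub>F n in sequentially. C * real n powr (- \<epsilon>) < (1 - 1 / y0) / 2"
        by (rule order_tendstoD(2)[OF r0]) (use y0 in simp)
      moreover have "\<forall>\<^sub>F n in sequentially. C / c * real n powr (- \<epsilon>) < d"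
        by (rule order_tendstoD(2)[OF r0 d(1)])
      moreover have "\<forall>\<^sub>F n in sequentially. 2 / (1 - s0) * real n powr (- \<epsilon>) < d"
        by (rule order_tendstoD(2)[OF r0 d(1)])
      moreover have "\<forall>\<^sub>F n in sequentially.
          K1 * sqrt (L n / n) + K2 * (sqrt n * L n * exp (- (K3 * (n / L n ^ 3)))) < d"
        using order_tendstoD(2)[OF error_bound_tendsto_0[OF lq K(3)] d(1), of K1 K2] by (simp only: L_def)
      ultimately show "\<forall>\<^sub>F n in sequentially. \<forall>m. R n m \<longrightarrow> (\<exists>\<delta>. \<bar>\<delta>\<bar> \<le> e \<and> P n m \<delta>)"
      proof eventually_elim
        case (elim n)
        show ?case
        proof (intro allI impI)
          fix m assume r: "R n m"
          then have nm: "0 < n" "0 < m" by (auto simp: R_def)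
          have rng: "log q n \<le> m" "m \<le> 2 * log q n" "n / real q ^ m \<le> n powr (- \<epsilon>)" "y2 ^ m \<le> n"
            using range[OF nm] r by (auto simp: R_def y2_def)
          have Ln: "L n = 2 * log q n" by (simp add: L_def log_def)
          have Lpos: "L n > 0" "m \<le> L n" using elim(1) rng(2) Ln by auto
          have mM: "m \<ge> M" "2 \<le> m" using elim(1) rng(1) Ln by linarith+
          have "real (2 * m) \<le> real n" using rng(2) elim(2) Ln by simp
          then have mn: "2 * m \<le> n" by linarith
          define x where "x = saddle n m"
          have x: "y0 \<le> x" "x \<le> y1"
          proof -
            show "x \<le> y1" unfolding x_def by (rule x_le[OF r])
            show "y0 \<le> x" unfolding x_def
              by (rule power_sum_base_ge[OF y0 saddle_props(1)[OF nm] M[OF mM(1)]])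
                (use saddle_props(2)[OF nm] rng(4) in simp)
          qed
          have s: "sqrt q \<le> s0 * x" "x \<le> s0 * q"
          proof -
            have "sqrt q = sqrt q / y0 * y0" using y0 by simp
            also have "\<dots> \<le> s0 * x" using x y0 by (intro mult_mono) (auto simp: s0_def le_max_iff_disj)
            finally show "sqrt q \<le> s0 * x" .
            have "x \<le> y1 / q * q" using x q by simp
            also have "\<dots> \<le> s0 * q" using q by (intro mult_right_mono) (auto simp: s0_def)
            finally show "x \<le> s0 * q" .
          qed
          have C0: "C \<ge> 0"
            unfolding C_def using summable_square_times_power[OF s0] s0
            by (intro mult_nonneg_nonneg suminf_nonneg) auto
          have rr: "k * (n / real q ^ m) \<le> k * n powr (- \<epsilon>)" if "k \<ge> 0" for k
            using rng(3) that by (rule mult_left_mono)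
          have small: "C * (n / real q ^ m) \<le> (1 - 1 / y0) / 2"
            using rr[OF C0] elim(3) by linarith
          define err where "err = K1 * sqrt (m / n) + K2 * (sqrt n * m * exp (- (K3 * (n / real m ^ 3))))"
          have "err \<le> K1 * sqrt (L n / n) + K2 * (sqrt n * L n * exp (- (K3 * (n / L n ^ 3))))"
          proof -
            have "sqrt (m / n) \<le> sqrt (L n / n)" using Lpos by (simp add: divide_right_mono)
            moreover have "K3 * (n / L n ^ 3) \<le> K3 * (n / real m ^ 3)"
              using Lpos nm K by (intro mult_left_mono divide_left_mono power_mono) auto
            ultimately show ?thesis
              unfolding err_def using K Lpos
              by (intro add_mono mult_left_mono mult_mono) (auto simp: mult_left_mono)
          qed
          then have err: "err \<le> d" using elim(6) by linarith
          obtain A A0 W t E where *: "\<bar>A - 1\<bar> \<le> err" "\<bar>A0 - 1\<bar> \<le> err" "\<bar>W - 1\<bar> \<le> C / c * (n / real q ^ m)"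
            "0 \<le> t" "t \<le> 2 / (1 - s0) * (n / real q ^ m)" "c ^ 5 / 2 * B n m \<le> E" "E \<le> 2 * (C / c)\<^sup>2 * B n m"
            "A0 \<noteq> 0 \<Longrightarrow> smooth_poly_prob TYPE('a) n m / smooth_perm_prob n m =
              A / A0 * sqrt (1 / W) * exp (- t) * Gq TYPE('a) m x * exp (- E)"
            using smooth_ratio_expansion[where 'a = 'a, OF mM(2) mn y0, of y1 s0] x s s0 small
            unfolding assms(1) err_def K1_def K2_def K3_def B_def C_def c_def x_def by blast
          have "\<bar>W - 1\<bar> \<le> d" using *(3) rr[of "C / c"] C0 c elim(4) by simp
          moreover have "\<bar>t\<bar> \<le> d" using *(4,5) rr[of "2 / (1 - s0)"] s0 elim(5) by simp
          ultimately have pert: "A0 \<noteq> 0" "\<bar>A / A0 * sqrt (1 / W) * exp (- t) - 1\<bar> \<le> e"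
            using d(2)[of A A0 W t] *(1,2) err by auto
          have B0: "B n m > 0" using nm q by (simp add: B_def)
          have "P n m (A / A0 * sqrt (1 / W) * exp (- t) - 1)"
            unfolding P_def
          \<comment> \<open>\<open>E\<close> lies between constant multiples of
            \<open>B n m\<close>, so this choice of \<open>\<theta>\<close> represents the loss
            exactly and \<open>\<delta>\<close> carries only the factors close to 1.\<close>
          proof (intro exI[of _ "E / B n m"] conjI)
            show "c1 \<le> E / B n m" using *(6) B0 by (simp add: c1_def pos_le_divide_eq)
            have "E / B n m \<le> 2 * (C / c)\<^sup>2" using *(7) B0 by (simp add: pos_divide_le_eq)
            then show "E / B n m \<le> C1" using c1 by (simp add: C1_def)
            show "smooth_poly_prob TYPE('a) n m / smooth_perm_prob n m =
              (1 + (A / A0 * sqrt (1 / W) * exp (- t) - 1)) * Gq TYPE('a) m (saddle n m) * exp (- (E / B n m) * B n m)"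
              using *(8)[OF pert(1)] B0 by (simp add: x_def)
          qed
          then show "\<exists>\<delta>. \<bar>\<delta>\<bar> \<le> e \<and> P n m \<delta>" using pert(2) by blast
        qed
      qed
    qed
    then obtain \<eta> :: "nat \<Rightarrow> real" where \<eta>: "\<eta> \<longlonglongrightarrow> 0" "\<And>n m. R n m \<Longrightarrow> \<exists>d. \<bar>d\<bar> \<le> \<eta> n \<and> P n m d"
      by blast
    show ?thesis
    proof (rule exI[of _ c1], rule exI[of _ C1], intro conjI c1 cC, rule exI[of _ \<eta>], intro conjI \<eta>(1) allI impI)
      fix n m :: nat
      assume "0 < n" "0 < m" "real m \<le> (2 - \<epsilon>) * log (real q) (real n)"
        "(1 + \<epsilon>) * log (real q) (real n) \<le> real m"
      then have "R n m" by (simp add: R_def)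
      from \<eta>(2)[OF this] show "\<exists>\<delta> \<theta> :: real. \<bar>\<delta>\<bar> \<le> \<eta> n \<and> c1 \<le> \<theta> \<and> \<theta> \<le> C1 \<and>
          smooth_poly_prob TYPE('a) n m / smooth_perm_prob n m =
            (1 + \<delta>) * Gq TYPE('a) m (saddle n m) *
              exp (- \<theta> * (real n ^ 3 / (real m * real q ^ (2 * m))))"
        unfolding P_def B_def by blast
    qed
  qed
qed

end
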